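(* Let $\nu>0$, $\epsilon>0$, $f\in X'$, and set $\kappa:=\nu^{-2}M\|f\|_{-1}$. For $(u,p)\in(X_h,Q_h)$ let $C_L=\max\{1,\ \kappa+\sqrt{\epsilon/\nu^3}\,M\|p\|\}$ and $\hat C_L=\sqrt{10}\,\nu^{-3/2}MC_L$. For $(u,p),(h,s)\in(X_h,Q_h)$ let $G'(u,p;h,s)=(G_1'(u,p;h,s),G_2'(u,p;h,s))\in(X_h,Q_h)$ be defined by requiring, for all $(v,q)\in(X_h,Q_h)$, $$\nu(\nabla G_1'(u,p;h,s),\nabla v)+b^*(h,G_1(u,p),v)+b^*(u,G_1'(u,p;h,s),v)-(G_2'(u,p;h,s),\nabla\cdot v)=0,$$ $$\epsilon(G_2'(u,p;h,s),q)+(q,\nabla\cdot G_1'(u,p;h,s))=\epsilon(s,q).$$ Then $G'$ is well defined (i.e. for all $(u,p),(h,s)\in(X_h,Q_h)$ this system has exactly one solution), and $G'(u,p;\cdot,\cdot)$ is the Fréchet derivative of $G$ at $(u,p)$ for every $(u,p)\in(X_h,Q_h)$. Moreover, for all $(u,p),(h,s),(w,z)\in(X_h,Q_h)$, $$\|G'(u,p;h,s)\|_X\le C_L\|(h,s)\|_X$$ and $$\|G'(u+h,p+s;w,z)-G'(u,p;w,z)\|_X\le\hat C_L\,\|(w,z)\|_X\,\|(h,s)\|_X.$$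
   Context: $\Omega\subset\mathbb{R}^d$ ($d=2,3$) is open and connected with Lipschitz boundary; $(\cdot,\cdot)$ and $\|\cdot\|$ denote the $L^2(\Omega)$ inner product and norm (for scalar-, vector- or matrix-valued functions). $X=H_0^1(\Omega)$ ($\mathbb{R}^d$-valued), on which the Poincaré inequality $\|\phi\|\le C_P\|\nabla\phi\|$ holds; $Q=L^2_0(\Omega)$ is the space of scalar $L^2$ functions with zero mean. $X'$ is the dual of $X$, with norm $\|\cdot\|_{-1}$ dual to the norm $v\mapsto\|\nabla v\|$ on $X$, and $(f,v)$ denotes the duality pairing for $f\in X'$. $\tau_h$ is a conforming, shape-regular simplicial triangulation of $\Omega$, $X_h$ is the finite-dimensional subspace of $X$ of vector-valued globally continuous functions that are piecewise polynomial of a fixed degree on $\tau_h$, and $Q_h=\nabla\cdot X_h\subseteq Q$. No inf-sup condition on $(X_h,Q_h)$ is assumed. We write $(X_h,Q_h)$ for $X_h\times Q_h$. (In the claim $h$ denotes an element of $X_h$, the direction of differentiation, not the mesh size.) The trilinear form is $b^*(u,v,w)=\tfrac12(u\cdot\nabla v,w)-\tfrac12(u\cdot\nabla w,v)$ for $u,v,w\in X$, and $M>0$ is a constant (depending only on $\Omega$) such that $b^*(u,v,w)\le M\|\nabla u\|\|\nabla v\|\|\nabla w\|$ for all $u,v,w\in X$. The norm on $(X_h,Q_h)$ is $\|(v,q)\|_X:=\sqrt{\nu\|\nabla v\|^2+\epsilon\|q\|^2}$. The iterated penalty Picard operator $G:(X_h,Q_h)\to(X_h,Q_h)$, $G(u,p)=(G_1(u,p),G_2(u,p))$,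 is defined by: for all $(v,q)\in(X_h,Q_h)$, $$\nu(\nabla G_1(u,p),\nabla v)+b^*(u,G_1(u,p),v)-(G_2(u,p),\nabla\cdot v)=(f,v),$$ $$\epsilon(G_2(u,p),q)+(\nabla\cdot G_1(u,p),q)=\epsilon(p,q)$$ (this linear system has a unique solution for each $(u,p)$). *)

theory Defs
  imports "HOL-Analysis.Analysis" "HOL-Library.Function_Algebras"
begin

text \<open>
  Functions on a domain are represented by total functions on \<^typ>\<open>real^'n\<close>, of which only the
  values on the domain matter, and members of L2 and Sobolev spaces are handled through
  representatives: as in the library's Bochner integration, two functions are the same element when
  they agree almost everywhere on the domain. The pointwise vector space structure below (with the
  one for pairs from the library) makes expressions such as \<open>(u, p) + (h, s)\<close> available.
\<close>

instantiation "fun" :: (type, scaleR) scaleR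
begin
definition scaleR_fun_def: "r *\<^sub>R f = (\<lambda>x. r *\<^sub>R f x)"
instance ..
end

lemma scaleR_fun_apply [simp]: "(r *\<^sub>R f) x = r *\<^sub>R f x"
  by (simp add: scaleR_fun_def)

instance "fun" :: (type, real_vector) real_vector
  by standard (simp_all add: fun_eq_iff algebra_simps)


section \<open>Square-integrable functions\<close>

definition L2 :: "(real^'n) set \<Rightarrow> (real^'n \<Rightarrow> 'b::euclidean_space) set" where
  "L2 \<Omega> = {f. f \<in> borel_measurable (lebesgue_on \<Omega>) \<and> integrable (lebesgue_on \<Omega>) (\<lambda>x. (norm (f x))\<^sup>2)}"

text \<open>On matrices \<^typ>\<open>real^'n^'n\<close> the library's inner product is the Frobenius product.\<close>

definition L2_inner :: "(real^'n) set \<Rightarrow> (real^'n \<Rightarrow> 'b::euclidean_space) \<Rightarrow> (real^'n \<Rightarrow> 'b) \<Rightarrow> real" where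
  "L2_inner \<Omega> f g = (\<integral>x. f x \<bullet> g x \<partial>lebesgue_on \<Omega>)"

definition L2_norm :: "(real^'n) set \<Rightarrow> (real^'n \<Rightarrow> 'b::euclidean_space) \<Rightarrow> real" where
  "L2_norm \<Omega> f = sqrt (L2_inner \<Omega> f f)"

definition ae_eq :: "(real^'n) set \<Rightarrow> (real^'n \<Rightarrow> 'b) \<Rightarrow> (real^'n \<Rightarrow> 'b) \<Rightarrow> bool" where
  "ae_eq \<Omega> f g \<longleftrightarrow> (AE x in lebesgue_on \<Omega>. f x = g x)"


section \<open>Test functions, weak gradients and the space of vanishing trace\<close>

definition partial :: "'n \<Rightarrow> (real^'n \<Rightarrow> real) \<Rightarrow> real^'n \<Rightarrow> real" where
  "partial j \<phi> x = frechet_derivative \<phi> (at x) (axis j 1)"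

primrec Ck :: "nat \<Rightarrow> (real^'n \<Rightarrow> real) \<Rightarrow> bool" where
  "Ck 0 \<phi> \<longleftrightarrow> continuous_on UNIV \<phi>"
| "Ck (Suc k) \<phi> \<longleftrightarrow> (\<forall>x. \<phi> differentiable at x) \<and> (\<forall>j. Ck k (partial j \<phi>))"

definition test_functions :: "(real^'n) set \<Rightarrow> (real^'n \<Rightarrow> real) set" where
  "test_functions \<Omega> =
    {\<phi>. (\<forall>k. Ck k \<phi>) \<and> compact (closure {x. \<phi> x \<noteq> 0}) \<and> closure {x. \<phi> x \<noteq> 0} \<subseteq> \<Omega>}"

definition test_fields :: "(real^'n) set \<Rightarrow> (real^'n \<Rightarrow> real^'n) set" where
  "test_fields \<Omega> = {\<phi>. \<forall>i. (\<lambda>x. \<phi> x $ i) \<in> test_functions \<Omega>}"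

text \<open>Row \<open>i\<close>, column \<open>j\<close> of the gradient of \<open>u\<close> is the \<open>j\<close>-th partial derivative of \<open>u\<^sub>i\<close>.\<close>

definition weak_gradient :: "(real^'n) set \<Rightarrow> (real^'n \<Rightarrow> real^'n) \<Rightarrow> (real^'n \<Rightarrow> real^'n^'n) \<Rightarrow> bool" where
  "weak_gradient \<Omega> u W \<longleftrightarrow>
    (\<forall>\<phi>\<in>test_functions \<Omega>. \<forall>i j.
      (\<integral>x. u x $ i * partial j \<phi> x \<partial>lebesgue_on \<Omega>) = - (\<integral>x. W x $ i $ j * \<phi> x \<partial>lebesgue_on \<Omega>))"

definition H1 :: "(real^'n) set \<Rightarrow> (real^'n \<Rightarrow> real^'n) set" where
  "H1 \<Omega> = {u \<in> L2 \<Omega>. \<exists>W \<in> L2 \<Omega>. weak_gradient \<Omega> u W}"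

text \<open>The weak gradient is unique up to null sets; \<open>grad\<close> is a representative of it.\<close>

definition grad :: "(real^'n) set \<Rightarrow> (real^'n \<Rightarrow> real^'n) \<Rightarrow> real^'n \<Rightarrow> real^'n^'n" where
  "grad \<Omega> u = (SOME W. W \<in> L2 \<Omega> \<and> weak_gradient \<Omega> u W)"

definition divergence :: "(real^'n) set \<Rightarrow> (real^'n \<Rightarrow> real^'n) \<Rightarrow> real^'n \<Rightarrow> real" where
  "divergence \<Omega> u x = trace (grad \<Omega> u x)"

definition H10 :: "(real^'n) set \<Rightarrow> (real^'n \<Rightarrow> real^'n) set" where
  "H10 \<Omega> = {u \<in> H1 \<Omega>. \<exists>\<phi>. (\<forall>n::nat. \<phi> n \<in> test_fields \<Omega>) \<and>
      (\<lambda>n. L2_norm \<Omega> (\<phi> n - u)) \<longlonglongrightarrow> 0 \<and>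
      (\<lambda>n. L2_norm \<Omega> (grad \<Omega> (\<phi> n) - grad \<Omega> u)) \<longlonglongrightarrow> 0}"


section \<open>Dual space and trilinear form\<close>

text \<open>Boundedness makes these functionals insensitive to the choice of representatives.\<close>

definition H10_dual :: "(real^'n) set \<Rightarrow> ((real^'n \<Rightarrow> real^'n) \<Rightarrow> real) set" where
  "H10_dual \<Omega> = {f.
     (\<forall>u\<in>H10 \<Omega>. \<forall>v\<in>H10 \<Omega>. \<forall>a b. f (a *\<^sub>R u + b *\<^sub>R v) = a * f u + b * f v) \<and>
     (\<exists>C. \<forall>v\<in>H10 \<Omega>. \<bar>f v\<bar> \<le> C * L2_norm \<Omega> (grad \<Omega> v))}"

text \<open>As in the library's \<^const>\<open>onorm\<close>, the zero element contributes the quotient \<open>0 / 0 = 0\<close>.\<close>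

definition dual_norm :: "(real^'n) set \<Rightarrow> ((real^'n \<Rightarrow> real^'n) \<Rightarrow> real) \<Rightarrow> real" where
  "dual_norm \<Omega> f = (SUP v\<in>H10 \<Omega>. \<bar>f v\<bar> / L2_norm \<Omega> (grad \<Omega> v))"

text \<open>\<open>grad \<Omega> v x *v u x\<close> is the value at \<open>x\<close> of the convective term, with components
  \<open>\<Sum>\<^sub>j u\<^sub>j \<partial>\<^sub>j v\<^sub>i\<close>.\<close>

definition bstar :: "(real^'n) set \<Rightarrow> (real^'n \<Rightarrow> real^'n) \<Rightarrow> (real^'n \<Rightarrow> real^'n) \<Rightarrow> (real^'n \<Rightarrow> real^'n) \<Rightarrow> real" where
  "bstar \<Omega> u v w =
     1/2 * L2_inner \<Omega> (\<lambda>x. grad \<Omega> v x *v u x) w - 1/2 * L2_inner \<Omega> (\<lambda>x. grad \<Omega> w x *v u x) v"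


section \<open>Domain, mesh and finite element spaces\<close>

text \<open>Near each boundary point, and for a suitable unit vector \<open>e\<close>, the domain is the part lying
  above the graph of a Lipschitz function of the component orthogonal to \<open>e\<close>.\<close>

definition lipschitz_boundary :: "(real^'n) set \<Rightarrow> bool" where
  "lipschitz_boundary \<Omega> \<longleftrightarrow>
    (\<forall>x\<in>frontier \<Omega>. \<exists>r>0. \<exists>e L. \<exists>\<gamma>::real^'n \<Rightarrow> real. norm e = 1 \<and> L-lipschitz_on UNIV \<gamma> \<and>
      \<Omega> \<inter> ball x r = {y \<in> ball x r. \<gamma> (y - (y \<bullet> e) *\<^sub>R e) < y \<bullet> e})"

definition inradius :: "(real^'n) set \<Rightarrow> real" where
  "inradius T = Sup {r. \<exists>x. cball x r \<subseteq> T \<and> 0 \<le> r}"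

text \<open>The library's \<^const>\<open>triangulation\<close> is conforming: two simplices meet in a common face.
  The parameter \<open>\<sigma>\<close> is the shape-regularity constant.\<close>

definition simplicial_mesh :: "(real^'n) set \<Rightarrow> real \<Rightarrow> (real^'n) set set \<Rightarrow> bool" where
  "simplicial_mesh \<Omega> \<sigma> \<T> \<longleftrightarrow>
     triangulation \<T> \<and> (\<forall>T\<in>\<T>. int CARD('n) simplex T) \<and> \<Union>\<T> = closure \<Omega> \<and>
     (\<forall>T\<in>\<T>. diameter T \<le> \<sigma> * (2 * inradius T))"

text \<open>Vector-valued polynomials of total degree at most \<open>k\<close>; \<open>\<alpha>\<close> ranges over multi-indices.\<close>

definition polynomial_field :: "nat \<Rightarrow> (real^'n \<Rightarrow> real^'n) \<Rightarrow> bool" where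
  "polynomial_field k P \<longleftrightarrow>
    (\<exists>c :: ('n \<Rightarrow> nat) \<Rightarrow> real^'n.
       \<forall>x. P x = (\<Sum>\<alpha> | (\<Sum>i\<in>UNIV. \<alpha> i) \<le> k. (\<Prod>i\<in>UNIV. (x $ i) ^ \<alpha> i) *\<^sub>R c \<alpha>))"

definition fe_velocity :: "(real^'n) set \<Rightarrow> (real^'n) set set \<Rightarrow> nat \<Rightarrow> (real^'n \<Rightarrow> real^'n) set" where
  "fe_velocity \<Omega> \<T> k =
     {v \<in> H10 \<Omega>. continuous_on (closure \<Omega>) v \<and>
        (\<forall>T\<in>\<T>. \<exists>P. polynomial_field k P \<and> (\<forall>x\<in>T. v x = P x))}"

definition fe_pressure :: "(real^'n) set \<Rightarrow> (real^'n \<Rightarrow> real^'n) set \<Rightarrow> (real^'n \<Rightarrow> real) set" where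
  "fe_pressure \<Omega> X\<^sub>h = {q \<in> L2 \<Omega>. \<exists>v\<in>X\<^sub>h. ae_eq \<Omega> q (divergence \<Omega> v)}"

definition norm_X :: "(real^'n) set \<Rightarrow> real \<Rightarrow> real \<Rightarrow> (real^'n \<Rightarrow> real^'n) \<times> (real^'n \<Rightarrow> real) \<Rightarrow> real" where
  "norm_X \<Omega> \<nu> \<epsilon> = (\<lambda>(v, q). sqrt (\<nu> * (L2_norm \<Omega> (grad \<Omega> v))\<^sup>2 + \<epsilon> * (L2_norm \<Omega> q)\<^sup>2))"


section \<open>The iterated penalty Picard operator and its linearization\<close>

text \<open>The two systems, as relations between the data and a candidate solution \<open>(g, r)\<close>, and the
  operators selecting a representative of the solution.\<close>

definition picard_system ::
  "(real^'n) set \<Rightarrow> (real^'n \<Rightarrow> real^'n) set \<Rightarrow> (real^'n \<Rightarrow> real) set \<Rightarrow> real \<Rightarrow> real \<Rightarrow>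
   ((real^'n \<Rightarrow> real^'n) \<Rightarrow> real) \<Rightarrow> (real^'n \<Rightarrow> real^'n) \<times> (real^'n \<Rightarrow> real) \<Rightarrow>
   (real^'n \<Rightarrow> real^'n) \<times> (real^'n \<Rightarrow> real) \<Rightarrow> bool" where
  "picard_system \<Omega> X\<^sub>h Q\<^sub>h \<nu> \<epsilon> f = (\<lambda>(u, p) (g, r).
     g \<in> X\<^sub>h \<and> r \<in> Q\<^sub>h \<and>
     (\<forall>v\<in>X\<^sub>h. \<nu> * L2_inner \<Omega> (grad \<Omega> g) (grad \<Omega> v) + bstar \<Omega> u g v
              - L2_inner \<Omega> r (divergence \<Omega> v) = f v) \<and>
     (\<forall>q\<in>Q\<^sub>h. \<epsilon> * L2_inner \<Omega> r q + L2_inner \<Omega> (divergence \<Omega> g) q = \<epsilon> * L2_inner \<Omega> p q))"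

definition picard ::
  "(real^'n) set \<Rightarrow> (real^'n \<Rightarrow> real^'n) set \<Rightarrow> (real^'n \<Rightarrow> real) set \<Rightarrow> real \<Rightarrow> real \<Rightarrow>
   ((real^'n \<Rightarrow> real^'n) \<Rightarrow> real) \<Rightarrow> (real^'n \<Rightarrow> real^'n) \<times> (real^'n \<Rightarrow> real) \<Rightarrow>
   (real^'n \<Rightarrow> real^'n) \<times> (real^'n \<Rightarrow> real)" where
  "picard \<Omega> X\<^sub>h Q\<^sub>h \<nu> \<epsilon> f up = (SOME gr. picard_system \<Omega> X\<^sub>h Q\<^sub>h \<nu> \<epsilon> f up gr)"

definition picard_deriv_system ::
  "(real^'n) set \<Rightarrow> (real^'n \<Rightarrow> real^'n) set \<Rightarrow> (real^'n \<Rightarrow> real) set \<Rightarrow> real \<Rightarrow> real \<Rightarrow>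
   ((real^'n \<Rightarrow> real^'n) \<Rightarrow> real) \<Rightarrow> (real^'n \<Rightarrow> real^'n) \<times> (real^'n \<Rightarrow> real) \<Rightarrow>
   (real^'n \<Rightarrow> real^'n) \<times> (real^'n \<Rightarrow> real) \<Rightarrow>
   (real^'n \<Rightarrow> real^'n) \<times> (real^'n \<Rightarrow> real) \<Rightarrow> bool" where
  "picard_deriv_system \<Omega> X\<^sub>h Q\<^sub>h \<nu> \<epsilon> f = (\<lambda>(u, p) (h, s) (g, r).
     g \<in> X\<^sub>h \<and> r \<in> Q\<^sub>h \<and>
     (\<forall>v\<in>X\<^sub>h. \<nu> * L2_inner \<Omega> (grad \<Omega> g) (grad \<Omega> v)
              + bstar \<Omega> h (fst (picard \<Omega> X\<^sub>h Q\<^sub>h \<nu> \<epsilon> f (u, p))) v + bstar \<Omega> u g v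
              - L2_inner \<Omega> r (divergence \<Omega> v) = 0) \<and>
     (\<forall>q\<in>Q\<^sub>h. \<epsilon> * L2_inner \<Omega> r q + L2_inner \<Omega> q (divergence \<Omega> g) = \<epsilon> * L2_inner \<Omega> s q))"

definition picard_deriv ::
  "(real^'n) set \<Rightarrow> (real^'n \<Rightarrow> real^'n) set \<Rightarrow> (real^'n \<Rightarrow> real) set \<Rightarrow> real \<Rightarrow> real \<Rightarrow>
   ((real^'n \<Rightarrow> real^'n) \<Rightarrow> real) \<Rightarrow> (real^'n \<Rightarrow> real^'n) \<times> (real^'n \<Rightarrow> real) \<Rightarrow>
   (real^'n \<Rightarrow> real^'n) \<times> (real^'n \<Rightarrow> real) \<Rightarrow>
   (real^'n \<Rightarrow> real^'n) \<times> (real^'n \<Rightarrow> real)" where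
  "picard_deriv \<Omega> X\<^sub>h Q\<^sub>h \<nu> \<epsilon> f up hs = (SOME gr. picard_deriv_system \<Omega> X\<^sub>h Q\<^sub>h \<nu> \<epsilon> f up hs gr)"


section \<open>Frechet derivatives on a normed space given by representatives\<close>

text \<open>The library's \<open>has_derivative\<close> needs the norm to come from the type. Here the normed
  space is a linear subspace \<open>V\<close> of representatives with a norm \<open>N\<close> that separates points only up
  to the identification of representatives; hence linearity is stated modulo the kernel of \<open>N\<close>.\<close>

definition frechet_derivative_on ::
  "('v::real_vector \<Rightarrow> real) \<Rightarrow> 'v set \<Rightarrow> ('v \<Rightarrow> 'v) \<Rightarrow> ('v \<Rightarrow> 'v) \<Rightarrow> 'v \<Rightarrow> bool" where
  "frechet_derivative_on N V F D x \<longleftrightarrow>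
     (\<forall>h\<in>V. D h \<in> V) \<and>
     (\<forall>h\<in>V. \<forall>k\<in>V. \<forall>a b. N (D (a *\<^sub>R h + b *\<^sub>R k) - (a *\<^sub>R D h + b *\<^sub>R D k)) = 0) \<and>
     (\<exists>C. \<forall>h\<in>V. N (D h) \<le> C * N h) \<and>
     (\<forall>e>0. \<exists>\<delta>>0. \<forall>h\<in>V. N h < \<delta> \<longrightarrow> N (F (x + h) - F x - D h) \<le> e * N h)"

end

(* Since the divergence of X_h is Q_h, the second equation determines the pressure as p - div g / epsilon,
   and the systems become coercive problems for the velocity g, because b*(u, g, g) = 0; in finite
   dimension these have solutions. Testing a system with its own solution gives the energy
   identity, hence the bound of the velocity of G(u, p) by nu^-1 |f| + sqrt(epsilon/nu) |p| and the bound
   of G'(u, p) by C_L. The increment of G along (h, s) solves the system of the derivative with u + h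
   in place of u, so it obeys the same bound; the remainder of the linearization and the difference of
   two derivatives solve systems with zero pressure data whose right-hand sides are products of two
   such quantities. This gives quadratic smallness and the Lipschitz bound, with 2 in place of sqrt 10.
   Linearity of all forms rests on the uniqueness of weak gradients. *)

theory Submission
  imports Defs
begin

section \<open>The linear penalty problem in semi-inner product spaces\<close>

text \<open>Elements of \<open>X\<^sub>h\<close> and \<open>Q\<^sub>h\<close> are functions on the
  whole space of which only the values on the domain count, up to null sets. So all norms are
  seminorms, the divergence is additive only almost everywhere, and \<open>X\<^sub>h\<close> is
  infinite-dimensional as a set of functions. Hence the abstract problem uses semi-inner products,
  linearity is asked only of forms on a subspace, and finite dimension means a finite set whose span
  reaches every velocity up to an element of vanishing seminorm and divergence. A non-integrable
  function has integral 0 by convention, so the trilinear form is linear only where its integrands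
  are integrable. That follows without Sobolev embeddings: velocities are continuous on the closure
  of the domain, which is a finite union of simplices, so they are bounded there. Skew-symmetry
  removes the convecting velocity from every estimate, and a solution for one convecting velocity
  solves the system for another up to a source term. Each comparison is made at the velocity whose
  sources are controlled by G(u, p) alone, not by G(u + h, p + s); this is why the constants contain
  p and not s.\<close>

definition linear_form_on :: "'a::real_vector set \<Rightarrow> ('a \<Rightarrow> real) \<Rightarrow> bool" where
  "linear_form_on S l \<longleftrightarrow>
    (\<forall>u\<in>S. \<forall>v\<in>S. l (u + v) = l u + l v) \<and> (\<forall>t. \<forall>u\<in>S. l (t *\<^sub>R u) = t * l u)"

lemma linear_form_onI:
  assumes "\<And>u v. u \<in> S \<Longrightarrow> v \<in> S \<Longrightarrow> l (u + v) = l u + l v"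
    and "\<And>t u. u \<in> S \<Longrightarrow> l (t *\<^sub>R u) = t * l u"
  shows "linear_form_on S l"
  using assms by (simp add: linear_form_on_def)

lemma linear_form_on_add: "linear_form_on S l \<Longrightarrow> u \<in> S \<Longrightarrow> v \<in> S \<Longrightarrow> l (u + v) = l u + l v"
  and linear_form_on_scaleR: "linear_form_on S l \<Longrightarrow> u \<in> S \<Longrightarrow> l (t *\<^sub>R u) = t * l u"
  by (simp_all add: linear_form_on_def)

lemma linear_form_on_diff:
  assumes "linear_form_on S l" "subspace S" "u \<in> S" "v \<in> S"
  shows "l (u - v) = l u - l v"
proof -
  have "u - v \<in> S" using assms by (simp add: subspace_diff)
  from linear_form_on_add[OF assms(1) this assms(4)] show ?thesis by simp
qed

lemma linear_form_on_0:
  assumes "linear_form_on S l" "subspace S"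
  shows "l 0 = 0"
  using linear_form_on_scaleR[OF assms(1) subspace_0[OF assms(2)], of 0] by simp

lemma linear_form_on_eq_span:
  assumes "linear_form_on S l" "linear_form_on S l'" "subspace S" "B \<subseteq> S"
    and "\<And>v. v \<in> B \<Longrightarrow> l v = l' v" "v \<in> span B"
  shows "l v = l' v"
proof -
  have "v \<in> S \<and> l v = l' v"
    using \<open>v \<in> span B\<close>
  proof (induction rule: span_induct_alt)
    case base
    then show ?case using assms linear_form_on_0 subspace_0 by metis
  next
    case (step c x y)
    then have "x \<in> S" "c *\<^sub>R x \<in> S" using assms by (auto simp: subspace_scale)
    then show ?case
      using step assms by (simp add: linear_form_on_add linear_form_on_scaleR subspace_add)
  qed
  then show ?thesis ..
qed

text \<open>Lax--Milgram on the span of a finite set, allowing a kernel: enlarging the set by \<open>b\<close>, correct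
  the solution by a multiple of the \<open>A\<close>-orthogonal part \<open>w\<close> of \<open>b\<close>.\<close>

lemma finite_dimensional_Lax_Milgram:
  fixes A :: "'a::real_vector \<Rightarrow> 'a \<Rightarrow> real"
  assumes "finite B" "B \<subseteq> S" and S: "subspace S"
    and left: "\<And>v. v \<in> S \<Longrightarrow> linear_form_on S (\<lambda>u. A u v)"
    and right: "\<And>u. u \<in> S \<Longrightarrow> linear_form_on S (A u)"
    and ker: "\<And>u w. u \<in> S \<Longrightarrow> w \<in> S \<Longrightarrow> A w w = 0 \<Longrightarrow> A u w = 0"
    and "linear_form_on S l" "\<And>w. w \<in> S \<Longrightarrow> A w w = 0 \<Longrightarrow> l w = 0"
  shows "\<exists>u\<in>span B. \<forall>v\<in>B. A u v = l v"
  using assms(1,2,7,8)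
proof (induction B arbitrary: l rule: finite_induct)
  case empty
  then show ?case by auto
next
  case (insert b B)
  have b: "b \<in> S" and BS: "B \<subseteq> S" using insert by auto
  have span: "span B \<subseteq> S" using BS S by (simp add: span_minimal)
  from insert.IH[OF BS insert.prems(2,3)] obtain u0 where
    u0: "u0 \<in> span B" "\<forall>v\<in>B. A u0 v = l v" by blast
  \<comment> \<open>The functional is arbitrary in the induction, so it may also be
    \<open>A b\<close>: \<open>z\<close> is the \<open>A\<close>-projection of \<open>b\<close> to
    the span of \<open>B\<close>, and \<open>w = b - z\<close> satisfies \<open>A w v = 0\<close> on
    \<open>B\<close>.\<close>
  from insert.IH[OF BS right[OF b]] ker[OF b] obtain z where
    z: "z \<in> span B" "\<forall>v\<in>B. A z v = A b v" by blast
  define w where "w = b - z"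
  have S': "u0 \<in> S" "z \<in> S" "w \<in> S" using u0 z span b S by (auto simp: w_def subspace_diff)
  have b_eq: "b = w + z" by (simp add: w_def)
  have wB: "A w v = 0" if "v \<in> B" for v
    using that z BS b S' linear_form_on_diff[OF left S b S'(2)] by (auto simp: w_def)
  have zero: "linear_form_on S (\<lambda>v. 0)" by (simp add: linear_form_on_def)
  have wz: "A w z = 0"
    using linear_form_on_eq_span[OF right[OF S'(3)] zero S BS wB z(1)] by simp
  have wb: "A w b = A w w" using wz b_eq linear_form_on_add[OF right] S' by (metis add.right_neutral)
  show ?case
  proof (cases "A w w = 0")
    \<comment> \<open>Here \<open>w\<close> lies in the kernel, so \<open>b\<close> and
      \<open>z\<close> are equivalent as test elements and \<open>u0\<close> already satisfies the
      equation for \<open>b\<close>.\<close>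
    case True
    have "A u0 b = A u0 w + A u0 z" using b_eq linear_form_on_add[OF right] S' by metis
    also have "A u0 w = 0" using ker S' True by blast
    also have "A u0 z = l z"
      using linear_form_on_eq_span[OF right[OF S'(1)] insert.prems(2) S BS _ z(1)] u0 by blast
    also have "0 + l z = l w + l z" using insert.prems(3) S' True by simp
    also have "\<dots> = l b" using b_eq linear_form_on_add[OF insert.prems(2)] S' by metis
    finally have "\<forall>v\<in>insert b B. A u0 v = l v" using u0 by simp
    moreover have "u0 \<in> span (insert b B)" using u0 span_mono[of B "insert b B"] by blast
    ultimately show ?thesis by blast
  next
    case False
    define t where "t = (l b - A u0 b) / A w w"
    define u where "u = u0 + t *\<^sub>R w"
    have tw: "t *\<^sub>R w \<in> S" using S' S by (simp add: subspace_scale)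
    have Au: "A u v = A u0 v + t * A w v" if "v \<in> S" for v
      using linear_form_on_add[OF left[OF that] S'(1) tw] linear_form_on_scaleR[OF left[OF that] S'(3)]
      by (simp add: u_def)
    have "A u b = l b" using Au[OF b] wb False by (simp add: t_def)
    moreover have "A u v = l v" if "v \<in> B" for v using Au wB that u0 BS by auto
    moreover have "u \<in> span (insert b B)"
    proof -
      have "b \<in> span (insert b B)" by (simp add: span_base)
      moreover have "span B \<subseteq> span (insert b B)" by (rule span_mono) auto
      ultimately show ?thesis
        unfolding u_def w_def using u0 z by (intro span_add span_scale span_diff) auto
    qed
    ultimately show ?thesis by blast
  qed
qed

lemma sqrt_scaled_product:
  fixes x y z :: real
  assumes "0 \<le> x"
  shows "(sqrt x * y) * (sqrt x * z) = x * (y * z)"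
proof -
  have "(sqrt x * y) * (sqrt x * z) = (sqrt x * sqrt x) * (y * z)" by (simp only: ac_simps)
  then show ?thesis using assms by simp
qed

section \<open>Semi-inner products on a subspace\<close>

locale semi_inner_product =
  fixes S :: "'a::real_vector set" and a :: "'a \<Rightarrow> 'a \<Rightarrow> real"
  assumes subsp: "subspace S"
    and lin: "v \<in> S \<Longrightarrow> linear_form_on S (\<lambda>u. a u v)"
    and sym: "u \<in> S \<Longrightarrow> v \<in> S \<Longrightarrow> a u v = a v u"
    and nonneg: "u \<in> S \<Longrightarrow> 0 \<le> a u u"
begin

definition seminorm :: "'a \<Rightarrow> real" where "seminorm u = sqrt (a u u)"

lemma linr: assumes "u \<in> S" shows "linear_form_on S (a u)"
  using lin[OF assms] subsp assms
  by (auto simp: linear_form_on_def sym subspace_add subspace_scale)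

lemma seminorm_nonneg: "u \<in> S \<Longrightarrow> 0 \<le> seminorm u"
  by (simp add: seminorm_def nonneg)

lemma seminorm_square: "u \<in> S \<Longrightarrow> (seminorm u)\<^sup>2 = a u u"
  by (simp add: seminorm_def nonneg)

lemma Cauchy_Schwarz:
  assumes "u \<in> S" "v \<in> S"
  shows "\<bar>a u v\<bar> \<le> seminorm u * seminorm v"
proof -
  have quadratic: "0 \<le> a u u + 2 * t * a u v + t * t * a v v" for t
  proof -
    have tv: "t *\<^sub>R v \<in> S" using assms subsp by (simp add: subspace_scale)
    then have uv: "u + t *\<^sub>R v \<in> S" using assms subsp by (simp add: subspace_add)
    have "a (u + t *\<^sub>R v) (u + t *\<^sub>R v) = a u (u + t *\<^sub>R v) + a (t *\<^sub>R v) (u + t *\<^sub>R v)"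
      by (rule linear_form_on_add[OF lin[OF uv] assms(1) tv])
    also have "\<dots> = a u (u + t *\<^sub>R v) + t * a v (u + t *\<^sub>R v)"
      by (simp add: linear_form_on_scaleR[OF lin[OF uv] assms(2)])
    also have "\<dots> = a u u + 2 * t * a u v + t * t * a v v"
      by (simp add: linear_form_on_add[OF linr _ tv] linear_form_on_scaleR[OF linr] assms
          sym[OF assms(2,1)] algebra_simps)
    finally show ?thesis using nonneg[OF uv] by simp
  qed
  have "(a u v)\<^sup>2 \<le> a u u * a v v"
  proof (cases "a v v = 0")
    case False
    then have pos: "a v v > 0" using nonneg[OF assms(2)] by simp
    have "0 \<le> a u u - a u v * a u v / a v v"
      using quadratic[of "- a u v / a v v"] pos by (simp add: field_simps)
    then show ?thesis using pos by (simp add: field_simps power2_eq_square)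
  next
    case True
    have "a u v = 0"
    proof (rule ccontr)
      assume *: "a u v \<noteq> 0"
      \<comment> \<open>With \<open>a v v = 0\<close> the quadratic is affine in \<open>t\<close>
        with nonzero slope; the chosen \<open>t\<close> is where it takes the value -1.\<close>
      have "0 \<le> a u u + 2 * (- (a u u + 1) / (2 * a u v)) * a u v"
        using quadratic[of "- (a u u + 1) / (2 * a u v)"] True by simp
      also have "2 * (- (a u u + 1) / (2 * a u v)) * a u v = - (a u u + 1)" using * by simp
      finally show False by simp
    qed
    then show ?thesis using True by simp
  qed
  then have "sqrt ((a u v)\<^sup>2) \<le> sqrt (a u u * a v v)" by (rule real_sqrt_le_mono)
  then show ?thesis by (simp add: seminorm_def real_sqrt_mult)
qed

lemma seminorm_triangle:
  assumes "u \<in> S" "v \<in> S"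
  shows "seminorm (u + v) \<le> seminorm u + seminorm v"
proof -
  have uv: "u + v \<in> S" using assms subsp by (simp add: subspace_add)
  have "(seminorm (u + v))\<^sup>2 = a u u + 2 * a u v + a v v"
    using linear_form_on_add[OF lin[OF uv] assms] linear_form_on_add[OF linr[OF assms(1)] assms]
      linear_form_on_add[OF linr[OF assms(2)] assms] sym[OF assms]
    by (simp add: seminorm_square[OF uv])
  also have "\<dots> \<le> (seminorm u + seminorm v)\<^sup>2"
    using Cauchy_Schwarz[OF assms] assms by (simp add: seminorm_square power2_sum)
  finally show ?thesis
    using seminorm_nonneg assms by (metis add_nonneg_nonneg power2_le_imp_le)
qed

lemma seminorm_scaleR:
  assumes "u \<in> S"
  shows "seminorm (t *\<^sub>R u) = \<bar>t\<bar> * seminorm u"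
proof -
  have tu: "t *\<^sub>R u \<in> S" using assms subsp by (simp add: subspace_scale)
  have "a (t *\<^sub>R u) (t *\<^sub>R u) = t\<^sup>2 * a u u"
    using linear_form_on_scaleR[OF lin[OF tu] assms] linear_form_on_scaleR[OF linr[OF assms] assms]
    by (simp add: power2_eq_square)
  then show ?thesis by (simp add: seminorm_def real_sqrt_mult)
qed

lemma seminorm_0_imp: "u \<in> S \<Longrightarrow> v \<in> S \<Longrightarrow> seminorm v = 0 \<Longrightarrow> a u v = 0"
  using Cauchy_Schwarz[of u v] by simp

end

section \<open>Energy estimates and solvability for the velocity-pressure system\<close>

locale penalty_problem =
  X: semi_inner_product X a + Q: semi_inner_product Q c
  for X :: "'a::real_vector set" and a :: "'a \<Rightarrow> 'a \<Rightarrow> real"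
    and Q :: "'b::real_vector set" and c :: "'b \<Rightarrow> 'b \<Rightarrow> real" +
  fixes d :: "'a \<Rightarrow> 'b" and b :: "'a \<Rightarrow> 'a \<Rightarrow> 'a \<Rightarrow> real" and M \<nu> \<epsilon> :: real and B :: "'a set"
  assumes d_in: "u \<in> X \<Longrightarrow> d u \<in> Q"
    and d_lin: "q \<in> Q \<Longrightarrow> linear_form_on X (\<lambda>u. c (d u) q)"
    and b_lin1: "v \<in> X \<Longrightarrow> w \<in> X \<Longrightarrow> linear_form_on X (\<lambda>u. b u v w)"
    and b_lin2: "u \<in> X \<Longrightarrow> w \<in> X \<Longrightarrow> linear_form_on X (\<lambda>v. b u v w)"
    and b_lin3: "u \<in> X \<Longrightarrow> v \<in> X \<Longrightarrow> linear_form_on X (\<lambda>w. b u v w)"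
    and b_skew: "u \<in> X \<Longrightarrow> v \<in> X \<Longrightarrow> b u v v = 0"
    and b_bound: "u \<in> X \<Longrightarrow> v \<in> X \<Longrightarrow> w \<in> X \<Longrightarrow>
      b u v w \<le> M * X.seminorm u * X.seminorm v * X.seminorm w"
    and M_pos: "M > 0" and \<nu>_pos: "\<nu> > 0" and \<epsilon>_pos: "\<epsilon> > 0"
    and B: "finite B" "B \<subseteq> X" "v \<in> X \<Longrightarrow> \<exists>w\<in>span B. X.seminorm (v - w) = 0 \<and> Q.seminorm (d (v - w)) = 0"
begin

definition energy_norm :: "'a \<times> 'b \<Rightarrow> real" where
  "energy_norm = (\<lambda>(v, q). sqrt (\<nu> * (X.seminorm v)\<^sup>2 + \<epsilon> * (Q.seminorm q)\<^sup>2))"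

text \<open>The source \<open>l\<close> is free and the convecting velocity \<open>u\<close> is
  separate from the unknown, so that the Picard system, its linearization, the increments and the
  differences of derivatives are all instances.\<close>

definition solves :: "'a \<Rightarrow> ('a \<Rightarrow> real) \<Rightarrow> 'b \<Rightarrow> 'a \<times> 'b \<Rightarrow> bool" where
  "solves u l p = (\<lambda>(g, r). g \<in> X \<and> r \<in> Q \<and>
     (\<forall>v\<in>X. \<nu> * a g v + b u g v - c r (d v) = l v) \<and>
     (\<forall>q\<in>Q. \<epsilon> * c r q + c (d g) q = \<epsilon> * c p q))"

text \<open>The one-sided bound at \<open>-w\<close>, which has the same seminorm, supplies the
  other sign.\<close>

lemma b_abs:
  assumes "u \<in> X" "v \<in> X" "w \<in> X"
  shows "\<bar>b u v w\<bar> \<le> M * X.seminorm u * X.seminorm v * X.seminorm w"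
proof -
  have m: "(-1) *\<^sub>R w \<in> X" using X.subsp assms subspace_scale by blast
  have "a ((-1) *\<^sub>R w) ((-1) *\<^sub>R w) = a w w"
    using linear_form_on_scaleR[OF X.lin[OF m] assms(3), of "-1"]
      linear_form_on_scaleR[OF X.linr[OF assms(3)] assms(3), of "-1"] by simp
  then have "X.seminorm ((-1) *\<^sub>R w) = X.seminorm w" by (simp add: X.seminorm_def)
  with b_bound[OF assms(1,2) m] linear_form_on_scaleR[OF b_lin3[OF assms(1,2)] assms(3), of "-1"]
    b_bound[OF assms] show ?thesis by simp
qed

text \<open>With \<open>v = g\<close> and \<open>q = r\<close> the two coupling terms are equal by
  symmetry of \<open>c\<close> and cancel on addition; \<open>b\<close> drops out whatever
  \<open>u\<close> is.\<close>

lemma energy_identity: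
  assumes "solves u l p (g, r)" "u \<in> X" "p \<in> Q"
  shows "\<nu> * (X.seminorm g)\<^sup>2 + \<epsilon> * (Q.seminorm r)\<^sup>2 = l g + \<epsilon> * c p r"
proof -
  have gr: "g \<in> X" "r \<in> Q" and eq: "\<nu> * a g g + b u g g - c r (d g) = l g"
      "\<epsilon> * c r r + c (d g) r = \<epsilon> * c p r"
    using assms by (auto simp: solves_def)
  then show ?thesis
    using b_skew[of u g] assms Q.sym[of r "d g"] d_in by (simp add: X.seminorm_square Q.seminorm_square)
qed

lemma energy_norm_nonneg: "u \<in> X \<Longrightarrow> p \<in> Q \<Longrightarrow> 0 \<le> energy_norm (u, p)"
  using \<nu>_pos \<epsilon>_pos by (simp add: energy_norm_def)

lemma energy_norm_square:
  "(energy_norm (u, p))\<^sup>2 = \<nu> * (X.seminorm u)\<^sup>2 + \<epsilon> * (Q.seminorm p)\<^sup>2"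
  using \<nu>_pos \<epsilon>_pos by (simp add: energy_norm_def)

lemma seminorm_le_energy_norm:
  assumes "u \<in> X"
  shows "sqrt \<nu> * X.seminorm u \<le> energy_norm (u, p)"
proof -
  have "sqrt (\<nu> * (X.seminorm u)\<^sup>2) \<le> energy_norm (u, p)"
    unfolding energy_norm_def using \<epsilon>_pos by simp
  then show ?thesis using X.seminorm_nonneg[OF assms] by (simp add: real_sqrt_mult)
qed

lemma energy_norm_eq_0:
  "energy_norm (u, p) = 0 \<longleftrightarrow> X.seminorm u = 0 \<and> Q.seminorm p = 0"
  using \<nu>_pos \<epsilon>_pos by (simp add: energy_norm_def add_nonneg_eq_0_iff)

text \<open>Splitting the pressure product by \<open>c p r \<le> |p|^2 + |r|^2\<close> absorbs the
  unknown pressure into the left-hand side of the energy identity. What remains is a quadratic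
  inequality \<nu> x^2 \<le> K x + \<nu> y^2 for the velocity seminorm x, with \<open>y\<close> the
  pressure contribution, and it forces x \<le> K/\<nu> + y.\<close>

lemma velocity_estimate:
  assumes sol: "solves u l p (g, r)" "u \<in> X" "p \<in> Q" and l: "l g \<le> K * X.seminorm g" and K: "0 \<le> K"
  shows "X.seminorm g \<le> K / \<nu> + sqrt (\<epsilon> / \<nu>) * Q.seminorm p"
proof (rule ccontr)
  define y where "y = sqrt (\<epsilon> / \<nu>) * Q.seminorm p"
  assume "\<not> ?thesis"
  then have big: "X.seminorm g > K / \<nu> + y" by (simp add: y_def)
  have gr: "g \<in> X" "r \<in> Q" using sol by (auto simp: solves_def)
  have y: "0 \<le> y" using \<nu>_pos \<epsilon>_pos Q.seminorm_nonneg[OF sol(3)] by (simp add: y_def)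
  have "\<epsilon> * c p r \<le> \<epsilon> * (Q.seminorm p * Q.seminorm r)"
    using Q.Cauchy_Schwarz[OF sol(3) gr(2)] \<epsilon>_pos by simp
  also have "\<dots> \<le> \<epsilon> * ((Q.seminorm p)\<^sup>2 + (Q.seminorm r)\<^sup>2)"
  proof -
    have "0 \<le> (Q.seminorm p - Q.seminorm r)\<^sup>2 + (Q.seminorm p)\<^sup>2 + (Q.seminorm r)\<^sup>2" by simp
    then show ?thesis using \<epsilon>_pos by (intro mult_left_mono) (auto simp: power2_diff)
  qed
  finally have "\<nu> * (X.seminorm g)\<^sup>2 \<le> K * X.seminorm g + \<epsilon> * (Q.seminorm p)\<^sup>2"
    using energy_identity[OF sol] l by (simp add: algebra_simps)
  also have "\<epsilon> * (Q.seminorm p)\<^sup>2 = \<nu> * (y * y)"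
    using \<nu>_pos \<epsilon>_pos by (simp add: y_def power_mult_distrib flip: power2_eq_square)
  \<comment> \<open>Under the contrary assumption \<open>y\<close> is below the velocity seminorm;
    trading one factor makes the whole inequality divisible by that seminorm.\<close>
  also have "y * y \<le> X.seminorm g * y"
    using big y K \<nu>_pos by (intro mult_right_mono) (auto intro: order_trans[of _ "K/\<nu> + y"])
  finally have "\<nu> * (X.seminorm g)\<^sup>2 \<le> K * X.seminorm g + \<nu> * (X.seminorm g * y)"
    using \<nu>_pos by simp
  moreover have "X.seminorm g > 0" using big y K \<nu>_pos by (smt (verit) divide_nonneg_pos)
  moreover have "\<nu> * (X.seminorm g)\<^sup>2 = (\<nu> * X.seminorm g) * X.seminorm g"
    "K * X.seminorm g + \<nu> * (X.seminorm g * y) = (K + \<nu> * y) * X.seminorm g"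
    by (simp_all add: power2_eq_square algebra_simps)
  ultimately have "\<nu> * X.seminorm g \<le> K + \<nu> * y"
    by (metis mult_le_cancel_right_pos)
  with big \<nu>_pos show False by (simp add: field_simps)
qed

text \<open>The pressure datum enters the energy identity with factor 1 and the source with factor
  \<open>C\<close>; since \<open>1 \<le> C\<close>, both get the factor \<open>C\<close>. The rest
  is the Cauchy-Schwarz inequality in the plane for the pairs of weighted norms, after which one
  factor \<open>energy_norm (g, r)\<close> is cancelled. The condition on \<open>C\<close> is the
  origin of the maximum with 1 in the Lipschitz constant.\<close>

lemma energy_estimate:
  assumes sol: "solves u l s (g, r)" "u \<in> X" "s \<in> Q" "h \<in> X"
    and l: "l g \<le> C * \<nu> * X.seminorm h * X.seminorm g" and C: "1 \<le> C"
  shows "energy_norm (g, r) \<le> C * energy_norm (h, s)"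
proof -
  have gr: "g \<in> X" "r \<in> Q" using sol by (auto simp: solves_def)
  have nn: "0 \<le> Q.seminorm s * Q.seminorm r" using gr sol by (simp add: Q.seminorm_nonneg)
  have "\<epsilon> * c s r \<le> \<epsilon> * (Q.seminorm s * Q.seminorm r)"
    using Q.Cauchy_Schwarz[OF sol(3) gr(2)] \<epsilon>_pos by simp
  also have "\<dots> \<le> C * (\<epsilon> * (Q.seminorm s * Q.seminorm r))"
    using mult_right_mono[OF C, of "\<epsilon> * (Q.seminorm s * Q.seminorm r)"] \<epsilon>_pos nn by simp
  finally have "(energy_norm (g, r))\<^sup>2 \<le> C * (\<nu> * (X.seminorm h * X.seminorm g)
      + \<epsilon> * (Q.seminorm s * Q.seminorm r))"
    using energy_identity[OF sol(1-3)] l by (simp add: energy_norm_square algebra_simps)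
  also have "\<nu> * (X.seminorm h * X.seminorm g) + \<epsilon> * (Q.seminorm s * Q.seminorm r)
      = (sqrt \<nu> * X.seminorm h) * (sqrt \<nu> * X.seminorm g)
        + (sqrt \<epsilon> * Q.seminorm s) * (sqrt \<epsilon> * Q.seminorm r)"
    using \<nu>_pos \<epsilon>_pos by (simp only: sqrt_scaled_product less_imp_le)
  also have "\<dots> \<le> energy_norm (h, s) * energy_norm (g, r)"
  proof -
    have "\<dots> \<le> sqrt ((sqrt \<nu> * X.seminorm h)\<^sup>2 + (sqrt \<epsilon> * Q.seminorm s)\<^sup>2)
        * sqrt ((sqrt \<nu> * X.seminorm g)\<^sup>2 + (sqrt \<epsilon> * Q.seminorm r)\<^sup>2)"
      using norm_cauchy_schwarz[of "(sqrt \<nu> * X.seminorm h, sqrt \<epsilon> * Q.seminorm s)"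
          "(sqrt \<nu> * X.seminorm g, sqrt \<epsilon> * Q.seminorm r)"]
      by (simp add: norm_Pair)
    then show ?thesis using \<nu>_pos \<epsilon>_pos by (simp add: energy_norm_def power_mult_distrib)
  qed
  finally have *: "(energy_norm (g, r))\<^sup>2 \<le> C * (energy_norm (h, s) * energy_norm (g, r))"
    using C by simp
  show ?thesis
  proof (cases "energy_norm (g, r) = 0")
    case True
    then show ?thesis using C sol energy_norm_nonneg by simp
  next
    case False
    then have "energy_norm (g, r) > 0" using energy_norm_nonneg[OF gr] by simp
    with * show ?thesis by (simp add: power2_eq_square)
  qed
qed

text \<open>Without pressure data only the source feeds the energy; measuring the velocity seminorm
  by the energy norm costs the factor \<open>1 / sqrt \<nu>\<close>.\<close>

lemma energy_estimate0:
  assumes sol: "solves u l 0 (g, r)" "u \<in> X"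
    and l: "l g \<le> K * X.seminorm g" and K: "0 \<le> K"
  shows "energy_norm (g, r) \<le> K / sqrt \<nu>"
proof -
  have gr: "g \<in> X" "r \<in> Q" using sol by (auto simp: solves_def)
  have Q0: "0 \<in> Q" using Q.subsp by (rule subspace_0)
  have "c 0 r = 0" using linear_form_on_0[OF Q.lin[OF gr(2)] Q.subsp] .
  then have "(energy_norm (g, r))\<^sup>2 \<le> K * X.seminorm g"
    using energy_identity[OF sol Q0] l by (simp add: energy_norm_square)
  also have "K * X.seminorm g \<le> K * (energy_norm (g, r) / sqrt \<nu>)"
    using seminorm_le_energy_norm[OF gr(1), of r] \<nu>_pos K
    by (intro mult_left_mono) (auto simp: field_simps)
  finally have *: "energy_norm (g, r) * energy_norm (g, r) \<le> (K / sqrt \<nu>) * energy_norm (g, r)"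
    by (simp add: power2_eq_square)
  show ?thesis
  proof (cases "energy_norm (g, r) = 0")
    case True
    then show ?thesis using K \<nu>_pos by simp
  next
    case False
    then have "energy_norm (g, r) > 0" using energy_norm_nonneg[OF gr] by simp
    with * show ?thesis by (metis mult_le_cancel_right_pos)
  qed
qed

lemma solves_combination:
  assumes "solves u l p (g, r)" "solves u l' p' (g', r')" "u \<in> X" "p \<in> Q" "p' \<in> Q"
  shows "solves u (\<lambda>v. x * l v + y * l' v) (x *\<^sub>R p + y *\<^sub>R p') (x *\<^sub>R g + y *\<^sub>R g', x *\<^sub>R r + y *\<^sub>R r')"
proof -
  have gr: "g \<in> X" "r \<in> Q" "g' \<in> X" "r' \<in> Q" using assms by (auto simp: solves_def)
  have comb: "L (x *\<^sub>R z + y *\<^sub>R z') = x * L z + y * L z'"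
    if "linear_form_on S L" "subspace S" "z \<in> S" "z' \<in> S" for L z z' and S :: "'c::real_vector set"
    using that by (simp add: linear_form_on_add linear_form_on_scaleR subspace_scale)
  have 1: "\<nu> * a (x *\<^sub>R g + y *\<^sub>R g') v + b u (x *\<^sub>R g + y *\<^sub>R g') v - c (x *\<^sub>R r + y *\<^sub>R r') (d v)
      = x * l v + y * l' v" if v: "v \<in> X" for v
  proof -
    have "\<nu> * a g v + b u g v - c r (d v) = l v" "\<nu> * a g' v + b u g' v - c r' (d v) = l' v"
      using assms v by (auto simp: solves_def)
    then have "x * (\<nu> * a g v + b u g v - c r (d v)) + y * (\<nu> * a g' v + b u g' v - c r' (d v))
      = x * l v + y * l' v" by simp
    then show ?thesis
      by (simp add: comb[OF X.lin[OF v] X.subsp gr(1,3)] comb[OF b_lin2[OF assms(3) v] X.subsp gr(1,3)]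
        comb[OF Q.lin[OF d_in[OF v]] Q.subsp gr(2,4)] algebra_simps)
  qed
  have 2: "\<epsilon> * c (x *\<^sub>R r + y *\<^sub>R r') q + c (d (x *\<^sub>R g + y *\<^sub>R g')) q = \<epsilon> * c (x *\<^sub>R p + y *\<^sub>R p') q"
    if q: "q \<in> Q" for q
  proof -
    have "\<epsilon> * c r q + c (d g) q = \<epsilon> * c p q" "\<epsilon> * c r' q + c (d g') q = \<epsilon> * c p' q"
      using assms q by (auto simp: solves_def)
    then have "x * (\<epsilon> * c r q + c (d g) q) + y * (\<epsilon> * c r' q + c (d g') q)
      = x * (\<epsilon> * c p q) + y * (\<epsilon> * c p' q)" by simp
    then show ?thesis
      by (simp add: comb[OF Q.lin[OF q] Q.subsp gr(2,4)] comb[OF d_lin[OF q] X.subsp gr(1,3)]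
        comb[OF Q.lin[OF q] Q.subsp assms(4,5)] algebra_simps)
  qed
  show ?thesis
    unfolding solves_def using 1 2 gr X.subsp Q.subsp by (simp add: subspace_add subspace_scale)
qed

lemma solves_diff:
  assumes "solves u l p (g, r)" "solves u l' p' (g', r')" "u \<in> X" "p \<in> Q" "p' \<in> Q"
  shows "solves u (\<lambda>v. l v - l' v) (p - p') (g - g', r - r')"
  using solves_combination[OF assms, of 1 "-1"] by simp

text \<open>By linearity of \<open>b\<close> in its first argument, a change of the convecting
  velocity is a source term. This brings solutions with different convecting velocities to a common
  one, where they can be subtracted.\<close>

lemma solves_shift:
  assumes "solves (u + h) l p (g, r)" "u \<in> X" "h \<in> X"
  shows "solves u (\<lambda>v. l v - b h g v) p (g, r)"
  using assms by (auto simp: solves_def linear_form_on_add[OF b_lin1] algebra_simps)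

lemma solves_cong: "solves u l p gr \<Longrightarrow> (\<And>v. v \<in> X \<Longrightarrow> l v = l' v) \<Longrightarrow> solves u l' p gr"
  by (auto simp: solves_def)

lemma solves_unique:
  assumes "solves u l p (g, r)" "solves u l p (g', r')" "u \<in> X" "p \<in> Q"
  shows "energy_norm (g - g', r - r') = 0"
proof -
  have *: "solves u (\<lambda>v. 0) 0 (g - g', r - r')"
    using solves_diff[OF assms(1,2,3,4,4)] by simp
  then have "g - g' \<in> X" "r - r' \<in> Q" by (auto simp: solves_def)
  then show ?thesis
    using energy_estimate0[OF * assms(3), of 0] energy_norm_nonneg by fastforce
qed

text \<open>The second equation gives \<open>r = p - d g / \<epsilon>\<close>, which leaves a coercive problem for \<open>g\<close>.\<close>

lemma solves_exists:
  assumes u: "u \<in> X" and p: "p \<in> Q" and l: "linear_form_on X l"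
    and bound: "\<And>v. v \<in> X \<Longrightarrow> \<bar>l v\<bar> \<le> K * X.seminorm v"
  shows "\<exists>g r. solves u l p (g, r)"
proof -
  define A where "A = (\<lambda>g v. \<nu> * a g v + b u g v + c (d g) (d v) / \<epsilon>)"
  \<comment> \<open>The extra term is the contribution of \<open>p\<close> to
    \<open>c r (d v)\<close> after the elimination of \<open>r\<close>, moved to the right.\<close>
  define L where "L = (\<lambda>v. l v + c p (d v))"
  have dr: "linear_form_on X (\<lambda>v. c q (d v))" if "q \<in> Q" for q
    using d_lin[OF that] Q.sym d_in that X.subsp
    by (auto simp: linear_form_on_def subspace_add subspace_scale)
  have left: "linear_form_on X (\<lambda>g. A g v)" if v: "v \<in> X" for v
    using X.lin[OF v] b_lin2[OF u v] d_lin[OF d_in[OF v]]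
    by (auto simp: A_def linear_form_on_def add_divide_distrib algebra_simps)
  have right: "linear_form_on X (A g)" if g: "g \<in> X" for g
    using X.linr[OF g] b_lin3[OF u g] dr[OF d_in[OF g]]
    by (auto simp: A_def linear_form_on_def add_divide_distrib algebra_simps)
  have L: "linear_form_on X L" using l dr[OF p] by (auto simp: L_def linear_form_on_def algebra_simps)
  have ker: "X.seminorm w = 0 \<and> Q.seminorm (d w) = 0" if w: "w \<in> X" "A w w = 0" for w
  proof -
    have "\<nu> * a w w + c (d w) (d w) / \<epsilon> = 0" using w b_skew[OF u w(1)] by (simp add: A_def)
    moreover have "0 \<le> \<nu> * a w w" "0 \<le> c (d w) (d w) / \<epsilon>"
      using X.nonneg[OF w(1)] Q.nonneg[OF d_in[OF w(1)]] \<nu>_pos \<epsilon>_pos by auto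
    ultimately have "\<nu> * a w w = 0" "c (d w) (d w) / \<epsilon> = 0" by linarith+
    then show ?thesis using \<nu>_pos \<epsilon>_pos by (simp add: X.seminorm_def Q.seminorm_def)
  qed
  have kerA: "A g w = 0" if "g \<in> X" "w \<in> X" "A w w = 0" for g w
    using ker[OF that(2,3)] X.seminorm_0_imp[OF that(1,2)] b_abs[OF u that(1,2)]
      Q.seminorm_0_imp[OF d_in[OF that(1)] d_in[OF that(2)]] by (simp add: A_def)
  \<comment> \<open>Boundedness of \<open>l\<close> is used for this: it makes \<open>l\<close>
    blind to elements of vanishing seminorm.\<close>
  have kerL: "L w = 0" if "w \<in> X" "A w w = 0" for w
    using ker[OF that] bound[OF that(1)] Q.seminorm_0_imp[OF p d_in[OF that(1)]] by (simp add: L_def)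
  from finite_dimensional_Lax_Milgram[of B X A, OF B(1,2) X.subsp left right kerA L kerL]
  obtain g where g: "g \<in> span B" "\<forall>v\<in>B. A g v = L v" by blast
  have span: "span B \<subseteq> X" using B X.subsp by (simp add: span_minimal)
  have gX: "g \<in> X" using g span by blast
  have eqn: "A g v = L v" if v: "v \<in> X" for v
  proof -
    obtain w where w: "w \<in> span B" "X.seminorm (v - w) = 0" "Q.seminorm (d (v - w)) = 0" using B(3)[OF v] by blast
    have wX: "w \<in> X" and vw: "v - w \<in> X" using w span v X.subsp by (auto simp: subspace_diff)
    have "A g w = L w"
      using linear_form_on_eq_span[OF right[OF gX] L X.subsp B(2) _ w(1)] g by blast
    \<comment> \<open>The span of \<open>B\<close> meets every class modulo the kernel, and neither
      \<open>A g\<close> nor \<open>L\<close> sees the kernel, so the equation passes from the span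
      to all of \<open>X\<close>.\<close>
    moreover have "A (v - w) (v - w) = 0"
      using X.seminorm_square[OF vw] Q.seminorm_square[OF d_in[OF vw]] w b_skew[OF u vw]
      by (simp add: A_def)
    then have "A g (v - w) = 0" "L (v - w) = 0" using kerA[OF gX vw] kerL[OF vw] by auto
    then have "A g v = A g w" "L v = L w"
      using linear_form_on_diff[OF right[OF gX] X.subsp v wX] linear_form_on_diff[OF L X.subsp v wX] by auto
    ultimately show ?thesis by simp
  qed
  define r where "r = p - (1 / \<epsilon>) *\<^sub>R d g"
  have dg: "(1 / \<epsilon>) *\<^sub>R d g \<in> Q" using d_in[OF gX] Q.subsp by (simp add: subspace_scale)
  have r: "r \<in> Q" using dg p Q.subsp by (simp add: r_def subspace_diff)
  have cr: "c r q = c p q - c (d g) q / \<epsilon>" if q: "q \<in> Q" for q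
    using linear_form_on_diff[OF Q.lin[OF q] Q.subsp p dg]
      linear_form_on_scaleR[OF Q.lin[OF q] d_in[OF gX], of "1 / \<epsilon>"] by (simp add: r_def)
  have "\<nu> * a g v + b u g v - c r (d v) = l v" if v: "v \<in> X" for v
    using eqn[OF v] cr[OF d_in[OF v]] by (simp add: A_def L_def)
  moreover have "\<epsilon> * c r q + c (d g) q = \<epsilon> * c p q" if q: "q \<in> Q" for q
    using cr[OF q] \<epsilon>_pos by (simp add: field_simps)
  ultimately have "solves u l p (g, r)" using gX r by (simp add: solves_def)
  then show ?thesis by blast
qed

lemma solves_convection_exists:
  assumes "u \<in> X" "p \<in> Q" "h \<in> X" "g \<in> X"
  shows "\<exists>g' r'. solves u (\<lambda>v. - b h g v) p (g', r')"
proof (rule solves_exists)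
  show "linear_form_on X (\<lambda>v. - b h g v)"
    using b_lin3[OF assms(3,4)] by (simp add: linear_form_on_def)
  show "\<bar>- b h g v\<bar> \<le> (M * X.seminorm h * X.seminorm g) * X.seminorm v" if "v \<in> X" for v
    using b_abs[OF assms(3,4) that] by simp
qed (use assms in auto)

end

section \<open>The Picard operator: increments, remainder, and variation of the derivative\<close>

locale penalty_picard = penalty_problem +
  fixes f :: "'a \<Rightarrow> real" and F :: real
  assumes f_lin: "linear_form_on X f"
    and f_bound: "v \<in> X \<Longrightarrow> \<bar>f v\<bar> \<le> F * X.seminorm v"
    and F_nonneg: "0 \<le> F"
begin

text \<open>\<open>M / \<nu>\<close> times the bound that \<open>velocity_estimate\<close> gives for
  \<open>K = F\<close>, raised to at least 1 as \<open>energy_estimate\<close> demands. With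
  \<open>F\<close> the dual norm of \<open>f\<close> it is the constant \<open>C\<^sub>L\<close> of
  the theorem.\<close>

definition Lipschitz_bound :: "'b \<Rightarrow> real" where
  "Lipschitz_bound p = max 1 (M * F / \<nu>\<^sup>2 + sqrt (\<epsilon> / \<nu> ^ 3) * M * Q.seminorm p)"

lemma velocity_le_Lipschitz_bound:
  assumes "solves u f p (g, r)" "u \<in> X" "p \<in> Q"
  shows "M * X.seminorm g \<le> Lipschitz_bound p * \<nu>"
proof -
  have g: "g \<in> X" using assms by (simp add: solves_def)
  have "X.seminorm g \<le> F / \<nu> + sqrt (\<epsilon> / \<nu>) * Q.seminorm p"
    using velocity_estimate[OF assms _ F_nonneg] f_bound[OF g] by simp
  then have "M * X.seminorm g \<le> M * (F / \<nu> + sqrt (\<epsilon> / \<nu>) * Q.seminorm p)"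
    using M_pos by simp
  also have "\<dots> = (M * F / \<nu>\<^sup>2 + sqrt (\<epsilon> / \<nu> ^ 3) * M * Q.seminorm p) * \<nu>"
  proof -
    have "\<nu> ^ 3 = \<nu> * \<nu>\<^sup>2" by (simp add: power_numeral_reduce)
    then have "sqrt (\<epsilon> / \<nu> ^ 3) = sqrt (\<epsilon> / \<nu> / \<nu>\<^sup>2)" by simp
    also have "\<dots> = sqrt (\<epsilon> / \<nu>) / \<nu>" using \<nu>_pos by (simp only: real_sqrt_divide real_sqrt_abs)
    finally show ?thesis using \<nu>_pos by (simp add: field_simps power2_eq_square)
  qed
  also have "\<dots> \<le> Lipschitz_bound p * \<nu>"
    unfolding Lipschitz_bound_def using \<nu>_pos by (intro mult_right_mono) auto
  finally show ?thesis .
qed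

text \<open>The convecting velocity \<open>u'\<close> is independent of the base point
  \<open>u\<close>: taking \<open>u' = u\<close> bounds the derivative, and
  \<open>u' = u + h\<close> bounds the increment by the same constant.\<close>

lemma convection_estimate:
  assumes "solves u f p (g, r)" "u \<in> X" "p \<in> Q"
    and "solves u' (\<lambda>v. - b h g v) s (g', r')" "u' \<in> X" "h \<in> X" "s \<in> Q"
  shows "energy_norm (g', r') \<le> Lipschitz_bound p * energy_norm (h, s)"
proof (rule energy_estimate[OF assms(4,5,7,6)])
  have g: "g \<in> X" "g' \<in> X" using assms by (auto simp: solves_def)
  have "- b h g g' \<le> M * X.seminorm g * (X.seminorm h * X.seminorm g')"
    using b_abs[OF assms(6) g] by (simp add: algebra_simps)
  also have "\<dots> \<le> Lipschitz_bound p * \<nu> * (X.seminorm h * X.seminorm g')"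
    using velocity_le_Lipschitz_bound[OF assms(1-3)] X.seminorm_nonneg assms g
    by (intro mult_right_mono) auto
  finally show "- b h g g' \<le> Lipschitz_bound p * \<nu> * X.seminorm h * X.seminorm g'"
    by (simp add: algebra_simps)
qed (simp add: Lipschitz_bound_def)

text \<open>The old solution is rewritten for the convecting velocity \<open>u + h\<close>, not the
  new one for \<open>u\<close>. In this way the source contains \<open>g\<close>, whose size is
  controlled by \<open>p\<close>, while the other choice would leave \<open>g2\<close>, controlled
  only by \<open>p + s\<close>.\<close>

lemma increment_solves:
  assumes "solves u f p (g, r)" "solves (u + h) f (p + s) (g2, r2)" "u \<in> X" "p \<in> Q" "h \<in> X" "s \<in> Q"
  shows "solves (u + h) (\<lambda>v. - b h g v) s (g2 - g, r2 - r)"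
proof -
  have uh: "u + h \<in> X" "p + s \<in> Q" using assms X.subsp Q.subsp by (auto simp: subspace_add)
  have "solves (u + h) (\<lambda>v. f v + b h g v) p (g, r)"
    using assms by (auto simp: solves_def linear_form_on_add[OF b_lin1] algebra_simps)
  from solves_diff[OF assms(2) this uh assms(4)] show ?thesis by simp
qed

text \<open>Origin of the power -3/2 of \<nu> in the Lipschitz constant of the derivative: one
  factor \<open>1 / sqrt \<nu>\<close> comes from \<open>energy_estimate0\<close>, and one from each
  of the two seminorms when it is replaced by an energy norm.\<close>

lemma seminorm_product_le:
  assumes "u \<in> X" "v \<in> X" "energy_norm (v, q) \<le> K * energy_norm (w, z)"
  shows "M * X.seminorm u * X.seminorm v / sqrt \<nu>
    \<le> M / (\<nu> * sqrt \<nu>) * K * energy_norm (u, p) * energy_norm (w, z)"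
proof -
  have "(sqrt \<nu> * X.seminorm u) * (sqrt \<nu> * X.seminorm v) \<le> energy_norm (u, p) * energy_norm (v, q)"
    using seminorm_le_energy_norm[OF assms(1), of p] seminorm_le_energy_norm[OF assms(2), of q]
      X.seminorm_nonneg[OF assms(1)] X.seminorm_nonneg[OF assms(2)] \<nu>_pos
    by (intro mult_mono) (auto intro: order_trans[rotated])
  also have "\<dots> \<le> energy_norm (u, p) * (K * energy_norm (w, z))"
    using assms \<nu>_pos \<epsilon>_pos by (intro mult_left_mono) (auto simp: energy_norm_def)
  finally have "M / (\<nu> * sqrt \<nu>) * ((sqrt \<nu> * X.seminorm u) * (sqrt \<nu> * X.seminorm v))
      \<le> M / (\<nu> * sqrt \<nu>) * (energy_norm (u, p) * (K * energy_norm (w, z)))"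
    using M_pos \<nu>_pos by (intro mult_left_mono) auto
  also have "(sqrt \<nu> * X.seminorm u) * (sqrt \<nu> * X.seminorm v) = \<nu> * (X.seminorm u * X.seminorm v)"
    using \<nu>_pos by (simp add: sqrt_scaled_product)
  finally show ?thesis using \<nu>_pos by (simp add: mult_ac)
qed

lemma remainder_estimate:
  assumes 1: "solves u f p (g, r)" "solves (u + h) f (p + s) (g2, r2)"
    and 2: "u \<in> X" "p \<in> Q" "h \<in> X" "s \<in> Q"
    and 3: "solves u (\<lambda>v. - b h g v) s (g', r')"
  shows "energy_norm (g2 - g - g', r2 - r - r')
    \<le> M / (\<nu> * sqrt \<nu>) * Lipschitz_bound p * energy_norm (h, s) * energy_norm (h, s)"
proof -
  note incr = increment_solves[OF 1 2]
  have uh: "u + h \<in> X" using 2 X.subsp by (simp add: subspace_add)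
  have N: "energy_norm (g2 - g, r2 - r) \<le> Lipschitz_bound p * energy_norm (h, s)"
    by (rule convection_estimate[OF 1(1) 2(1,2) incr uh 2(3,4)])
  have \<delta>: "g2 - g \<in> X" using incr by (simp add: solves_def)
  \<comment> \<open>Shifting the increment back to the convecting velocity \<open>u\<close> adds the
    source \<open>- b h (g2 - g)\<close>; the source \<open>- b h g\<close> is shared with the
    derivative and cancels. The product of \<open>h\<close> with an increment is the quadratic
    smallness.\<close>
  have *: "solves u (\<lambda>v. - b h (g2 - g) v) 0 (g2 - g - g', r2 - r - r')"
    using solves_diff[OF solves_shift[OF incr 2(1,3)] 3 2(1,4,4)] by simp
  then have e: "g2 - g - g' \<in> X" by (simp add: solves_def)
  have "energy_norm (g2 - g - g', r2 - r - r') \<le> (M * X.seminorm h * X.seminorm (g2 - g)) / sqrt \<nu>"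
    using b_abs[OF 2(3) \<delta> e] X.seminorm_nonneg M_pos \<delta> 2
    by (intro energy_estimate0[OF * 2(1)]) auto
  also have "\<dots> \<le> M / (\<nu> * sqrt \<nu>) * Lipschitz_bound p * energy_norm (h, s) * energy_norm (h, s)"
    using seminorm_product_le[OF 2(3) \<delta> N] .
  finally show ?thesis .
qed

text \<open>Two things change between the derivatives: the velocity convected by \<open>w\<close>,
  from \<open>g\<close> to \<open>g2\<close>, and the convecting velocity acting on the derivative,
  by \<open>h\<close>. Each change contributes one product of a direction with a quantity bounded by
  \<open>Lipschitz_bound p\<close>, hence the factor 2.\<close>

lemma derivative_Lipschitz:
  assumes 1: "solves u f p (g, r)" "solves (u + h) f (p + s) (g2, r2)"
    and 2: "u \<in> X" "p \<in> Q" "h \<in> X" "s \<in> Q" "w \<in> X" "z \<in> Q"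
    and 3: "solves u (\<lambda>v. - b w g v) z (g', r')" "solves (u + h) (\<lambda>v. - b w g2 v) z (g2', r2')"
  shows "energy_norm (g2' - g', r2' - r')
    \<le> 2 * (M / (\<nu> * sqrt \<nu>)) * Lipschitz_bound p * energy_norm (w, z) * energy_norm (h, s)"
proof -
  note incr = increment_solves[OF 1 2(1-4)]
  have uh: "u + h \<in> X" using 2 X.subsp by (simp add: subspace_add)
  have N: "energy_norm (g2 - g, r2 - r) \<le> Lipschitz_bound p * energy_norm (h, s)"
    by (rule convection_estimate[OF 1(1) 2(1,2) incr uh 2(3,4)])
  have N': "energy_norm (g', r') \<le> Lipschitz_bound p * energy_norm (w, z)"
    by (rule convection_estimate[OF 1(1) 2(1,2) 3(1) 2(1) 2(5,6)])
  have g: "g \<in> X" "g2 \<in> X" "g2 - g \<in> X" "g' \<in> X" using 1 3 incr by (auto simp: solves_def)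
  \<comment> \<open>The derivative at the base point is rewritten for the convecting velocity
    \<open>u + h\<close>, so that the remaining source involves \<open>g'\<close> and not
    \<open>g2'\<close>.\<close>
  have "solves (u + h) (\<lambda>v. - b w g v + b h g' v) z (g', r')"
    using 3(1) 2 by (auto simp: solves_def linear_form_on_add[OF b_lin1] algebra_simps)
  from solves_diff[OF 3(2) this uh 2(6,6)]
  have *: "solves (u + h) (\<lambda>v. - b w g2 v - (- b w g v + b h g' v)) 0 (g2' - g', r2' - r')" by simp
  then have e: "g2' - g' \<in> X" by (simp add: solves_def)
  have "- b w g2 (g2' - g') - (- b w g (g2' - g') + b h g' (g2' - g'))
      = - b w (g2 - g) (g2' - g') - b h g' (g2' - g')"
    using linear_form_on_diff[OF b_lin2[OF 2(5) e] X.subsp g(2,1)] by simp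
  also have "\<dots> \<le> (M * X.seminorm w * X.seminorm (g2 - g) + M * X.seminorm h * X.seminorm g')
      * X.seminorm (g2' - g')"
    using b_abs[OF 2(5) g(3) e] b_abs[OF 2(3) g(4) e] by (simp add: algebra_simps)
  finally have "energy_norm (g2' - g', r2' - r')
      \<le> (M * X.seminorm w * X.seminorm (g2 - g) + M * X.seminorm h * X.seminorm g') / sqrt \<nu>"
    using X.seminorm_nonneg M_pos g 2
    by (intro energy_estimate0[OF * uh]) auto
  also have "\<dots> = M * X.seminorm w * X.seminorm (g2 - g) / sqrt \<nu> + M * X.seminorm h * X.seminorm g' / sqrt \<nu>"
    by (rule add_divide_distrib)
  also have "\<dots> \<le> M / (\<nu> * sqrt \<nu>) * Lipschitz_bound p * energy_norm (w, z) * energy_norm (h, s)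
      + M / (\<nu> * sqrt \<nu>) * Lipschitz_bound p * energy_norm (h, s) * energy_norm (w, z)"
    by (intro add_mono seminorm_product_le[OF 2(5) g(3) N] seminorm_product_le[OF 2(3) g(4) N'])
  finally show ?thesis by (simp add: algebra_simps)
qed

end

section \<open>Smooth bump functions\<close>

lemma partial_eqI: "(\<phi> has_derivative D) (at x) \<Longrightarrow> partial j \<phi> x = D (axis j 1)"
  by (simp add: partial_def flip: frechet_derivative_at)

text \<open>Above level 0 the recursion speaks of differentiability only; continuity at the bottom
  is recovered from it, and the induction lifts this through the partial derivatives.\<close>

lemma Ck_Suc_imp: "Ck (Suc k) \<phi> \<Longrightarrow> Ck k \<phi>"
proof (induction k arbitrary: \<phi>)
  case 0
  then show ?case
    by (auto intro!: continuous_at_imp_continuous_on differentiable_imp_continuous_within)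
next
  case (Suc k)
  from Suc.prems have "\<forall>x. \<phi> differentiable at x" "\<And>j. Ck (Suc k) (partial j \<phi>)"
    unfolding Ck.simps(2)[of "Suc k"] by blast+
  with Suc.IH show ?case unfolding Ck.simps(2)[of k] by blast
qed

lemma partial_const: "partial j (\<lambda>x. c) = (\<lambda>x. 0)"
  by (rule ext, subst partial_eqI[OF has_derivative_const]) simp

lemma Ck_const: "Ck k (\<lambda>x. c)"
  by (induction k arbitrary: c) (auto simp: partial_const)

lemma differentiable_imp_has_derivative:
  "\<phi> differentiable at x \<Longrightarrow> (\<phi> has_derivative frechet_derivative \<phi> (at x)) (at x)"
  by (simp add: frechet_derivative_works)

lemma partial_add:
  assumes "\<forall>x. \<phi> differentiable at x" "\<forall>x. \<psi> differentiable at x"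
  shows "partial j (\<lambda>x. \<phi> x + \<psi> x) = (\<lambda>x. partial j \<phi> x + partial j \<psi> x)"
proof
  fix x
  show "partial j (\<lambda>x. \<phi> x + \<psi> x) x = partial j \<phi> x + partial j \<psi> x"
    by (subst partial_eqI[OF has_derivative_add[OF differentiable_imp_has_derivative
        differentiable_imp_has_derivative]]) (simp_all add: assms partial_def)
qed

lemma partial_mult:
  assumes "\<forall>x. \<phi> differentiable at x" "\<forall>x. \<psi> differentiable at x"
  shows "partial j (\<lambda>x. \<phi> x * \<psi> x) = (\<lambda>x. \<phi> x * partial j \<psi> x + partial j \<phi> x * \<psi> x)"
proof
  fix x
  show "partial j (\<lambda>x. \<phi> x * \<psi> x) x = \<phi> x * partial j \<psi> x + partial j \<phi> x * \<psi> x"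
    by (subst partial_eqI[OF has_derivative_mult[OF differentiable_imp_has_derivative
        differentiable_imp_has_derivative]]) (simp_all add: assms partial_def)
qed

lemma Ck_add: "Ck k \<phi> \<Longrightarrow> Ck k \<psi> \<Longrightarrow> Ck k (\<lambda>x. \<phi> x + \<psi> x)"
proof (induction k arbitrary: \<phi> \<psi>)
  case 0
  then show ?case by (auto intro: continuous_on_add)
next
  case (Suc k)
  then show ?case by (simp add: partial_add)
qed

lemma Ck_mult: "Ck k \<phi> \<Longrightarrow> Ck k \<psi> \<Longrightarrow> Ck k (\<lambda>x. \<phi> x * \<psi> x)"
proof (induction k arbitrary: \<phi> \<psi>)
  case 0
  then show ?case by (auto intro: continuous_on_mult)
next
  case (Suc k)
  then have "Ck k \<phi>" "Ck k \<psi>" using Ck_Suc_imp by blast+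
  with Suc show ?case by (simp add: partial_mult Ck_add)
qed

lemma Ck_prod: "(\<And>i. i \<in> I \<Longrightarrow> Ck k (\<phi> i)) \<Longrightarrow> Ck k (\<lambda>x. \<Prod>i\<in>I. \<phi> i x)"
  by (induction I rule: infinite_finite_induct) (auto simp: Ck_const Ck_mult)

text \<open>The functions \<open>flat p\<close> are closed under differentiation, and positive exactly on the positive
  half-line for \<open>p = 1\<close>.\<close>

definition flat :: "real poly \<Rightarrow> real \<Rightarrow> real" where
  "flat p t = (if t \<le> 0 then 0 else poly p (1 / t) * exp (- (1 / t)))"

lemma poly_mult_exp_minus_tendsto_0: "((\<lambda>s. poly p s * exp (- s)) \<longlongrightarrow> 0) at_top"
  for p :: "real poly"
proof -
  have "((\<lambda>s. \<Sum>i\<le>degree p. coeff p i * (s ^ i / exp s)) \<longlongrightarrow> (\<Sum>i\<le>degree p. coeff p i * 0)) at_top"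
    by (intro tendsto_sum tendsto_mult tendsto_const tendsto_power_div_exp_0)
  moreover have "(\<lambda>s. \<Sum>i\<le>degree p. coeff p i * (s ^ i / exp s)) = (\<lambda>s. poly p s * exp (- s))"
    by (simp add: poly_altdef exp_minus sum_distrib_right divide_inverse mult.assoc)
  ultimately show ?thesis by simp
qed

text \<open>In the variable s = 1/t, with ds/dt = -s^2, the derivative of p(s) exp(-s) is s^2 (p -
  p')(s) exp(-s). At 0 the difference quotient from the right is s p(s) exp(-s) with s tending to
  infinity, and from the left it is 0.\<close>

lemma flat_has_derivative:
  "(flat p has_real_derivative flat ([:0, 0, 1:] * (p - pderiv p)) t) (at t)"
proof -
  consider "t < 0" | "t = 0" | "t > 0" by linarith
  then show ?thesis
  proof cases
    case 1
    have "((\<lambda>_. 0) has_real_derivative 0) (at t)" by simp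
    then have "(flat p has_real_derivative 0) (at t)"
    proof (rule has_field_derivative_transform_within_open)
      show "open {..<0::real}" "t \<in> {..<0}" using 1 by auto
    qed (simp add: flat_def)
    then show ?thesis using 1 by (simp add: flat_def)
  next
    case 2
    have "((\<lambda>h. flat p h / h) \<longlongrightarrow> 0) (at 0)"
    proof (rule filterlim_split_at)
      show "((\<lambda>h. flat p h / h) \<longlongrightarrow> 0) (at_left 0)"
        by (rule tendsto_eventually) (auto simp: eventually_at_filter flat_def)
      have "((\<lambda>h. poly ([:0, 1:] * p) (inverse h) * exp (- inverse h)) \<longlongrightarrow> 0) (at_right (0::real))"
        using filterlim_compose[OF poly_mult_exp_minus_tendsto_0 filterlim_inverse_at_top_right] .
      then show "((\<lambda>h. flat p h / h) \<longlongrightarrow> 0) (at_right 0)"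
        by (rule Lim_transform_eventually)
          (auto simp: eventually_at_filter flat_def field_simps)
    qed
    then show ?thesis using 2 by (simp add: has_field_derivative_iff flat_def)
  next
    case 3
    have "((\<lambda>t. poly p (1 / t) * exp (- (1 / t))) has_real_derivative
        poly ([:0, 0, 1:] * (p - pderiv p)) (1 / t) * exp (- (1 / t))) (at t)"
      using 3 by (auto intro!: derivative_eq_intros poly_DERIV[THEN DERIV_chain2]
          simp: field_simps power2_eq_square)
    then have "(flat p has_real_derivative
        poly ([:0, 0, 1:] * (p - pderiv p)) (1 / t) * exp (- (1 / t))) (at t)"
    proof (rule has_field_derivative_transform_within_open)
      show "open {0::real<..}" "t \<in> {0<..}" using 3 by auto
    qed (simp add: flat_def)
    then show ?thesis using 3 by (simp add: flat_def)
  qed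
qed

lemma flat_affine_has_derivative:
  "((\<lambda>x. flat p (c * x $ i + d)) has_derivative
    (\<lambda>v. flat ([:0, 0, 1:] * (p - pderiv p)) (c * x $ i + d) * (c * v $ i))) (at x)"
proof -
  have "((\<lambda>x. c * x $ i + d) has_derivative (\<lambda>v. c * v $ i)) (at x)"
    by (auto intro!: derivative_eq_intros bounded_linear_imp_has_derivative bounded_linear_vec_nth)
  from has_derivative_compose[OF this flat_has_derivative[unfolded has_field_derivative_def]]
  show ?thesis by simp
qed

text \<open>The polynomial has to be arbitrary in the induction, since a partial derivative is a
  constant times a function of the same kind with another polynomial.\<close>

lemma Ck_flat_affine: "Ck k (\<lambda>x. flat p (c * x $ i + d))"
proof (induction k arbitrary: p)
  case 0
  show ?case
    using flat_affine_has_derivative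
    by (auto intro!: continuous_at_imp_continuous_on has_derivative_continuous)
next
  case (Suc k)
  have "partial j (\<lambda>x. flat p (c * x $ i + d))
      = (\<lambda>x. flat ([:0, 0, 1:] * (p - pderiv p)) (c * x $ i + d) * (c * axis j 1 $ i))" for j
    by (rule ext, rule partial_eqI[OF flat_affine_has_derivative])
  moreover have "(\<lambda>x. flat p (c * x $ i + d)) differentiable at x" for x
    using flat_affine_has_derivative by (rule differentiableI)
  ultimately show ?case
    using Suc by (auto simp only: Ck.simps intro!: Ck_mult Ck_const)
qed

text \<open>The factors have the arguments n (x_i - a_i) and n (b_i - x_i), expanded to match
  \<open>Ck_flat_affine\<close>. The scale \<open>n\<close> is a steepness: the bump is supported in
  the closed box for every \<open>n\<close>, and since \<open>flat 1\<close> tends to 1 at infinity,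
  the bumps approach the indicator of the open box.\<close>

definition box_bump :: "real^'n \<Rightarrow> real^'n \<Rightarrow> nat \<Rightarrow> real^'n \<Rightarrow> real" where
  "box_bump a b n x = (\<Prod>i\<in>UNIV. flat 1 (real n * x $ i + (- real n * a $ i)) *
     flat 1 ((- real n) * x $ i + real n * b $ i))"

lemma flat_1_bounds: "0 \<le> flat 1 t" "flat 1 t \<le> 1"
  by (auto simp: flat_def)

lemma box_bump_bounds: "0 \<le> box_bump a b n x" "box_bump a b n x \<le> 1"
  unfolding box_bump_def by (auto intro!: prod_nonneg prod_le_1 mult_le_one simp: flat_1_bounds)

lemma box_bump_eq_0: "x \<notin> box a b \<Longrightarrow> box_bump a b n x = 0"
proof -
  assume "x \<notin> box a b"
  then obtain i where "x $ i \<le> a $ i \<or> b $ i \<le> x $ i" by (auto simp: mem_box_cart not_less)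
  then have "real n * x $ i \<le> real n * a $ i \<or> real n * b $ i \<le> real n * x $ i"
    by (auto intro: mult_left_mono)
  then have "flat 1 (real n * x $ i + (- real n * a $ i)) * flat 1 ((- real n) * x $ i + real n * b $ i) = 0"
    by (auto simp: flat_def)
  then show ?thesis unfolding box_bump_def by (auto intro!: prod_zero)
qed

text \<open>Any compact \<open>K\<close> outside which \<phi> vanishes will do, so the support
  itself never has to be computed.\<close>

lemma test_functionsI:
  assumes "\<And>k. Ck k \<phi>" "compact K" "K \<subseteq> \<Omega>" "\<And>x. x \<notin> K \<Longrightarrow> \<phi> x = 0"
  shows "\<phi> \<in> test_functions \<Omega>"
proof -
  have "closure {x. \<phi> x \<noteq> 0} \<subseteq> K"
    using assms by (intro closure_minimal) (auto intro: compact_imp_closed)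
  moreover from this have "compact (closure {x. \<phi> x \<noteq> 0})"
    using assms(2) by (metis closed_closure compact_Int_closed inf.absorb_iff2)
  ultimately show ?thesis using assms by (auto simp: test_functions_def)
qed

lemma box_bump_test_function:
  assumes "cbox a b \<subseteq> \<Omega>"
  shows "box_bump a b n \<in> test_functions \<Omega>"
proof (rule test_functionsI)
  show "Ck k (box_bump a b n)" for k
    unfolding box_bump_def by (intro Ck_prod Ck_mult Ck_flat_affine)
  show "box_bump a b n x = 0" if "x \<notin> cbox a b" for x
    using that box_subset_cbox by (intro box_bump_eq_0) blast
qed (use assms in auto)

lemma box_bump_tendsto: "(\<lambda>n. box_bump a b n x) \<longlonglongrightarrow> indicator (box a b) x"
proof (cases "x \<in> box a b")
  case False
  then show ?thesis by (simp add: box_bump_eq_0)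
next
  case True
  have flat_1: "(\<lambda>n. flat 1 (real n * c)) \<longlonglongrightarrow> 1" if "c > 0" for c
  proof -
    have "(\<lambda>n. exp (- (1 / (real n * c)))) \<longlonglongrightarrow> exp (- 0)"
      using that by (intro tendsto_intros real_tendsto_divide_at_top[OF tendsto_const]
          filterlim_at_top_mult_tendsto_pos[OF tendsto_const] filterlim_real_sequentially)
        (simp_all add: filterlim_real_sequentially filterlim_at_top_mult_tendsto_pos[OF tendsto_const])
    \<comment> \<open>Only eventually: at \<open>n = 0\<close> the exponential is 1, because
      \<open>1 / 0 = 0\<close>, whereas \<open>flat 1 0 = 0\<close>.\<close>
    moreover have "\<forall>\<^sub>F n in sequentially. exp (- (1 / (real n * c))) = flat 1 (real n * c)"
      using eventually_gt_at_top[of "0::nat"]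
      by (rule eventually_mono) (use that in \<open>auto simp: flat_def mult_le_0_iff\<close>)
    ultimately show ?thesis by (simp add: Lim_transform_eventually)
  qed
  have eq: "real n * x $ i + (- real n * a $ i) = real n * (x $ i - a $ i)"
    "(- real n) * x $ i + real n * b $ i = real n * (b $ i - x $ i)" for n i
    by (simp_all add: algebra_simps)
  have "(\<lambda>n. box_bump a b n x) \<longlonglongrightarrow> (\<Prod>i\<in>(UNIV::'a set). 1 * 1)"
    unfolding box_bump_def eq using True by (intro tendsto_prod tendsto_mult flat_1) (auto simp: mem_box_cart)
  then show ?thesis using True by simp
qed

section \<open>The space L2\<close>

lemma L2_measurable: "f \<in> L2 \<Omega> \<Longrightarrow> f \<in> borel_measurable (lebesgue_on \<Omega>)"
  by (simp add: L2_def)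

lemma L2_square_integrable: "f \<in> L2 \<Omega> \<Longrightarrow> integrable (lebesgue_on \<Omega>) (\<lambda>x. (norm (f x))\<^sup>2)"
  by (simp add: L2_def)

lemma L2I_bound:
  assumes "f \<in> borel_measurable (lebesgue_on \<Omega>)" "integrable (lebesgue_on \<Omega>) g"
    and "\<And>x. x \<in> \<Omega> \<Longrightarrow> (norm (f x))\<^sup>2 \<le> g x"
  shows "f \<in> L2 \<Omega>"
  unfolding L2_def mem_Collect_eq
proof
  show "integrable (lebesgue_on \<Omega>) (\<lambda>x. (norm (f x))\<^sup>2)"
  proof (rule Bochner_Integration.integrable_bound[OF assms(2)])
    show "AE x in lebesgue_on \<Omega>. norm ((norm (f x))\<^sup>2) \<le> norm (g x)"
    proof (rule AE_I2)
      fix x assume "x \<in> space (lebesgue_on \<Omega>)"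
      then have "(norm (f x))\<^sup>2 \<le> g x" using assms(3) by simp
      then show "norm ((norm (f x))\<^sup>2) \<le> norm (g x)" by simp
    qed
  qed (use assms(1) in simp)
qed (rule assms)

lemma L2_integrable_inner:
  assumes "f \<in> L2 \<Omega>" "g \<in> L2 \<Omega>"
  shows "integrable (lebesgue_on \<Omega>) (\<lambda>x. f x \<bullet> g x)"
proof (rule Bochner_Integration.integrable_bound)
  show "integrable (lebesgue_on \<Omega>) (\<lambda>x. (norm (f x))\<^sup>2 + (norm (g x))\<^sup>2)"
    using assms by (intro Bochner_Integration.integrable_add L2_square_integrable)
  have "\<bar>y \<bullet> z\<bar> \<le> (norm y)\<^sup>2 + (norm z)\<^sup>2" for y z :: 'b
  proof -
    have "0 \<le> (norm y - norm z)\<^sup>2 + (norm y)\<^sup>2 + (norm z)\<^sup>2" by simp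
    then have "norm y * norm z \<le> (norm y)\<^sup>2 + (norm z)\<^sup>2" by (simp add: power2_diff)
    then show ?thesis using Cauchy_Schwarz_ineq2[of y z] by linarith
  qed
  then show "AE x in lebesgue_on \<Omega>. norm (f x \<bullet> g x) \<le> norm ((norm (f x))\<^sup>2 + (norm (g x))\<^sup>2)"
    by simp
qed (intro borel_measurable_inner L2_measurable assms)

lemma L2_integrable_mult: "f \<in> L2 \<Omega> \<Longrightarrow> g \<in> L2 \<Omega> \<Longrightarrow> integrable (lebesgue_on \<Omega>) (\<lambda>x. f x * g x)"
  for f g :: "real^'n \<Rightarrow> real"
  using L2_integrable_inner[of f \<Omega> g] unfolding inner_real_def .

lemma L2_add_fun:
  assumes "f \<in> L2 \<Omega>" "g \<in> L2 \<Omega>"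
  shows "(\<lambda>x. f x + g x) \<in> L2 \<Omega>"
proof (rule L2I_bound)
  show "integrable (lebesgue_on \<Omega>) (\<lambda>x. 2 * (norm (f x))\<^sup>2 + 2 * (norm (g x))\<^sup>2)"
    using assms by (intro Bochner_Integration.integrable_add integrable_mult_right L2_square_integrable)
  show "(norm (f x + g x))\<^sup>2 \<le> 2 * (norm (f x))\<^sup>2 + 2 * (norm (g x))\<^sup>2" for x
  proof -
    have "(norm (f x + g x))\<^sup>2 \<le> (norm (f x) + norm (g x))\<^sup>2"
      by (simp add: norm_triangle_ineq power_mono)
    moreover have "0 \<le> (norm (f x) - norm (g x))\<^sup>2" by simp
    ultimately show ?thesis by (simp add: power2_sum power2_diff)
  qed
qed (intro borel_measurable_add L2_measurable assms)

lemma bounded_linear_borel_measurable: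
  assumes "bounded_linear T" "f \<in> borel_measurable N"
  shows "(\<lambda>x. T (f x)) \<in> borel_measurable N"
proof -
  have "T \<in> borel_measurable borel"
    using assms by (intro borel_measurable_continuous_onI linear_continuous_on)
  then show ?thesis by (rule measurable_compose[OF assms(2)])
qed

lemma L2_bounded_linear:
  assumes "bounded_linear T" "f \<in> L2 \<Omega>"
  shows "(\<lambda>x. T (f x)) \<in> L2 \<Omega>"
proof -
  obtain K where K: "\<And>y. norm (T y) \<le> norm y * K" using assms(1) bounded_linear.bounded by blast
  show ?thesis
  proof (rule L2I_bound)
    show "integrable (lebesgue_on \<Omega>) (\<lambda>x. K\<^sup>2 * (norm (f x))\<^sup>2)"
      using assms by (intro integrable_mult_right L2_square_integrable)
    show "(norm (T (f x)))\<^sup>2 \<le> K\<^sup>2 * (norm (f x))\<^sup>2" for x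
      using power_mono[OF K[of "f x"], of 2] by (simp add: power_mult_distrib mult.commute)
  qed (rule bounded_linear_borel_measurable[OF assms(1) L2_measurable[OF assms(2)]])
qed

lemma subspace_L2: "subspace (L2 \<Omega> :: (real^'n \<Rightarrow> 'b::euclidean_space) set)"
proof (rule subspaceI)
  show "(0 :: real^'n \<Rightarrow> 'b) \<in> L2 \<Omega>" by (simp add: L2_def zero_fun_def)
  show "f + g \<in> L2 \<Omega>" if "f \<in> L2 \<Omega>" "g \<in> L2 \<Omega>" for f g :: "real^'n \<Rightarrow> 'b"
    using L2_add_fun[OF that] by (simp add: plus_fun_def)
  show "c *\<^sub>R f \<in> L2 \<Omega>" if "f \<in> L2 \<Omega>" for c and f :: "real^'n \<Rightarrow> 'b"
    using L2_bounded_linear[OF bounded_linear_scaleR_right that] by (simp add: scaleR_fun_def)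
qed

lemma L2_inner_cong_AE:
  assumes "ae_eq \<Omega> f f'" "ae_eq \<Omega> g g'" "f \<in> L2 \<Omega>" "g \<in> L2 \<Omega>" "f' \<in> L2 \<Omega>" "g' \<in> L2 \<Omega>"
  shows "L2_inner \<Omega> f g = L2_inner \<Omega> f' g'"
  unfolding L2_inner_def
proof (rule integral_cong_AE)
  show "AE x in lebesgue_on \<Omega>. f x \<bullet> g x = f' x \<bullet> g' x"
    using assms(1,2) unfolding ae_eq_def by (rule eventually_elim2) simp
qed (simp_all only: L2_integrable_inner[OF assms(3,4), THEN borel_measurable_integrable]
    L2_integrable_inner[OF assms(5,6), THEN borel_measurable_integrable])

lemma linear_L2_inner: "g \<in> L2 \<Omega> \<Longrightarrow> linear_form_on (L2 \<Omega>) (\<lambda>f. L2_inner \<Omega> f g)"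
  by (rule linear_form_onI)
    (simp_all add: L2_inner_def inner_add_left L2_integrable_inner)

lemma L2_inner_commute: "L2_inner \<Omega> f g = L2_inner \<Omega> g f"
  by (simp add: L2_inner_def inner_commute)

interpretation L2: semi_inner_product "L2 \<Omega>" "L2_inner \<Omega>" for \<Omega>
proof
  show "0 \<le> L2_inner \<Omega> u u" for u :: "real^'a \<Rightarrow> 'b" by (simp add: L2_inner_def)
qed (rule subspace_L2 linear_L2_inner L2_inner_commute; assumption?)+

lemma L2_seminorm_eq [simp]: "L2.seminorm \<Omega> f = L2_norm \<Omega> f"
  by (simp add: L2.seminorm_def L2_norm_def)

lemma L2_norm_eq_0:
  assumes "f \<in> L2 \<Omega>"
  shows "L2_norm \<Omega> f = 0 \<longleftrightarrow> ae_eq \<Omega> f (\<lambda>x. 0)"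
proof -
  have "L2_norm \<Omega> f = 0 \<longleftrightarrow> (\<integral>x. f x \<bullet> f x \<partial>lebesgue_on \<Omega>) = 0"
    by (simp add: L2_norm_def L2_inner_def)
  also have "\<dots> \<longleftrightarrow> (AE x in lebesgue_on \<Omega>. f x \<bullet> f x = 0)"
    using L2_integrable_inner[OF assms assms] by (rule integral_nonneg_eq_0_iff_AE) simp
  finally show ?thesis by (simp add: ae_eq_def)
qed

lemma ae_eq_iff_norm_diff:
  assumes "f \<in> L2 \<Omega>" "g \<in> L2 \<Omega>"
  shows "ae_eq \<Omega> f g \<longleftrightarrow> L2_norm \<Omega> (f - g) = 0"
proof -
  have "f - g \<in> L2 \<Omega>" using assms subspace_L2 by (rule subspace_diff[rotated])
  then show ?thesis by (simp add: L2_norm_eq_0 ae_eq_def)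
qed

lemma L2_norm_cong: "ae_eq \<Omega> f g \<Longrightarrow> f \<in> L2 \<Omega> \<Longrightarrow> g \<in> L2 \<Omega> \<Longrightarrow> L2_norm \<Omega> f = L2_norm \<Omega> g"
  by (simp add: L2_norm_def L2_inner_cong_AE)

lemma L2_norm_triangle:
  "f \<in> L2 \<Omega> \<Longrightarrow> g \<in> L2 \<Omega> \<Longrightarrow> L2_norm \<Omega> (f + g) \<le> L2_norm \<Omega> f + L2_norm \<Omega> g"
  using L2.seminorm_triangle by simp

lemma L2_norm_scaleR: "f \<in> L2 \<Omega> \<Longrightarrow> L2_norm \<Omega> (t *\<^sub>R f) = \<bar>t\<bar> * L2_norm \<Omega> f"
  using L2.seminorm_scaleR by simp

lemma L2_norm_nonneg: "0 \<le> L2_norm \<Omega> f"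
  by (simp add: L2_norm_def L2_inner_def)

lemma bounded_bilinear_matrix_vector_mult:
  "bounded_bilinear ((*v) :: real^'n^'m \<Rightarrow> real^'n \<Rightarrow> real^'m)"
  unfolding bilinear_conv_bounded_bilinear[symmetric] bilinear_def
  by (auto intro!: linearI simp: matrix_vector_mult_add_rdistrib matrix_vector_right_distrib
      scaleR_matrix_vector_assoc matrix_vector_mult_scaleR)

text \<open>The product of two square-integrable factors is only integrable in general; a bounded
  vector factor keeps it in L2, so that it may again be paired with an L2 function. This is what the
  convective term needs.\<close>

lemma L2_matrix_vector_mult:
  fixes W :: "real^'n \<Rightarrow> real^'k^'m" and u :: "real^'n \<Rightarrow> real^'k"
  assumes "W \<in> L2 \<Omega>" "u \<in> borel_measurable (lebesgue_on \<Omega>)" "\<And>x. x \<in> \<Omega> \<Longrightarrow> norm (u x) \<le> B"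
  shows "(\<lambda>x. W x *v u x) \<in> L2 \<Omega>"
proof -
  interpret m: bounded_bilinear "(*v) :: real^'k^'m \<Rightarrow> real^'k \<Rightarrow> real^'m"
    by (rule bounded_bilinear_matrix_vector_mult)
  obtain K where K: "K > 0" "\<And>(A :: real^'k^'m) x. norm (A *v x) \<le> norm A * norm x * K"
    using m.pos_bounded by blast
  show ?thesis
  proof (rule L2I_bound)
    show "integrable (lebesgue_on \<Omega>) (\<lambda>x. (B * K)\<^sup>2 * (norm (W x))\<^sup>2)"
      using assms by (intro integrable_mult_right L2_square_integrable)
    show "(norm (W x *v u x))\<^sup>2 \<le> (B * K)\<^sup>2 * (norm (W x))\<^sup>2" if "x \<in> \<Omega>" for x
    proof -
      have "norm (W x *v u x) \<le> norm (W x) * norm (u x) * K" by (rule K)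
      also have "\<dots> \<le> norm (W x) * B * K"
        using assms(3)[OF that] K(1) by (intro mult_right_mono mult_left_mono) auto
      finally have "(norm (W x *v u x))\<^sup>2 \<le> (norm (W x) * B * K)\<^sup>2" by (intro power_mono) auto
      then show ?thesis by (simp add: power_mult_distrib mult_ac)
    qed
    show "(\<lambda>x. W x *v u x) \<in> borel_measurable (lebesgue_on \<Omega>)"
      using L2_measurable[OF assms(1)] assms(2)
      by (rule borel_measurable_continuous_Pair) (rule m.continuous_on[OF continuous_on_fst[OF continuous_on_id] continuous_on_snd[OF continuous_on_id]])
  qed
qed

section \<open>Test functions and the fundamental lemma\<close>

lemma test_function_Ck: "\<phi> \<in> test_functions \<Omega> \<Longrightarrow> Ck k \<phi>"
  by (simp add: test_functions_def)

lemma test_function_differentiable: "\<phi> \<in> test_functions \<Omega> \<Longrightarrow> \<phi> differentiable at x"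
  using test_function_Ck[of \<phi> \<Omega> 1] by simp

lemma test_function_continuous: "\<phi> \<in> test_functions \<Omega> \<Longrightarrow> continuous_on UNIV \<phi>"
  using test_function_Ck[of \<phi> \<Omega> 0] by simp

lemma test_function_support:
  assumes "\<phi> \<in> test_functions \<Omega>"
  obtains K where "compact K" "K \<subseteq> \<Omega>" "\<And>x. x \<notin> K \<Longrightarrow> \<phi> x = 0"
proof
  show "compact (closure {x. \<phi> x \<noteq> 0})" "closure {x. \<phi> x \<noteq> 0} \<subseteq> \<Omega>"
    using assms by (auto simp: test_functions_def)
  show "\<phi> x = 0" if "x \<notin> closure {x. \<phi> x \<noteq> 0}" for x
    using that subsetD[OF closure_subset, of x "{x. \<phi> x \<noteq> 0}"] by auto
qed

lemma test_function_bounded: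
  assumes "\<phi> \<in> test_functions \<Omega>"
  obtains B where "0 \<le> B" "\<And>x. \<bar>\<phi> x\<bar> \<le> B"
proof -
  obtain K where K: "compact K" "K \<subseteq> \<Omega>" "\<And>x. x \<notin> K \<Longrightarrow> \<phi> x = 0"
    by (rule test_function_support[OF assms]) (rule that)
  have "compact (\<phi> ` K)"
    by (rule compact_continuous_image[OF
          continuous_on_subset[OF test_function_continuous[OF assms] subset_UNIV] K(1)])
  then obtain B where B: "\<forall>y\<in>\<phi> ` K. norm y \<le> B" using compact_imp_bounded bounded_iff by metis
  have "\<bar>\<phi> x\<bar> \<le> max 0 B" for x using B K(3)[of x] by (cases "x \<in> K") fastforce+
  then show ?thesis using that[of "max 0 B"] by simp
qed

lemma zero_test_function: "(\<lambda>x. 0) \<in> test_functions \<Omega>"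
  by (rule test_functionsI[of _ "{}"]) (auto simp: Ck_const)

lemma test_function_add:
  assumes "\<phi> \<in> test_functions \<Omega>" "\<psi> \<in> test_functions \<Omega>"
  shows "(\<lambda>x. \<phi> x + \<psi> x) \<in> test_functions \<Omega>"
proof -
  obtain K where K: "compact K" "K \<subseteq> \<Omega>" "\<And>x. x \<notin> K \<Longrightarrow> \<phi> x = 0"
    by (rule test_function_support[OF assms(1)]) (rule that)
  obtain L where L: "compact L" "L \<subseteq> \<Omega>" "\<And>x. x \<notin> L \<Longrightarrow> \<psi> x = 0"
    by (rule test_function_support[OF assms(2)]) (rule that)
  show ?thesis
  proof (rule test_functionsI)
    show "compact (K \<union> L)" using K L by blast
  qed (use K L assms in \<open>auto intro: Ck_add test_function_Ck\<close>)
qed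

text \<open>Only \<phi> carries the compact support, so scalar multiples and products of test
  functions are both covered.\<close>

lemma test_function_mult:
  assumes "\<phi> \<in> test_functions \<Omega>" "\<And>k. Ck k \<psi>"
  shows "(\<lambda>x. \<psi> x * \<phi> x) \<in> test_functions \<Omega>"
proof -
  obtain K where K: "compact K" "K \<subseteq> \<Omega>" "\<And>x. x \<notin> K \<Longrightarrow> \<phi> x = 0"
    by (rule test_function_support[OF assms(1)]) (rule that)
  show ?thesis
    by (rule test_functionsI[OF _ K(1,2)]) (use K assms in \<open>auto intro: Ck_mult test_function_Ck\<close>)
qed

lemma test_function_partial:
  assumes "\<phi> \<in> test_functions \<Omega>"
  shows "partial j \<phi> \<in> test_functions \<Omega>"
proof -
  obtain K where K: "compact K" "K \<subseteq> \<Omega>" "\<And>x. x \<notin> K \<Longrightarrow> \<phi> x = 0"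
    by (rule test_function_support[OF assms(1)]) (rule that)
  show ?thesis
  proof (rule test_functionsI[OF _ K(1,2)])
    show "Ck k (partial j \<phi>)" for k using test_function_Ck[OF assms, of "Suc k"] by simp
    show "partial j \<phi> x = 0" if "x \<notin> K" for x
    proof -
      have "(\<phi> has_derivative (\<lambda>v. 0)) (at x)"
        by (rule has_derivative_transform_within_open[of "\<lambda>x. 0" _ _ _ "- K"])
          (use K that in \<open>auto intro: compact_imp_closed open_Compl\<close>)
      then show ?thesis by (rule partial_eqI)
    qed
  qed
qed

lemma test_function_integrable_lborel:
  assumes "\<phi> \<in> test_functions \<Omega>"
  shows "integrable lborel \<phi>"
proof -
  obtain K where K: "compact K" "K \<subseteq> \<Omega>" "\<And>x. x \<notin> K \<Longrightarrow> \<phi> x = 0"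
    by (rule test_function_support[OF assms(1)]) (rule that)
  have "integrable lborel (\<lambda>x. indicator K x *\<^sub>R \<phi> x)"
    using borel_integrable_compact[OF K(1)
        continuous_on_subset[OF test_function_continuous[OF assms] subset_UNIV]]
    by (simp add: set_integrable_def indicator_scaleR_eq_if)
  moreover have "(\<lambda>x. indicator K x *\<^sub>R \<phi> x) = \<phi>" using K(3) by (auto simp: fun_eq_iff indicator_def)
  ultimately show ?thesis by simp
qed

lemma test_function_borel: "\<phi> \<in> test_functions \<Omega> \<Longrightarrow> \<phi> \<in> borel_measurable borel"
  by (rule borel_measurable_continuous_onI[OF test_function_continuous])

lemma test_function_zero_outside: "\<phi> \<in> test_functions \<Omega> \<Longrightarrow> x \<notin> \<Omega> \<Longrightarrow> \<phi> x = 0"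
  by (metis test_function_support subsetD)

text \<open>Passage from the measure on the domain, used in the definitions, to the Lebesgue-Borel
  measure of the whole space, where translation invariance is available.\<close>

lemma integrable_lebesgue_on_if_zero_outside:
  fixes g :: "real^'n \<Rightarrow> real"
  assumes "open \<Omega>" "integrable lborel g" "\<And>x. x \<notin> \<Omega> \<Longrightarrow> g x = 0"
  shows "integrable (lebesgue_on \<Omega>) g" "(\<integral>x. g x \<partial>lebesgue_on \<Omega>) = (\<integral>x. g x \<partial>lborel)"
proof -
  have \<Omega>: "\<Omega> \<inter> space lebesgue \<in> sets lebesgue" using assms(1) by simp
  have eq: "(\<lambda>x. indicator \<Omega> x *\<^sub>R g x) = g" using assms(3) by (auto simp: fun_eq_iff indicator_def)
  have m: "g \<in> borel_measurable lborel" using assms(2) by simp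
  show "integrable (lebesgue_on \<Omega>) g"
    using assms(2) m by (simp only: integrable_restrict_space[OF \<Omega>] eq integrable_completion)
  show "(\<integral>x. g x \<partial>lebesgue_on \<Omega>) = (\<integral>x. g x \<partial>lborel)"
    using m by (simp only: integral_restrict_space[OF \<Omega>] eq integral_completion)
qed

lemma test_function_L2:
  assumes "open \<Omega>" "\<phi> \<in> test_functions \<Omega>"
  shows "\<phi> \<in> L2 \<Omega>"
proof -
  have sq: "(\<lambda>x. \<phi> x * \<phi> x) \<in> test_functions \<Omega>"
    using test_function_mult[OF assms(2) test_function_Ck[OF assms(2)]] .
  have "integrable (lebesgue_on \<Omega>) (\<lambda>x. (norm (\<phi> x))\<^sup>2)"
    using integrable_lebesgue_on_if_zero_outside(1)[OF assms(1) test_function_integrable_lborel[OF sq]]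
      test_function_zero_outside[OF assms(2)] by (simp add: power2_eq_square)
  moreover have "\<phi> \<in> borel_measurable (lebesgue_on \<Omega>)"
    using integrable_lebesgue_on_if_zero_outside(1)[OF assms(1) test_function_integrable_lborel[OF assms(2)]]
      test_function_zero_outside[OF assms(2)] by (intro borel_measurable_integrable) blast
  ultimately show ?thesis by (simp add: L2_def)
qed

text \<open>Restriction to a line parallel to an axis, so that the one-dimensional mean value
  theorem can be applied to difference quotients.\<close>

lemma test_function_DERIV_line:
  assumes "\<phi> \<in> test_functions \<Omega>"
  shows "((\<lambda>t. \<phi> (x + t *\<^sub>R axis j 1)) has_real_derivative partial j \<phi> (x + t *\<^sub>R axis j 1)) (at t)"
proof -
  have 1: "((\<lambda>t. x + t *\<^sub>R axis j 1) has_derivative (\<lambda>t. t *\<^sub>R axis j 1)) (at t)"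
    by (auto intro!: derivative_eq_intros)
  define D where "D = frechet_derivative \<phi> (at (x + t *\<^sub>R axis j 1))"
  have 2: "(\<phi> has_derivative D) (at (x + t *\<^sub>R axis j 1))"
    unfolding D_def using assms by (intro differentiable_imp_has_derivative test_function_differentiable)
  then interpret D: linear D by (rule has_derivative_linear)
  have "((\<lambda>t. \<phi> (x + t *\<^sub>R axis j 1)) has_derivative (\<lambda>t. D (t *\<^sub>R axis j 1))) (at t)"
    using has_derivative_compose[OF 1 2] .
  then show ?thesis
    by (simp add: has_field_derivative_def D.scaleR partial_eqI[OF 2] mult.commute[of _ "D _"])
qed

text \<open>The integral of a difference quotient vanishes by translation invariance.\<close>

lemma integral_partial_eq_0:
  fixes \<phi> :: "real^'n \<Rightarrow> real"
  assumes "\<phi> \<in> test_functions \<Omega>"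
  shows "(\<integral>x. partial j \<phi> x \<partial>lborel) = 0"
proof -
  define e :: "real^'n" where "e = axis j 1"
  define t where "t n = inverse (real (Suc n))" for n
  define q where "q n x = (\<phi> (x + t n *\<^sub>R e) - \<phi> x) / t n" for n x
  have t: "0 < t n" "t n \<le> 1" for n by (auto simp: t_def inverse_le_1_iff)
  note [measurable] = test_function_borel[OF assms] test_function_borel[OF test_function_partial[OF assms]]
  have shift: "integrable lborel (\<lambda>x. \<phi> (x + c))" "(\<integral>x. \<phi> (x + c) \<partial>lborel) = (\<integral>x. \<phi> x \<partial>lborel)" for c
  proof -
    have d: "distr lborel borel ((+) c) = lborel" by (rule lborel_distr_plus)
    have "integrable (distr lborel borel ((+) c)) \<phi>"
      using test_function_integrable_lborel[OF assms] by (simp add: d)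
    then show "integrable lborel (\<lambda>x. \<phi> (x + c))"
      by (subst (asm) integrable_distr_eq) (auto simp: add.commute)
    have "(\<integral>x. \<phi> x \<partial>distr lborel borel ((+) c)) = (\<integral>x. \<phi> (c + x) \<partial>lborel)"
      by (rule integral_distr) auto
    then show "(\<integral>x. \<phi> (x + c) \<partial>lborel) = (\<integral>x. \<phi> x \<partial>lborel)" by (simp add: d add.commute)
  qed
  have q0: "(\<integral>x. q n x \<partial>lborel) = 0" for n
    unfolding q_def using shift test_function_integrable_lborel[OF assms]
    by simp
  obtain K where K: "compact K" "K \<subseteq> \<Omega>" "\<And>x. x \<notin> K \<Longrightarrow> \<phi> x = 0"
    by (rule test_function_support[OF assms(1)]) (rule that)
  obtain R where R: "\<And>x. x \<in> K \<Longrightarrow> norm x \<le> R"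
    using compact_imp_bounded[OF K(1)] bounded_iff by metis
  obtain B where B: "0 \<le> B" "\<And>x. \<bar>partial j \<phi> x\<bar> \<le> B"
    by (rule test_function_bounded[OF test_function_partial[OF assms]]) (rule that)
  have "(\<lambda>n. \<integral>x. q n x \<partial>lborel) \<longlonglongrightarrow> (\<integral>x. partial j \<phi> x \<partial>lborel)"
  proof (rule integral_dominated_convergence)
    \<comment> \<open>By the mean value theorem a difference quotient is a value of the partial
      derivative, hence bounded by \<open>B\<close>. The steps \<open>t n\<close> are at most 1, so
      all translated supports stay in the ball of radius \<open>R + 1\<close>.\<close>
    show "integrable lborel (\<lambda>x::real^'n. indicator (cball 0 (R + 1)) x * B)"
      using emeasure_lborel_cball_finite[of "0::real^'n" "R + 1"]
      by (intro integrable_mult_left integrable_real_indicator) simp_all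
    have "norm (q n x) \<le> indicator (cball 0 (R + 1)) x * B" for n x
    proof (cases "x \<in> cball 0 (R + 1)")
      case True
      have "\<exists>z>0. z < t n \<and> \<phi> (x + t n *\<^sub>R e) - \<phi> (x + 0 *\<^sub>R e) = (t n - 0) * partial j \<phi> (x + z *\<^sub>R e)"
        by (rule MVT2[OF t(1)]) (simp add: e_def test_function_DERIV_line[OF assms])
      then obtain z where "\<phi> (x + t n *\<^sub>R e) - \<phi> (x + 0 *\<^sub>R e) = (t n - 0) * partial j \<phi> (x + z *\<^sub>R e)"
        by blast
      then have "q n x = partial j \<phi> (x + z *\<^sub>R e)" using t(1)[of n] by (simp add: q_def)
      then show ?thesis using True B by simp
    next
      case False
      then have nx: "norm x > R + 1" by simp
      have "norm (t n *\<^sub>R e) \<le> 1" using t[of n] by (simp add: e_def norm_axis_1)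
      then have "norm (x + t n *\<^sub>R e) > R" using nx norm_triangle_ineq2[of x "- (t n *\<^sub>R e)"] by simp
      then have "x \<notin> K" "x + t n *\<^sub>R e \<notin> K" using R nx by fastforce+
      then show ?thesis using K(3) False by (simp add: q_def)
    qed
    then show "AE x in lborel. norm (q n x) \<le> indicator (cball 0 (R + 1)) x * B" for n by simp
    have "(\<lambda>n. q n x) \<longlonglongrightarrow> partial j \<phi> x" for x
    proof -
      have "((\<lambda>h. (\<phi> (x + (0 + h) *\<^sub>R e) - \<phi> (x + 0 *\<^sub>R e)) / h) \<longlongrightarrow> partial j \<phi> (x + 0 *\<^sub>R e)) (at 0)"
        using test_function_DERIV_line[OF assms, of x j 0] unfolding DERIV_def e_def .
      moreover have "filterlim t (at 0) sequentially"
        unfolding filterlim_at using LIMSEQ_inverse_real_of_nat t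
        by (auto simp: t_def[abs_def] less_imp_neq[symmetric])
      ultimately show ?thesis by (auto simp: q_def[abs_def] dest: filterlim_compose)
    qed
    then show "AE x in lborel. (\<lambda>n. q n x) \<longlonglongrightarrow> partial j \<phi> x" by simp
  qed (auto simp: q_def)
  then show ?thesis unfolding q0 by (simp add: LIMSEQ_const_iff)
qed

text \<open>The product is itself a test function, so the integral of its partial derivative is 0.
  No boundary term arises, and the regularity of the boundary is irrelevant.\<close>

lemma integration_by_parts:
  assumes "open \<Omega>" "\<phi> \<in> test_functions \<Omega>" "\<psi> \<in> test_functions \<Omega>"
  shows "(\<integral>x. \<phi> x * partial j \<psi> x \<partial>lebesgue_on \<Omega>) = - (\<integral>x. partial j \<phi> x * \<psi> x \<partial>lebesgue_on \<Omega>)"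
proof -
  have prod: "(\<lambda>x. \<phi> x * \<psi> x) \<in> test_functions \<Omega>"
    using test_function_mult[OF assms(3) test_function_Ck[OF assms(2)]] .
  have "(\<integral>x. partial j (\<lambda>x. \<phi> x * \<psi> x) x \<partial>lebesgue_on \<Omega>) = 0"
    using integrable_lebesgue_on_if_zero_outside(2)[OF assms(1)
        test_function_integrable_lborel[OF test_function_partial[OF prod]]]
      test_function_zero_outside[OF test_function_partial[OF prod]] integral_partial_eq_0[OF prod]
    by metis
  moreover have "partial j (\<lambda>x. \<phi> x * \<psi> x) = (\<lambda>x. \<phi> x * partial j \<psi> x + partial j \<phi> x * \<psi> x)"
    using assms by (intro partial_mult allI test_function_differentiable)
  moreover have "integrable (lebesgue_on \<Omega>) (\<lambda>x. \<phi> x * partial j \<psi> x)"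
    "integrable (lebesgue_on \<Omega>) (\<lambda>x. partial j \<phi> x * \<psi> x)"
    by (rule L2_integrable_mult; rule test_function_L2[OF assms(1)]; intro test_function_partial assms)+
  ultimately show ?thesis by (simp add: eq_neg_iff_add_eq_0)
qed

text \<open>A Dynkin argument: boxes are stable under intersection and generate the Borel sets, and
  the sets over which the integral vanishes are closed under complements and countable disjoint
  unions. A density whose integral over every Borel set is 0 vanishes almost everywhere.\<close>

lemma AE_eq_0_if_box_integrals_eq_0:
  fixes w :: "real^'n \<Rightarrow> real"
  assumes w: "integrable lebesgue w" "(\<integral>x. w x \<partial>lebesgue) = 0"
    and box: "\<And>a b. (\<integral>x. indicator (box a b) x * w x \<partial>lebesgue) = 0"
  shows "AE x in lebesgue. w x = 0"
proof -
  \<comment> \<open>The argument runs over Borel sets, so the Lebesgue measurable \<open>w\<close>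
    is first replaced by a Borel measurable version.\<close>
  obtain g where g1: "g \<in> borel_measurable lborel" "AE x in lborel. w x = g x"
    using completion_ex_borel_measurable_real[OF borel_measurable_integrable[OF w(1)]] by blast
  note g = g1(1) AE_completion[OF g1(2)]
  note [measurable] = g(1)
  have gl: "g \<in> borel_measurable lebesgue" using g(1) by (rule measurable_completion)
  have "integrable lebesgue g" by (rule integrable_cong_AE_imp[OF w(1) gl g(2)])
  then have int: "integrable lborel g" using g(1) by (simp only: integrable_completion)
  then have sint: "set_integrable lborel A g" if "A \<in> sets lborel" for A
    using that unfolding set_integrable_def by (rule integrable_mult_indicator[rotated])
  have transfer: "(LINT x:A|lborel. g x) = (\<integral>x. indicator A x * w x \<partial>lebesgue)" if A: "A \<in> sets borel" for A
  proof -
    have "(LINT x:A|lborel. g x) = (\<integral>x. indicator A x * g x \<partial>lebesgue)"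
      unfolding set_lebesgue_integral_def using A
      by (subst integral_completion) auto
    also have "\<dots> = (\<integral>x. indicator A x * w x \<partial>lebesgue)"
    proof (rule integral_cong_AE)
      show "AE x in lebesgue. indicator A x * g x = indicator A x * w x"
        using g(2) by (rule eventually_mono) simp
      have "indicator A \<in> borel_measurable lebesgue" using A by (auto intro: measurable_completion)
      then show "(\<lambda>x. indicator A x * g x) \<in> borel_measurable lebesgue"
        "(\<lambda>x. indicator A x * w x) \<in> borel_measurable lebesgue"
        using gl borel_measurable_integrable[OF w(1)] by (auto intro: borel_measurable_times)
    qed
    finally show ?thesis .
  qed
  have stable: "Int_stable (range (\<lambda>(a, b). box a b :: (real^'n) set))"
    by (auto simp: Int_stable_def box_Int_box)
  have closed: "range (\<lambda>(a, b). box a b) \<subseteq> Pow (UNIV :: (real^'n) set)" by simp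
  have "(LINT x:A|lborel. g x) = 0" if "A \<in> sigma_sets UNIV (range (\<lambda>(a, b). box a b))"
    for A :: "(real^'n) set"
    using stable closed that
  proof (induction rule: sigma_sets_induct_disjoint)
    case (basic A)
    then obtain a b where "A = box a b" by auto
    then show ?case using box by (simp add: transfer)
  next
    case empty
    then show ?case by (simp add: set_lebesgue_integral_def)
  next
    case (compl A)
    have A: "A \<in> sets borel" using compl by (simp add: borel_eq_box)
    have "(LINT x:A \<union> (UNIV - A)|lborel. g x) = (LINT x:A|lborel. g x) + (LINT x:UNIV - A|lborel. g x)"
      by (rule set_integral_Un) (use A sint in auto)
    \<comment> \<open>Complements are taken in the whole space, which is not a box; this is the
      place for the assumption on the total integral.\<close>
    moreover have "(LINT x:A \<union> (UNIV - A)|lborel. g x) = 0" using w(2) by (simp add: transfer)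
    ultimately show ?case using compl by simp
  next
    case (union A)
    have A: "range A \<subseteq> sets borel" using union by (simp add: borel_eq_box)
    have "(LINT x:(\<Union>i. A i)|lborel. g x) = (\<Sum>i. (LINT x:A i|lborel. g x))"
    proof (rule lebesgue_integral_countable_add)
      show "A i \<inter> A j = {}" if "i \<noteq> j" for i j using union(1) that by (auto simp: disjoint_family_on_def)
    qed (use A sint in auto)
    then show ?case using union by simp
  qed
  then have "AE x in lborel. g x = 0"
    by (intro sigma_finite_measure.density_zero[OF sigma_finite_lborel] int) (simp add: borel_eq_box)
  then have "AE x in lebesgue. g x = 0" by (rule AE_completion)
  with g(2) show ?thesis by (rule eventually_elim2) simp
qed

lemma box_indicator_L2:
  assumes "open \<Omega>" "box a b \<subseteq> \<Omega>"
  shows "(indicator (box a b) :: real^'n \<Rightarrow> real) \<in> L2 \<Omega>"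
proof -
  have "integrable lborel (indicator (box a b) :: real^'n \<Rightarrow> real)"
    using emeasure_lborel_box_finite[of a b] by (intro integrable_real_indicator) auto
  then have "integrable (lebesgue_on \<Omega>) (indicator (box a b) :: real^'n \<Rightarrow> real)"
    using assms by (intro integrable_lebesgue_on_if_zero_outside) (auto simp: indicator_def)
  then show ?thesis by (intro L2I_bound[OF borel_measurable_integrable]) (auto simp: indicator_def)
qed

text \<open>Bumps converge boundedly to the indicator of a box, so integrals over boxes whose
  closure lies in the domain vanish. This gives \<open>W = 0\<close> almost everywhere on each such
  box, and an open set is a countable union of closed boxes.\<close>

theorem fundamental_lemma_of_variations:
  fixes W :: "real^'n \<Rightarrow> real"
  assumes \<Omega>: "open \<Omega>" and W: "W \<in> L2 \<Omega>"
    and zero: "\<And>\<phi>. \<phi> \<in> test_functions \<Omega> \<Longrightarrow> (\<integral>x. W x * \<phi> x \<partial>lebesgue_on \<Omega>) = 0"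
  shows "ae_eq \<Omega> W (\<lambda>x. 0)"
proof -
  have \<Omega>s: "\<Omega> \<inter> space lebesgue \<in> sets lebesgue" using \<Omega> by simp
  have int: "integrable (lebesgue_on \<Omega>) (\<lambda>x. W x * indicator (box a b) x)" if "box a b \<subseteq> \<Omega>" for a b
    using L2_integrable_mult[OF W box_indicator_L2[OF \<Omega> that]] .
  have restrict: "integrable lebesgue (\<lambda>x. indicator (box a b) x * W x)"
      "(\<integral>x. indicator (box a b) x * W x \<partial>lebesgue) = (\<integral>x. W x * indicator (box a b) x \<partial>lebesgue_on \<Omega>)"
    if "box a b \<subseteq> \<Omega>" for a b
  proof -
    have eq: "(\<lambda>x. indicator \<Omega> x *\<^sub>R (W x * indicator (box a b) x)) = (\<lambda>x. indicator (box a b) x * W x)"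
      using that by (auto simp: fun_eq_iff indicator_def)
    show "integrable lebesgue (\<lambda>x. indicator (box a b) x * W x)"
      using int[OF that] unfolding integrable_restrict_space[OF \<Omega>s] eq .
    show "(\<integral>x. indicator (box a b) x * W x \<partial>lebesgue) = (\<integral>x. W x * indicator (box a b) x \<partial>lebesgue_on \<Omega>)"
      unfolding integral_restrict_space[OF \<Omega>s] eq ..
  qed
  have box0: "(\<integral>x. indicator (box a b) x * W x \<partial>lebesgue) = 0" if ab: "cbox a b \<subseteq> \<Omega>" for a b
  proof -
    have sub: "box a b \<subseteq> \<Omega>" by (rule order_trans[OF box_subset_cbox ab])
    have "(\<lambda>n. \<integral>x. W x * box_bump a b n x \<partial>lebesgue_on \<Omega>)
        \<longlonglongrightarrow> (\<integral>x. W x * indicator (box a b) x \<partial>lebesgue_on \<Omega>)"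
    proof (rule integral_dominated_convergence)
      show "integrable (lebesgue_on \<Omega>) (\<lambda>x. norm (W x * indicator (box a b) x))"
        using int[OF sub] by (rule integrable_norm)
      have "norm (W x * box_bump a b n x) \<le> norm (W x * indicator (box a b) x)" for x n
        using box_bump_bounds[of a b n x] box_bump_eq_0[of x a b n]
        by (cases "x \<in> box a b") (auto simp: abs_mult mult_left_le)
      then show "AE x in lebesgue_on \<Omega>. norm (W x * box_bump a b n x) \<le> norm (W x * indicator (box a b) x)" for n
        by simp
      show "AE x in lebesgue_on \<Omega>. (\<lambda>n. W x * box_bump a b n x) \<longlonglongrightarrow> W x * indicator (box a b) x"
        by (intro AE_I2 tendsto_mult tendsto_const box_bump_tendsto)
      show "(\<lambda>x. W x * indicator (box a b) x) \<in> borel_measurable (lebesgue_on \<Omega>)"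
        using int[OF sub] by (rule borel_measurable_integrable)
      show "(\<lambda>x. W x * box_bump a b n x) \<in> borel_measurable (lebesgue_on \<Omega>)" for n
        using L2_integrable_mult[OF W test_function_L2[OF \<Omega> box_bump_test_function[OF ab]]]
        by (rule borel_measurable_integrable)
    qed
    moreover have "(\<integral>x. W x * box_bump a b n x \<partial>lebesgue_on \<Omega>) = 0" for n
      by (rule zero[OF box_bump_test_function[OF ab]])
    ultimately show ?thesis by (simp add: restrict[OF sub] LIMSEQ_const_iff)
  qed
  have AE_box: "AE x in lebesgue. x \<in> cbox a b \<longrightarrow> W x = 0" if ab: "cbox a b \<subseteq> \<Omega>" for a b
  proof -
    have sub: "box a b \<subseteq> \<Omega>" by (rule order_trans[OF box_subset_cbox ab])
    have "AE x in lebesgue. indicator (box a b) x * W x = 0"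
    proof (rule AE_eq_0_if_box_integrals_eq_0)
      show "(\<integral>x. indicator (box c d) x * (indicator (box a b) x * W x) \<partial>lebesgue) = 0" for c d
      proof -
        obtain e f where ef: "box c d \<inter> box a b = box e f" using box_Int_box[of c d a b] by blast
        have eq: "(\<lambda>x. indicator (box c d) x * (indicator (box a b) x * W x)) = (\<lambda>x. indicator (box e f) x * W x)"
          unfolding ef[symmetric] by (auto simp: fun_eq_iff indicator_def)
        \<comment> \<open>The empty case is separate: if \<open>box e f\<close> is empty,
          \<open>cbox e f\<close> may still be a nonempty degenerate box outside the domain, and
          \<open>box0\<close> would not apply.\<close>
        show ?thesis
        proof (cases "box e f = {}")
          case False
          then have "cbox e f = closure (box e f)" by (simp add: closure_box)
          also have "\<dots> \<subseteq> cbox a b"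
            using ef box_subset_cbox[of a b] by (intro closure_minimal closed_cbox) blast
          finally show ?thesis unfolding eq using ab by (intro box0) blast
        qed (simp add: eq)
      qed
    qed (use restrict[OF sub] box0[OF ab] in auto)
    \<comment> \<open>The closed boxes are the ones that cover the domain, and they differ from the
      open ones by null sets.\<close>
    moreover have "AE x in lebesgue. x \<notin> cbox a b - box a b"
      using negligible_frontier_interval by (intro AE_not_in) (simp add: negligible_iff_null_sets)
    ultimately show ?thesis by (rule eventually_elim2) (auto simp: indicator_def)
  qed
  obtain D where D: "countable D" "D \<subseteq> Pow \<Omega>" "\<And>X. X \<in> D \<Longrightarrow> \<exists>a b. X = cbox a b" "\<Union>D = \<Omega>"
    by (rule open_countable_Union_open_cbox[OF \<Omega>]) (rule that)
  have "AE x in lebesgue. \<forall>X\<in>D. x \<in> X \<longrightarrow> W x = 0"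
  proof (rule AE_ball_countable'[OF _ D(1)])
    fix X assume X: "X \<in> D"
    then obtain a b where "X = cbox a b" using D(3) by blast
    with X D(2) show "AE x in lebesgue. x \<in> X \<longrightarrow> W x = 0" using AE_box[of a b] by blast
  qed
  then have "AE x in lebesgue. x \<in> \<Omega> \<longrightarrow> W x = 0" by (rule eventually_mono) (use D(4) in blast)
  then show ?thesis unfolding ae_eq_def AE_restrict_space_iff[OF \<Omega>s] .
qed

section \<open>Weak gradients\<close>

lemma L2_component: "W \<in> L2 \<Omega> \<Longrightarrow> (\<lambda>x. W x $ i $ j) \<in> L2 \<Omega>"
  for W :: "real^'n \<Rightarrow> real^'k^'m"
  by (rule L2_bounded_linear[where T="\<lambda>A. A $ i $ j"])
    (rule bounded_linear_compose[OF bounded_linear_vec_nth bounded_linear_vec_nth])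

lemma L2_nth: "u \<in> L2 \<Omega> \<Longrightarrow> (\<lambda>x. u x $ i) \<in> L2 \<Omega>"
  for u :: "real^'n \<Rightarrow> real^'m"
  by (rule L2_bounded_linear[OF bounded_linear_vec_nth])

lemma sum_fun_apply: "(\<Sum>i\<in>I. f i) x = (\<Sum>i\<in>I. f i x)"
  by (induction I rule: infinite_finite_induct) auto

lemma L2_vecI:
  fixes f :: "real^'n \<Rightarrow> 'b::euclidean_space^'m"
  assumes "\<And>i. (\<lambda>x. f x $ i) \<in> L2 \<Omega>"
  shows "f \<in> L2 \<Omega>"
proof -
  have lin: "bounded_linear (axis i :: 'b \<Rightarrow> 'b^'m)" for i :: 'm
    unfolding linear_conv_bounded_linear[symmetric]
    by (auto intro!: linearI simp: vec_eq_iff axis_def)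
  have "(\<Sum>i\<in>UNIV. (\<lambda>x. axis i (f x $ i))) \<in> L2 \<Omega>"
    by (rule subspace_sum[OF subspace_L2]) (rule L2_bounded_linear[OF lin assms])
  moreover have "(\<Sum>i\<in>UNIV. (\<lambda>x. axis i (f x $ i))) = f"
    by (simp add: fun_eq_iff vec_eq_iff axis_def sum_fun_apply)
  ultimately show ?thesis by simp
qed

text \<open>Each entry of \<open>W - V\<close> is orthogonal to all test functions. As
  \<open>grad\<close> is an arbitrary choice, every algebraic rule for it rests on this.\<close>

lemma weak_gradient_unique:
  assumes \<Omega>: "open \<Omega>" and W: "W \<in> L2 \<Omega>" "weak_gradient \<Omega> u W" and V: "V \<in> L2 \<Omega>" "weak_gradient \<Omega> u V"
  shows "ae_eq \<Omega> W V"
proof -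
  have comp: "ae_eq \<Omega> (\<lambda>x. W x $ i $ j - V x $ i $ j) (\<lambda>x. 0)" for i j
  proof (rule fundamental_lemma_of_variations[OF \<Omega>])
    have L2: "(\<lambda>x. W x $ i $ j) \<in> L2 \<Omega>" "(\<lambda>x. V x $ i $ j) \<in> L2 \<Omega>"
      using W V by (auto intro: L2_component)
    then show "(\<lambda>x. W x $ i $ j - V x $ i $ j) \<in> L2 \<Omega>"
      using subspace_diff[OF subspace_L2 L2] by (simp add: fun_diff_def)
    fix \<phi> assume \<phi>: "\<phi> \<in> test_functions \<Omega>"
    note int = L2_integrable_mult[OF L2(1) test_function_L2[OF \<Omega> \<phi>]]
      L2_integrable_mult[OF L2(2) test_function_L2[OF \<Omega> \<phi>]]
    have "(\<integral>x. W x $ i $ j * \<phi> x \<partial>lebesgue_on \<Omega>) = (\<integral>x. V x $ i $ j * \<phi> x \<partial>lebesgue_on \<Omega>)"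
      using bspec[OF W(2)[unfolded weak_gradient_def] \<phi>] bspec[OF V(2)[unfolded weak_gradient_def] \<phi>]
      by simp
    then show "(\<integral>x. (W x $ i $ j - V x $ i $ j) * \<phi> x \<partial>lebesgue_on \<Omega>) = 0"
      using int by (simp add: left_diff_distrib)
  qed
  have "AE x in lebesgue_on \<Omega>. \<forall>i. \<forall>j. W x $ i $ j - V x $ i $ j = 0"
    using comp unfolding ae_eq_def by (intro eventually_all_finite)
  then show ?thesis unfolding ae_eq_def by (rule eventually_mono) (simp add: vec_eq_iff)
qed

lemma grad_works:
  assumes "u \<in> H1 \<Omega>"
  shows "grad \<Omega> u \<in> L2 \<Omega>" "weak_gradient \<Omega> u (grad \<Omega> u)"
proof -
  have "\<exists>W. W \<in> L2 \<Omega> \<and> weak_gradient \<Omega> u W" using assms by (auto simp: H1_def)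
  then have "grad \<Omega> u \<in> L2 \<Omega> \<and> weak_gradient \<Omega> u (grad \<Omega> u)" unfolding grad_def by (rule someI_ex)
  then show "grad \<Omega> u \<in> L2 \<Omega>" "weak_gradient \<Omega> u (grad \<Omega> u)" by auto
qed

lemma H1_L2: "u \<in> H1 \<Omega> \<Longrightarrow> u \<in> L2 \<Omega>"
  by (simp add: H1_def)

lemma grad_ae_eqI:
  assumes "open \<Omega>" "u \<in> H1 \<Omega>" "W \<in> L2 \<Omega>" "weak_gradient \<Omega> u W"
  shows "ae_eq \<Omega> (grad \<Omega> u) W"
  using weak_gradient_unique[OF assms(1) grad_works[OF assms(2)] assms(3,4)] .

lemma L2_combination:
  "u \<in> L2 \<Omega> \<Longrightarrow> v \<in> L2 \<Omega> \<Longrightarrow> a *\<^sub>R u + b *\<^sub>R v \<in> L2 \<Omega>"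
  using subspace_add[OF subspace_L2 subspace_scale[OF subspace_L2] subspace_scale[OF subspace_L2]] .

lemma weak_gradient_combination:
  assumes \<Omega>: "open \<Omega>" and L2: "u \<in> L2 \<Omega>" "v \<in> L2 \<Omega>" "W \<in> L2 \<Omega>" "V \<in> L2 \<Omega>"
    and grad: "weak_gradient \<Omega> u W" "weak_gradient \<Omega> v V"
  shows "weak_gradient \<Omega> (a *\<^sub>R u + b *\<^sub>R v) (a *\<^sub>R W + b *\<^sub>R V)"
  unfolding weak_gradient_def
proof (intro ballI allI)
  fix \<phi> i j assume \<phi>: "\<phi> \<in> test_functions \<Omega>"
  note d\<phi> = test_function_L2[OF \<Omega> test_function_partial[OF \<phi>]]
  note int = L2_integrable_mult[OF L2_nth[OF L2(1)] d\<phi>] L2_integrable_mult[OF L2_nth[OF L2(2)] d\<phi>]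
    L2_integrable_mult[OF L2_component[OF L2(3)] test_function_L2[OF \<Omega> \<phi>]]
    L2_integrable_mult[OF L2_component[OF L2(4)] test_function_L2[OF \<Omega> \<phi>]]
  have eq: "(a *\<^sub>R u + b *\<^sub>R v) x $ i * z = a * (u x $ i * z) + b * (v x $ i * z)"
    "(a *\<^sub>R W + b *\<^sub>R V) x $ i $ j * z = a * (W x $ i $ j * z) + b * (V x $ i $ j * z)" for x z
    by (simp_all add: algebra_simps)
  have g: "(\<integral>x. u x $ i * partial j \<phi> x \<partial>lebesgue_on \<Omega>) = - (\<integral>x. W x $ i $ j * \<phi> x \<partial>lebesgue_on \<Omega>)"
    "(\<integral>x. v x $ i * partial j \<phi> x \<partial>lebesgue_on \<Omega>) = - (\<integral>x. V x $ i $ j * \<phi> x \<partial>lebesgue_on \<Omega>)"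
    using grad \<phi> by (auto simp: weak_gradient_def)
  show "(\<integral>x. (a *\<^sub>R u + b *\<^sub>R v) x $ i * partial j \<phi> x \<partial>lebesgue_on \<Omega>)
      = - (\<integral>x. (a *\<^sub>R W + b *\<^sub>R V) x $ i $ j * \<phi> x \<partial>lebesgue_on \<Omega>)"
    unfolding eq using int by (simp add: g)
qed

lemma H1_combination:
  assumes \<Omega>: "open \<Omega>" and "u \<in> H1 \<Omega>" "v \<in> H1 \<Omega>"
  shows "a *\<^sub>R u + b *\<^sub>R v \<in> H1 \<Omega>"
proof -
  have "a *\<^sub>R grad \<Omega> u + b *\<^sub>R grad \<Omega> v \<in> L2 \<Omega>"
    "weak_gradient \<Omega> (a *\<^sub>R u + b *\<^sub>R v) (a *\<^sub>R grad \<Omega> u + b *\<^sub>R grad \<Omega> v)"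
    using assms by (auto intro!: L2_combination weak_gradient_combination H1_L2 grad_works)
  moreover have "a *\<^sub>R u + b *\<^sub>R v \<in> L2 \<Omega>" using assms by (intro L2_combination H1_L2)
  ultimately show ?thesis unfolding H1_def by blast
qed

lemma grad_combination:
  assumes \<Omega>: "open \<Omega>" and uv: "u \<in> H1 \<Omega>" "v \<in> H1 \<Omega>"
  shows "ae_eq \<Omega> (grad \<Omega> (a *\<^sub>R u + b *\<^sub>R v)) (a *\<^sub>R grad \<Omega> u + b *\<^sub>R grad \<Omega> v)"
  by (rule grad_ae_eqI[OF \<Omega> H1_combination[OF assms] L2_combination[OF grad_works(1) grad_works(1)]
      weak_gradient_combination[OF \<Omega> H1_L2 H1_L2 grad_works(1) grad_works(1) grad_works(2) grad_works(2)]])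
    (rule uv)+

lemma weak_gradient_cong:
  fixes u v :: "real^'n \<Rightarrow> real^'n"
  assumes "\<And>x. x \<in> \<Omega> \<Longrightarrow> u x = v x"
  shows "weak_gradient \<Omega> u = weak_gradient \<Omega> v"
proof -
  have "(\<integral>x. u x $ i * g x \<partial>lebesgue_on \<Omega>) = (\<integral>x. v x $ i * g x \<partial>lebesgue_on \<Omega>)" for i and g :: "real^'n \<Rightarrow> real"
    using assms by (intro Bochner_Integration.integral_cong) auto
  then show ?thesis by (simp add: fun_eq_iff weak_gradient_def)
qed

text \<open>An equality of functions, not merely almost everywhere: \<open>u\<close> and
  \<open>v\<close> have the same set of weak gradients, and the choice operator picks the same
  member for both.\<close>

lemma grad_cong: "(\<And>x. x \<in> \<Omega> \<Longrightarrow> u x = v x) \<Longrightarrow> grad \<Omega> u = grad \<Omega> v"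
  unfolding grad_def by (subst weak_gradient_cong[of \<Omega> u v]) auto

lemma L2_cong:
  assumes "\<And>x. x \<in> \<Omega> \<Longrightarrow> u x = v x"
  shows "u \<in> L2 \<Omega> \<longleftrightarrow> v \<in> L2 \<Omega>"
proof -
  have "u \<in> borel_measurable (lebesgue_on \<Omega>) \<longleftrightarrow> v \<in> borel_measurable (lebesgue_on \<Omega>)"
    using assms by (intro measurable_cong) simp
  moreover have "integrable (lebesgue_on \<Omega>) (\<lambda>x. (norm (u x))\<^sup>2) \<longleftrightarrow> integrable (lebesgue_on \<Omega>) (\<lambda>x. (norm (v x))\<^sup>2)"
    using assms by (intro Bochner_Integration.integrable_cong) auto
  ultimately show ?thesis by (simp add: L2_def)
qed

lemma L2_norm_eq_on:
  assumes "\<And>x. x \<in> \<Omega> \<Longrightarrow> u x = v x"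
  shows "L2_norm \<Omega> u = L2_norm \<Omega> v"
  unfolding L2_norm_def L2_inner_def
  using assms by (intro arg_cong[of _ _ sqrt] Bochner_Integration.integral_cong) auto

lemma H10_H1: "u \<in> H10 \<Omega> \<Longrightarrow> u \<in> H1 \<Omega>"
  by (simp add: H10_def)

text \<open>Allows the values outside the domain to be reset, as is done in the construction of a
  finite spanning set.\<close>

lemma H10_cong:
  assumes u: "u \<in> H10 \<Omega>" and eq: "\<And>x. x \<in> \<Omega> \<Longrightarrow> u x = v x"
  shows "v \<in> H10 \<Omega>"
proof -
  have "L2_norm \<Omega> (\<phi> - u) = L2_norm \<Omega> (\<phi> - v)" for \<phi>
    by (rule L2_norm_eq_on) (simp add: eq)
  moreover have "v \<in> H1 \<Omega>"
    using H10_H1[OF u] L2_cong[of \<Omega> u v] weak_gradient_cong[of \<Omega> u v] eq by (simp add: H1_def)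
  ultimately show ?thesis using u grad_cong[of \<Omega> u v] eq by (simp add: H10_def)
qed

text \<open>The approximating sequences in \<open>H10\<close> involve \<open>grad\<close> of test
  fields; the classical Jacobian is a weak gradient by integration by parts, so that this choice is
  meaningful.\<close>

lemma test_field_H1:
  assumes \<Omega>: "open \<Omega>" and \<phi>: "\<phi> \<in> test_fields \<Omega>"
  shows "\<phi> \<in> H1 \<Omega>"
proof -
  have test: "(\<lambda>x. \<phi> x $ i) \<in> test_functions \<Omega>" for i using \<phi> by (simp add: test_fields_def)
  define W where "W = (\<lambda>x. \<chi> i j. partial j (\<lambda>x. \<phi> x $ i) x)"
  have "W \<in> L2 \<Omega>"
    by (intro L2_vecI) (simp add: W_def test_function_L2[OF \<Omega> test_function_partial[OF test]])
  moreover have "weak_gradient \<Omega> \<phi> W"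
    using integration_by_parts[OF \<Omega> test] by (simp add: weak_gradient_def W_def)
  moreover have "\<phi> \<in> L2 \<Omega>" by (intro L2_vecI test_function_L2[OF \<Omega> test])
  ultimately show ?thesis by (auto simp: H1_def)
qed

lemma test_field_combination:
  assumes "\<phi> \<in> test_fields \<Omega>" "\<psi> \<in> test_fields \<Omega>"
  shows "a *\<^sub>R \<phi> + b *\<^sub>R \<psi> \<in> test_fields \<Omega>"
  using assms by (auto simp: test_fields_def Ck_const intro!: test_function_add test_function_mult)

lemma H10_combination:
  assumes \<Omega>: "open \<Omega>" and u: "u \<in> H10 \<Omega>" and v: "v \<in> H10 \<Omega>"
  shows "a *\<^sub>R u + b *\<^sub>R v \<in> H10 \<Omega>"
proof -
  obtain \<phi> where \<phi>: "\<And>n::nat. \<phi> n \<in> test_fields \<Omega>" "(\<lambda>n. L2_norm \<Omega> (\<phi> n - u)) \<longlonglongrightarrow> 0"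
    "(\<lambda>n. L2_norm \<Omega> (grad \<Omega> (\<phi> n) - grad \<Omega> u)) \<longlonglongrightarrow> 0" using u by (auto simp: H10_def)
  obtain \<psi> where \<psi>: "\<And>n::nat. \<psi> n \<in> test_fields \<Omega>" "(\<lambda>n. L2_norm \<Omega> (\<psi> n - v)) \<longlonglongrightarrow> 0"
    "(\<lambda>n. L2_norm \<Omega> (grad \<Omega> (\<psi> n) - grad \<Omega> v)) \<longlonglongrightarrow> 0" using v by (auto simp: H10_def)
  note H1 = test_field_H1[OF \<Omega> \<phi>(1)] test_field_H1[OF \<Omega> \<psi>(1)] H10_H1[OF u] H10_H1[OF v]
  \<comment> \<open>Stated for any Euclidean codomain, because it serves the vector fields and then
    their matrix-valued gradients.\<close>
  have bound: "L2_norm \<Omega> (a *\<^sub>R f + b *\<^sub>R g - (a *\<^sub>R f' + b *\<^sub>R g'))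
      \<le> \<bar>a\<bar> * L2_norm \<Omega> (f - f') + \<bar>b\<bar> * L2_norm \<Omega> (g - g')"
    if "f \<in> L2 \<Omega>" "g \<in> L2 \<Omega>" "f' \<in> L2 \<Omega>" "g' \<in> L2 \<Omega>" for f g f' g' :: "real^'a \<Rightarrow> 'b::euclidean_space"
  proof -
    have d: "f - f' \<in> L2 \<Omega>" "g - g' \<in> L2 \<Omega>" using that subspace_diff[OF subspace_L2] by auto
    have "a *\<^sub>R f + b *\<^sub>R g - (a *\<^sub>R f' + b *\<^sub>R g') = a *\<^sub>R (f - f') + b *\<^sub>R (g - g')"
      by (simp add: algebra_simps)
    then show ?thesis
      using L2_norm_triangle[OF subspace_scale[OF subspace_L2 d(1), of a] subspace_scale[OF subspace_L2 d(2), of b]]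
      by (simp add: L2_norm_scaleR[OF d(1)] L2_norm_scaleR[OF d(2)])
  qed
  have lim: "(\<lambda>n. \<bar>a\<bar> * s n + \<bar>b\<bar> * t n) \<longlonglongrightarrow> 0" if "s \<longlonglongrightarrow> 0" "t \<longlonglongrightarrow> 0" for s t :: "nat \<Rightarrow> real"
    using tendsto_add[OF tendsto_mult[OF tendsto_const that(1)] tendsto_mult[OF tendsto_const that(2)]] by simp
  define \<xi> where "\<xi> n = a *\<^sub>R \<phi> n + b *\<^sub>R \<psi> n" for n
  have conv: "(\<lambda>n. L2_norm \<Omega> (\<xi> n - (a *\<^sub>R u + b *\<^sub>R v))) \<longlonglongrightarrow> 0"
    by (rule tendsto_sandwich[OF _ _ tendsto_const lim[OF \<phi>(2) \<psi>(2)]])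
      (use bound[OF H1_L2[OF H1(1)] H1_L2[OF H1(2)] H1_L2[OF H1(3)] H1_L2[OF H1(4)]]
        in \<open>auto simp: \<xi>_def L2_norm_nonneg\<close>)
  have le: "L2_norm \<Omega> (grad \<Omega> (\<xi> n) - grad \<Omega> (a *\<^sub>R u + b *\<^sub>R v))
      \<le> \<bar>a\<bar> * L2_norm \<Omega> (grad \<Omega> (\<phi> n) - grad \<Omega> u) + \<bar>b\<bar> * L2_norm \<Omega> (grad \<Omega> (\<psi> n) - grad \<Omega> v)" for n
  proof -
    note g = grad_works(1)[OF H1(1), of n] grad_works(1)[OF H1(2), of n] grad_works(1)[OF H1(3)] grad_works(1)[OF H1(4)]
    \<comment> \<open>The gradient of a combination and the combination of gradients are different
      representatives, which the norm does not distinguish.\<close>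
    have "L2_norm \<Omega> (grad \<Omega> (\<xi> n) - grad \<Omega> (a *\<^sub>R u + b *\<^sub>R v))
      = L2_norm \<Omega> (a *\<^sub>R grad \<Omega> (\<phi> n) + b *\<^sub>R grad \<Omega> (\<psi> n) - (a *\<^sub>R grad \<Omega> u + b *\<^sub>R grad \<Omega> v))"
    proof (rule L2_norm_cong)
      show "ae_eq \<Omega> (grad \<Omega> (\<xi> n) - grad \<Omega> (a *\<^sub>R u + b *\<^sub>R v))
        (a *\<^sub>R grad \<Omega> (\<phi> n) + b *\<^sub>R grad \<Omega> (\<psi> n) - (a *\<^sub>R grad \<Omega> u + b *\<^sub>R grad \<Omega> v))"
        using grad_combination[OF \<Omega> H1(1,2), of a n b n] grad_combination[OF \<Omega> H1(3,4), of a b]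
        unfolding ae_eq_def \<xi>_def by (rule eventually_elim2) simp
    qed (intro subspace_diff[OF subspace_L2] L2_combination g grad_works(1) H1_combination[OF \<Omega>] H1
        | simp add: \<xi>_def H1_combination[OF \<Omega> H1(1,2)])+
    with bound[OF g] show ?thesis by simp
  qed
  have conv': "(\<lambda>n. L2_norm \<Omega> (grad \<Omega> (\<xi> n) - grad \<Omega> (a *\<^sub>R u + b *\<^sub>R v))) \<longlonglongrightarrow> 0"
    by (rule tendsto_sandwich[OF _ _ tendsto_const lim[OF \<phi>(3) \<psi>(3)]]) (use le in \<open>auto simp: L2_norm_nonneg\<close>)
  have "\<xi> n \<in> test_fields \<Omega>" for n unfolding \<xi>_def by (intro test_field_combination \<phi> \<psi>)
  with conv conv' H1_combination[OF \<Omega> H1(3,4), of a b] show ?thesis by (auto simp: H10_def)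
qed

lemma L2_norm_zero [simp]: "L2_norm \<Omega> 0 = 0"
  by (simp add: L2_norm_def L2_inner_def)

lemma zero_H10: assumes "open \<Omega>" shows "0 \<in> H10 \<Omega>"
proof -
  have "(0 :: real^'a \<Rightarrow> real^'a) \<in> test_fields \<Omega>"
    by (simp add: test_fields_def zero_test_function)
  then show ?thesis
    using test_field_H1[OF assms] unfolding H10_def by (auto intro!: exI[of _ "\<lambda>n. 0"])
qed

section \<open>Finite element spaces\<close>

lemma subspace_if_combinations:
  assumes "0 \<in> S" "\<And>a b u v. u \<in> S \<Longrightarrow> v \<in> S \<Longrightarrow> a *\<^sub>R u + b *\<^sub>R v \<in> S"
  shows "subspace S"
proof (rule subspaceI)
  show "u + v \<in> S" if "u \<in> S" "v \<in> S" for u v using assms(2)[OF that, of 1 1] by simp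
  show "c *\<^sub>R u \<in> S" if "u \<in> S" for c u using assms(2)[OF that that, of c 0] by simp
qed (rule assms)

lemma linear_form_on_if_combinations:
  assumes "\<And>a b u v. u \<in> S \<Longrightarrow> v \<in> S \<Longrightarrow> l (a *\<^sub>R u + b *\<^sub>R v) = a * l u + b * l v"
  shows "linear_form_on S l"
proof (rule linear_form_onI)
  show "l (u + v) = l u + l v" if "u \<in> S" "v \<in> S" for u v using assms[OF that, of 1 1] by simp
  show "l (t *\<^sub>R u) = t * l u" if "u \<in> S" for t u using assms[OF that that, of t 0] by simp
qed

text \<open>Gradient, divergence and convection are linear only up to null sets; pairing with a
  fixed L2 function turns each into a form that is linear on the nose.\<close>

lemma linear_form_L2_inner_compose:
  assumes T: "\<And>u. u \<in> S \<Longrightarrow> T u \<in> L2 \<Omega>" and S: "subspace S" and w: "w \<in> L2 \<Omega>"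
    and comb: "\<And>a b u v. u \<in> S \<Longrightarrow> v \<in> S \<Longrightarrow> ae_eq \<Omega> (T (a *\<^sub>R u + b *\<^sub>R v)) (a *\<^sub>R T u + b *\<^sub>R T v)"
  shows "linear_form_on S (\<lambda>u. L2_inner \<Omega> (T u) w)"
proof (rule linear_form_on_if_combinations)
  fix a b u v assume u: "u \<in> S" and v: "v \<in> S"
  have uv: "a *\<^sub>R u + b *\<^sub>R v \<in> S" using u v S by (simp add: subspace_add subspace_scale)
  have "L2_inner \<Omega> (T (a *\<^sub>R u + b *\<^sub>R v)) w = L2_inner \<Omega> (a *\<^sub>R T u + b *\<^sub>R T v) w"
    by (rule L2_inner_cong_AE[OF comb[OF u v] _ T[OF uv] w L2_combination[OF T[OF u] T[OF v]] w])
      (simp add: ae_eq_def)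
  also have "\<dots> = a * L2_inner \<Omega> (T u) w + b * L2_inner \<Omega> (T v) w"
    using linear_form_on_add[OF linear_L2_inner[OF w] subspace_scale[OF subspace_L2 T[OF u]]
        subspace_scale[OF subspace_L2 T[OF v]]]
      linear_form_on_scaleR[OF linear_L2_inner[OF w] T[OF u]] linear_form_on_scaleR[OF linear_L2_inner[OF w] T[OF v]]
    by simp
  finally show "L2_inner \<Omega> (T (a *\<^sub>R u + b *\<^sub>R v)) w = a * L2_inner \<Omega> (T u) w + b * L2_inner \<Omega> (T v) w" .
qed

lemma linear_form_on_subset: "linear_form_on S l \<Longrightarrow> T \<subseteq> S \<Longrightarrow> linear_form_on T l"
  unfolding linear_form_on_def by blast

lemma bounded_linear_trace: "bounded_linear (trace :: real^'n^'n \<Rightarrow> real)"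
  unfolding linear_conv_bounded_linear[symmetric]
  by (auto intro!: linearI simp: trace_def sum.distrib sum_distrib_left)

lemma divergence_L2:
  assumes "u \<in> H1 \<Omega>"
  shows "divergence \<Omega> u \<in> L2 \<Omega>"
proof -
  have "divergence \<Omega> u = (\<lambda>x. trace (grad \<Omega> u x))" by (simp add: fun_eq_iff divergence_def)
  then show ?thesis using L2_bounded_linear[OF bounded_linear_trace grad_works(1)[OF assms]] by simp
qed

lemma divergence_combination:
  assumes "open \<Omega>" "u \<in> H1 \<Omega>" "v \<in> H1 \<Omega>"
  shows "ae_eq \<Omega> (divergence \<Omega> (a *\<^sub>R u + b *\<^sub>R v)) (a *\<^sub>R divergence \<Omega> u + b *\<^sub>R divergence \<Omega> v)"
proof -
  have lin: "linear (trace :: real^'n^'n \<Rightarrow> real)" using bounded_linear_trace by (rule bounded_linear.linear)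
  show ?thesis
    using grad_combination[OF assms, of a b] unfolding ae_eq_def
    by (rule eventually_mono) (simp add: divergence_def linear_add[OF lin] linear_scale[OF lin])
qed

section \<open>The forms of the problem on spaces of bounded velocities\<close>

locale bounded_H10_subspace =
  fixes \<Omega> :: "(real^'n) set" and X :: "(real^'n \<Rightarrow> real^'n) set"
  assumes \<Omega>: "open \<Omega>" and X: "subspace X" "X \<subseteq> H10 \<Omega>"
    and bounded: "u \<in> X \<Longrightarrow> \<exists>B. \<forall>x\<in>\<Omega>. norm (u x) \<le> B"
begin

lemma X_H1: "u \<in> X \<Longrightarrow> u \<in> H1 \<Omega>"
  using X(2) H10_H1 by blast

lemma X_L2: "u \<in> X \<Longrightarrow> u \<in> L2 \<Omega>"
  by (rule H1_L2[OF X_H1])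

lemma X_combination: "u \<in> X \<Longrightarrow> v \<in> X \<Longrightarrow> a *\<^sub>R u + b *\<^sub>R v \<in> X"
  using X(1) by (simp add: subspace_add subspace_scale)

text \<open>Boundedness of the convecting field enters here; the bound may depend on
  \<open>u\<close>, since only integrability is at stake.\<close>

lemma convection_L2:
  assumes "u \<in> X" "v \<in> X"
  shows "(\<lambda>x. grad \<Omega> v x *v u x) \<in> L2 \<Omega>"
proof -
  obtain B where "\<forall>x\<in>\<Omega>. norm (u x) \<le> B" using bounded[OF assms(1)] by blast
  then show ?thesis
    by (intro L2_matrix_vector_mult[of _ _ _ B] grad_works(1) X_H1 L2_measurable X_L2 assms) blast
qed

lemma linear_convection_1:
  assumes "v \<in> X" "w \<in> X"
  shows "linear_form_on X (\<lambda>u. L2_inner \<Omega> (\<lambda>x. grad \<Omega> v x *v u x) w)"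
  by (rule linear_form_L2_inner_compose[OF convection_L2[OF _ assms(1)] X(1) X_L2[OF assms(2)]])
    (simp_all add: ae_eq_def matrix_vector_right_distrib matrix_vector_mult_scaleR)

lemma linear_convection_2:
  assumes "u \<in> X" "w \<in> X"
  shows "linear_form_on X (\<lambda>v. L2_inner \<Omega> (\<lambda>x. grad \<Omega> v x *v u x) w)"
proof (rule linear_form_L2_inner_compose[OF convection_L2[OF assms(1)] X(1) X_L2[OF assms(2)]])
  fix a b and v v' :: "real^'n \<Rightarrow> real^'n" assume "v \<in> X" "v' \<in> X"
  then show "ae_eq \<Omega> (\<lambda>x. grad \<Omega> (a *\<^sub>R v + b *\<^sub>R v') x *v u x)
      (a *\<^sub>R (\<lambda>x. grad \<Omega> v x *v u x) + b *\<^sub>R (\<lambda>x. grad \<Omega> v' x *v u x))"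
    using grad_combination[OF \<Omega> X_H1 X_H1, of v v' a b] unfolding ae_eq_def
    by (auto elim!: eventually_mono simp: matrix_vector_mult_add_rdistrib scaleR_matrix_vector_assoc)
qed

lemma linear_convection_3:
  assumes "u \<in> X" "v \<in> X"
  shows "linear_form_on X (\<lambda>w. L2_inner \<Omega> (\<lambda>x. grad \<Omega> v x *v u x) w)"
  by (rule linear_form_on_subset[OF L2.linr[OF convection_L2[OF assms]]]) (use X_L2 in blast)

lemma linear_bstar:
  assumes "u \<in> X" "v \<in> X"
  shows "linear_form_on X (\<lambda>w. bstar \<Omega> w u v)" "linear_form_on X (\<lambda>w. bstar \<Omega> u w v)"
    "linear_form_on X (\<lambda>w. bstar \<Omega> u v w)"
  using linear_convection_1[OF assms] linear_convection_1[OF assms(2,1)] linear_convection_2[OF assms]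
    linear_convection_3[OF assms]
  by (auto simp: linear_form_on_def bstar_def add_divide_distrib right_diff_distrib)

lemma grad_form_semi_inner_product: "semi_inner_product X (\<lambda>u v. L2_inner \<Omega> (grad \<Omega> u) (grad \<Omega> v))"
proof
  show "linear_form_on X (\<lambda>u. L2_inner \<Omega> (grad \<Omega> u) (grad \<Omega> v))" if "v \<in> X" for v
    by (intro linear_form_L2_inner_compose grad_works(1) grad_combination X_H1 X(1) \<Omega> that)
  show "0 \<le> L2_inner \<Omega> (grad \<Omega> u) (grad \<Omega> u)" for u by (simp add: L2_inner_def)
qed (rule X L2_inner_commute)+

lemma subspace_fe_pressure: "subspace (fe_pressure \<Omega> X)"
proof (rule subspace_if_combinations)
  show "a *\<^sub>R p + b *\<^sub>R q \<in> fe_pressure \<Omega> X"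
    if p: "p \<in> fe_pressure \<Omega> X" and q: "q \<in> fe_pressure \<Omega> X" for a b p q
  proof -
    obtain u v where uv: "u \<in> X" "v \<in> X" "ae_eq \<Omega> p (divergence \<Omega> u)" "ae_eq \<Omega> q (divergence \<Omega> v)"
      using p q by (auto simp: fe_pressure_def)
    have "ae_eq \<Omega> (a *\<^sub>R p + b *\<^sub>R q) (a *\<^sub>R divergence \<Omega> u + b *\<^sub>R divergence \<Omega> v)"
      using uv(3,4) unfolding ae_eq_def by (rule eventually_elim2) simp
    then have "ae_eq \<Omega> (a *\<^sub>R p + b *\<^sub>R q) (divergence \<Omega> (a *\<^sub>R u + b *\<^sub>R v))"
      using divergence_combination[OF \<Omega> X_H1[OF uv(1)] X_H1[OF uv(2)], of a b]
      unfolding ae_eq_def by (rule eventually_elim2) simp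
    then show ?thesis
      using p q X_combination[OF uv(1,2)] L2_combination by (auto simp: fe_pressure_def)
  qed
  have "ae_eq \<Omega> 0 (divergence \<Omega> 0)"
    using divergence_combination[OF \<Omega> X_H1 X_H1, OF subspace_0 subspace_0, OF X(1) X(1), of 0 0]
    unfolding ae_eq_def by (rule eventually_mono) simp
  then show "0 \<in> fe_pressure \<Omega> X"
    using subspace_0[OF X(1)] subspace_0[OF subspace_L2] by (auto simp: fe_pressure_def)
qed

lemma fe_pressure_L2: "fe_pressure \<Omega> X \<subseteq> L2 \<Omega>"
  by (auto simp: fe_pressure_def)

lemma fe_pressure_semi_inner_product: "semi_inner_product (fe_pressure \<Omega> X) (L2_inner \<Omega>)"
proof
  show "linear_form_on (fe_pressure \<Omega> X) (\<lambda>p. L2_inner \<Omega> p q)" if "q \<in> fe_pressure \<Omega> X" for q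
    by (rule linear_form_on_subset[OF linear_L2_inner fe_pressure_L2]) (use that fe_pressure_L2 in blast)
  show "0 \<le> L2_inner \<Omega> q q" for q :: "real^'n \<Rightarrow> real" by (simp add: L2_inner_def)
qed (rule subspace_fe_pressure L2_inner_commute)+

text \<open>Keeps \<open>p - d g / \<epsilon>\<close> in the pressure space and makes divergences
  admissible test functions there, without an inf-sup condition.\<close>

lemma divergence_fe_pressure: "u \<in> X \<Longrightarrow> divergence \<Omega> u \<in> fe_pressure \<Omega> X"
  using divergence_L2[OF X_H1] by (auto simp: fe_pressure_def ae_eq_def)

lemma linear_divergence_form:
  assumes "q \<in> fe_pressure \<Omega> X"
  shows "linear_form_on X (\<lambda>u. L2_inner \<Omega> (divergence \<Omega> u) q)"
  by (intro linear_form_L2_inner_compose divergence_L2 divergence_combination X_H1 X(1) \<Omega>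
      subsetD[OF fe_pressure_L2] assms)

text \<open>Two velocities that agree on the domain may differ elsewhere; their difference then
  belongs to the kernel of the gradient seminorm.\<close>

lemma grad_diff_eq_on:
  assumes "u \<in> X" "v \<in> X" "\<And>x. x \<in> \<Omega> \<Longrightarrow> u x = v x"
  shows "ae_eq \<Omega> (grad \<Omega> (u - v)) (\<lambda>x. 0)"
proof -
  have "ae_eq \<Omega> (grad \<Omega> (u - v)) (grad \<Omega> u - grad \<Omega> v)"
    using grad_combination[OF \<Omega> X_H1[OF assms(1)] X_H1[OF assms(2)], of 1 "-1"] by simp
  moreover have "grad \<Omega> u = grad \<Omega> v" by (rule grad_cong[OF assms(3)])
  ultimately show ?thesis by (simp add: ae_eq_def)
qed

end

section \<open>Piecewise polynomial fields on a mesh and the dual norm\<close>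

lemma polynomial_field_combination:
  assumes "polynomial_field k P" "polynomial_field k R"
  shows "polynomial_field k (\<lambda>x. a *\<^sub>R P x + b *\<^sub>R R x)"
proof -
  obtain c where c: "\<And>x. P x = (\<Sum>\<alpha> | (\<Sum>i\<in>UNIV. \<alpha> i) \<le> k. (\<Prod>i\<in>UNIV. (x $ i) ^ \<alpha> i) *\<^sub>R c \<alpha>)"
    using assms(1) unfolding polynomial_field_def by blast
  obtain d where d: "\<And>x. R x = (\<Sum>\<alpha> | (\<Sum>i\<in>UNIV. \<alpha> i) \<le> k. (\<Prod>i\<in>UNIV. (x $ i) ^ \<alpha> i) *\<^sub>R d \<alpha>)"
    using assms(2) unfolding polynomial_field_def by blast
  have "a *\<^sub>R P x + b *\<^sub>R R x = (\<Sum>\<alpha> | (\<Sum>i\<in>UNIV. \<alpha> i) \<le> k. (\<Prod>i\<in>UNIV. (x $ i) ^ \<alpha> i) *\<^sub>R (a *\<^sub>R c \<alpha> + b *\<^sub>R d \<alpha>))" for x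
    by (simp add: c d scaleR_sum_right sum.distrib scaleR_add_right mult.commute)
  then show ?thesis unfolding polynomial_field_def by (intro exI[of _ "\<lambda>\<alpha>. a *\<^sub>R c \<alpha> + b *\<^sub>R d \<alpha>"] allI)
qed

lemma subspace_fe_velocity:
  fixes \<Omega> :: "(real^'n) set"
  assumes "open \<Omega>"
  shows "subspace (fe_velocity \<Omega> \<T> k)"
proof (rule subspace_if_combinations)
  have "polynomial_field k (\<lambda>x. 0)"
    unfolding polynomial_field_def by (intro exI[of _ "\<lambda>\<alpha>. 0"]) simp
  then show "0 \<in> fe_velocity \<Omega> \<T> k"
    using zero_H10[OF assms] by (auto simp: fe_velocity_def zero_fun_def)
  fix a b and u v :: "real^'n \<Rightarrow> real^'n"
  assume u: "u \<in> fe_velocity \<Omega> \<T> k" and v: "v \<in> fe_velocity \<Omega> \<T> k"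
  have "\<exists>P. polynomial_field k P \<and> (\<forall>x\<in>T. (a *\<^sub>R u + b *\<^sub>R v) x = P x)" if T: "T \<in> \<T>" for T
  proof -
    obtain P R where "polynomial_field k P" "\<forall>x\<in>T. u x = P x" "polynomial_field k R" "\<forall>x\<in>T. v x = R x"
      using u v T unfolding fe_velocity_def by blast
    then show ?thesis
      by (intro exI[of _ "\<lambda>x. a *\<^sub>R P x + b *\<^sub>R R x"]) (simp add: polynomial_field_combination)
  qed
  moreover have "continuous_on (closure \<Omega>) (a *\<^sub>R u + b *\<^sub>R v)"
  proof -
    have "continuous_on (closure \<Omega>) (\<lambda>x. a *\<^sub>R u x + b *\<^sub>R v x)"
      using u v by (intro continuous_intros) (auto simp: fe_velocity_def)
    then show ?thesis by (simp add: plus_fun_def scaleR_fun_def)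
  qed
  moreover have "a *\<^sub>R u + b *\<^sub>R v \<in> H10 \<Omega>"
    using u v by (intro H10_combination[OF assms]) (auto simp: fe_velocity_def)
  ultimately show "a *\<^sub>R u + b *\<^sub>R v \<in> fe_velocity \<Omega> \<T> k" by (simp add: fe_velocity_def)
qed

text \<open>The mesh is what makes the domain bounded: its closure is a finite union of compact
  simplices.\<close>

lemma simplicial_mesh_compact:
  assumes "simplicial_mesh \<Omega> \<sigma> \<T>"
  shows "finite \<T>" "compact (closure \<Omega>)"
proof -
  show fin: "finite \<T>" using assms by (simp add: simplicial_mesh_def triangulation_def)
  have "compact T" if "T \<in> \<T>" for T
    using assms that by (auto simp: simplicial_mesh_def intro: simplex_imp_polytope polytope_imp_compact)
  then have "compact (\<Union>\<T>)" using fin by (intro compact_Union)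
  then show "compact (closure \<Omega>)" using assms by (simp add: simplicial_mesh_def)
qed

lemma fe_velocity_bounded:
  assumes "compact (closure \<Omega>)" "v \<in> fe_velocity \<Omega> \<T> k"
  shows "\<exists>B. \<forall>x\<in>\<Omega>. norm (v x) \<le> B"
proof -
  have "compact (v ` closure \<Omega>)"
    using assms by (intro compact_continuous_image) (auto simp: fe_velocity_def)
  then obtain B where "\<forall>y\<in>v ` closure \<Omega>. norm y \<le> B"
    using compact_imp_bounded bounded_iff by metis
  then have "\<forall>x\<in>\<Omega>. norm (v x) \<le> B" using closure_subset[of \<Omega>] by blast
  then show ?thesis ..
qed

lemma finite_multi_indices: "finite {\<alpha> :: 'n::finite \<Rightarrow> nat. (\<Sum>i\<in>UNIV. \<alpha> i) \<le> k}"
proof (rule finite_subset)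
  have "\<alpha> i \<le> (\<Sum>i\<in>UNIV. \<alpha> i)" for \<alpha> :: "'n \<Rightarrow> nat" and i by (rule member_le_sum) auto
  then show "{\<alpha> :: 'n \<Rightarrow> nat. (\<Sum>i\<in>UNIV. \<alpha> i) \<le> k} \<subseteq> UNIV \<rightarrow>\<^sub>E {..k}"
    by (auto simp: PiE_UNIV_domain intro: order_trans)
  show "finite ((UNIV :: 'n set) \<rightarrow>\<^sub>E {..k})" by (rule finite_PiE) auto
qed

text \<open>Choosing a cell of the mesh for each point makes the shape functions of different cells
  disjointly supported, so that the field is the sum of its restrictions.\<close>

lemma fe_velocity_finite_span:
  fixes \<Omega> :: "(real^'n) set"
  assumes \<Omega>: "open \<Omega>" and mesh: "simplicial_mesh \<Omega> \<sigma> \<T>"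
  shows "\<exists>B. finite B \<and> B \<subseteq> fe_velocity \<Omega> \<T> k \<and>
    (\<forall>v\<in>fe_velocity \<Omega> \<T> k. \<exists>w\<in>span B. \<forall>x\<in>\<Omega>. w x = v x)"
proof -
  let ?X = "fe_velocity \<Omega> \<T> k"
  have cover: "\<Union>\<T> = closure \<Omega>" using mesh by (simp add: simplicial_mesh_def)
  define I where "I = {\<alpha> :: 'n \<Rightarrow> nat. (\<Sum>i\<in>UNIV. \<alpha> i) \<le> k}"
  have I: "finite I" unfolding I_def by (rule finite_multi_indices)
  define cell where "cell x = (SOME T. T \<in> \<T> \<and> x \<in> T)" for x
  have cell: "cell x \<in> \<T>" "x \<in> cell x" if "x \<in> closure \<Omega>" for x
  proof -
    have "\<exists>T. T \<in> \<T> \<and> x \<in> T" using that cover by blast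
    then have "cell x \<in> \<T> \<and> x \<in> cell x" unfolding cell_def by (rule someI_ex)
    then show "cell x \<in> \<T>" "x \<in> cell x" by auto
  qed
  \<comment> \<open>A monomial times a unit vector, cut off to the points assigned to one cell.
    Atoms are discontinuous in general, so they need not be finite element fields.\<close>
  define atom :: "(real^'n) set \<times> ('n \<Rightarrow> nat) \<times> 'n \<Rightarrow> real^'n \<Rightarrow> real^'n" where
    "atom = (\<lambda>(T, \<alpha>, i) x. if x \<in> closure \<Omega> \<and> cell x = T then (\<Prod>j\<in>UNIV. (x $ j) ^ \<alpha> j) *\<^sub>R axis i 1 else 0)"
  define A where "A = atom ` (\<T> \<times> I \<times> UNIV)"
  have A: "finite A" unfolding A_def using I simplicial_mesh_compact(1)[OF mesh] by simp
  \<comment> \<open>Fields are arbitrary outside the closure of the domain; setting them to 0 there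
    makes the space of values finite-dimensional.\<close>
  define R :: "(real^'n \<Rightarrow> real^'n) \<Rightarrow> real^'n \<Rightarrow> real^'n" where
    "R v = (\<lambda>x. if x \<in> closure \<Omega> then v x else 0)" for v
  have R_eq: "R v x = v x" if "x \<in> \<Omega>" for v x
    using that closure_subset[of \<Omega>] by (auto simp: R_def)
  have RX: "R v \<in> ?X" if v: "v \<in> ?X" for v
  proof -
    have "v \<in> H10 \<Omega>" using v by (simp add: fe_velocity_def)
    then have "R v \<in> H10 \<Omega>" by (rule H10_cong) (simp add: R_eq)
    moreover have "continuous_on (closure \<Omega>) (R v)"
      using v by (subst continuous_on_cong[of _ "closure \<Omega>" _ v]) (auto simp: fe_velocity_def R_def)
    moreover have "\<exists>P. polynomial_field k P \<and> (\<forall>x\<in>T. R v x = P x)" if "T \<in> \<T>" for T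
    proof -
      have "R v x = v x" if "x \<in> T" for x using \<open>T \<in> \<T>\<close> that cover by (auto simp: R_def)
      then show ?thesis using v \<open>T \<in> \<T>\<close> by (auto simp: fe_velocity_def)
    qed
    ultimately show ?thesis by (simp add: fe_velocity_def)
  qed
  have R_span: "R v \<in> span A" if v: "v \<in> ?X" for v
  proof -
    have "\<forall>T\<in>\<T>. \<exists>c. \<forall>x\<in>T. v x = (\<Sum>\<alpha>\<in>I. (\<Prod>i\<in>UNIV. (x $ i) ^ \<alpha> i) *\<^sub>R c \<alpha>)"
      using v unfolding fe_velocity_def polynomial_field_def I_def by fastforce
    then obtain c where c: "\<And>T x. T \<in> \<T> \<Longrightarrow> x \<in> T \<Longrightarrow>
        v x = (\<Sum>\<alpha>\<in>I. (\<Prod>i\<in>UNIV. (x $ i) ^ \<alpha> i) *\<^sub>R c T \<alpha>)"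
      using bchoice[of \<T>] by metis
    have "R v = (\<Sum>T\<in>\<T>. \<Sum>\<alpha>\<in>I. \<Sum>i\<in>UNIV. (c T \<alpha> $ i) *\<^sub>R atom (T, \<alpha>, i))" (is "_ = ?S")
    proof
      fix x
      have S: "?S x = (\<Sum>T\<in>\<T>. \<Sum>\<alpha>\<in>I. \<Sum>i\<in>UNIV. (c T \<alpha> $ i) *\<^sub>R atom (T, \<alpha>, i) x)"
        by (simp add: sum_fun_apply)
      show "R v x = ?S x"
      proof (cases "x \<in> closure \<Omega>")
        case False
        then show ?thesis unfolding S by (simp add: R_def atom_def)
      next
        case True
        have expand: "(\<Sum>i\<in>UNIV. (z $ i) *\<^sub>R (m *\<^sub>R axis i 1)) = m *\<^sub>R z" for m and z :: "real^'n"
          by (simp add: vec_eq_iff axis_def if_distrib mult.commute cong: if_cong)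
        have "?S x = (\<Sum>T\<in>\<T>. if T = cell x then \<Sum>\<alpha>\<in>I. (\<Prod>j\<in>UNIV. (x $ j) ^ \<alpha> j) *\<^sub>R c T \<alpha> else 0)"
          unfolding S using True by (intro sum.cong) (auto simp: atom_def expand simp del: scaleR_scaleR)
        also have "\<dots> = v x"
          using simplicial_mesh_compact(1)[OF mesh] cell[OF True] c[of "cell x" x] by (simp add: sum.delta)
        finally show ?thesis using True by (simp add: R_def)
      qed
    qed
    moreover have "?S \<in> span A"
      by (intro span_sum span_scale span_base) (auto simp: A_def)
    ultimately show ?thesis by simp
  qed
  \<comment> \<open>The atoms only bound the dimension. The spanning set is drawn from the cut-off
    fields themselves, and it is finite because it is independent inside the span of finitely many
    atoms.\<close>
  obtain B where B: "B \<subseteq> R ` ?X" "independent B" "R ` ?X \<subseteq> span B"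
    using maximal_independent_subset[of "R ` ?X"] by blast
  have "finite B"
    using independent_span_bound[OF A B(2)] B(1) R_span by blast
  moreover have "B \<subseteq> ?X" using B(1) RX by blast
  moreover have "\<exists>w\<in>span B. \<forall>x\<in>\<Omega>. w x = v x" if "v \<in> ?X" for v
    using B(3) that R_eq by (intro bexI[of _ "R v"]) auto
  ultimately show ?thesis by blast
qed

text \<open>Membership in the dual gives some constant \<open>C\<close>, so the supremum is over a
  bounded set and is attained as an upper bound. If the gradient norm of \<open>v\<close> is 0, the
  quotient carries no information and \<open>f v = 0\<close> follows from \<open>C\<close>
  instead.\<close>

lemma dual_norm_bound:
  assumes f: "f \<in> H10_dual \<Omega>" and v: "v \<in> H10 \<Omega>"
  shows "\<bar>f v\<bar> \<le> dual_norm \<Omega> f * L2_norm \<Omega> (grad \<Omega> v)" "0 \<le> dual_norm \<Omega> f"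
proof -
  obtain C where C: "\<And>v. v \<in> H10 \<Omega> \<Longrightarrow> \<bar>f v\<bar> \<le> C * L2_norm \<Omega> (grad \<Omega> v)"
    using f unfolding H10_dual_def by blast
  have "bdd_above ((\<lambda>v. \<bar>f v\<bar> / L2_norm \<Omega> (grad \<Omega> v)) ` H10 \<Omega>)"
  proof (rule bdd_aboveI2)
    \<comment> \<open>The maximum with 0 covers the quotient \<open>0 / 0 = 0\<close>, as nothing
      prevents \<open>C\<close> from being negative when all gradient norms vanish.\<close>
    show "\<bar>f v\<bar> / L2_norm \<Omega> (grad \<Omega> v) \<le> max 0 C" if "v \<in> H10 \<Omega>" for v
    proof (cases "L2_norm \<Omega> (grad \<Omega> v) = 0")
      case False
      then have "L2_norm \<Omega> (grad \<Omega> v) > 0" using L2_norm_nonneg[of \<Omega> "grad \<Omega> v"] by simp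
      then have "\<bar>f v\<bar> / L2_norm \<Omega> (grad \<Omega> v) \<le> C" using C[OF that] by (simp add: field_simps)
      then show ?thesis by simp
    qed simp
  qed
  then have le: "\<bar>f v\<bar> / L2_norm \<Omega> (grad \<Omega> v) \<le> dual_norm \<Omega> f"
    unfolding dual_norm_def by (rule cSUP_upper[OF v])
  show "0 \<le> dual_norm \<Omega> f"
    by (rule order_trans[OF _ le]) (simp add: L2_norm_nonneg)
  show "\<bar>f v\<bar> \<le> dual_norm \<Omega> f * L2_norm \<Omega> (grad \<Omega> v)"
  proof (cases "L2_norm \<Omega> (grad \<Omega> v) = 0")
    case True
    then show ?thesis using C[OF v] by simp
  next
    case False
    then have "L2_norm \<Omega> (grad \<Omega> v) > 0" using L2_norm_nonneg[of \<Omega> "grad \<Omega> v"] by simp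
    then show ?thesis using le by (simp add: field_simps)
  qed
qed

section \<open>The finite element problem as an instance of the abstract one\<close>

theorem lemma3p8:
  fixes \<Omega> :: "(real^'n) set" and \<T> :: "(real^'n) set set"
    and f :: "(real^'n \<Rightarrow> real^'n) \<Rightarrow> real"
    and \<sigma> C\<^sub>P M \<nu> \<epsilon> \<kappa> :: real and k :: nat
    and X\<^sub>h :: "(real^'n \<Rightarrow> real^'n) set" and Q\<^sub>h :: "(real^'n \<Rightarrow> real) set"
    and C\<^sub>L C\<^sub>L' :: "(real^'n \<Rightarrow> real) \<Rightarrow> real"
    and G :: "(real^'n \<Rightarrow> real^'n) \<times> (real^'n \<Rightarrow> real) \<Rightarrow> (real^'n \<Rightarrow> real^'n) \<times> (real^'n \<Rightarrow> real)"
    and G' :: "(real^'n \<Rightarrow> real^'n) \<times> (real^'n \<Rightarrow> real) \<Rightarrow> (real^'n \<Rightarrow> real^'n) \<times> (real^'n \<Rightarrow> real) \<Rightarrow>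
               (real^'n \<Rightarrow> real^'n) \<times> (real^'n \<Rightarrow> real)"
  assumes dim: "CARD('n) = 2 \<or> CARD('n) = 3"
    and domain: "open \<Omega>" "connected \<Omega>" "\<Omega> \<noteq> {}" "lipschitz_boundary \<Omega>"
    and poincare: "\<forall>\<phi>\<in>H10 \<Omega>. L2_norm \<Omega> \<phi> \<le> C\<^sub>P * L2_norm \<Omega> (grad \<Omega> \<phi>)"
    and mesh: "simplicial_mesh \<Omega> \<sigma> \<T>"
    and Xh: "X\<^sub>h = fe_velocity \<Omega> \<T> k"
    and Qh: "Q\<^sub>h = fe_pressure \<Omega> X\<^sub>h"
    and M: "M > 0"
      "\<forall>u\<in>H10 \<Omega>. \<forall>v\<in>H10 \<Omega>. \<forall>w\<in>H10 \<Omega>.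
         bstar \<Omega> u v w \<le> M * L2_norm \<Omega> (grad \<Omega> u) * L2_norm \<Omega> (grad \<Omega> v) * L2_norm \<Omega> (grad \<Omega> w)"
    and params: "\<nu> > 0" "\<epsilon> > 0" "f \<in> H10_dual \<Omega>"
    and \<kappa>: "\<kappa> = M * dual_norm \<Omega> f / \<nu>\<^sup>2"
    and C\<^sub>L: "\<And>p. C\<^sub>L p = max 1 (\<kappa> + sqrt (\<epsilon> / \<nu>^3) * M * L2_norm \<Omega> p)"
    and C\<^sub>L': "\<And>p. C\<^sub>L' p = sqrt 10 * \<nu> powr (-3/2) * M * C\<^sub>L p"
    and G: "G = picard \<Omega> X\<^sub>h Q\<^sub>h \<nu> \<epsilon> f"
    and G': "G' = picard_deriv \<Omega> X\<^sub>h Q\<^sub>h \<nu> \<epsilon> f"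
  shows
    "(\<forall>u\<in>X\<^sub>h. \<forall>p\<in>Q\<^sub>h. \<forall>h\<in>X\<^sub>h. \<forall>s\<in>Q\<^sub>h.
        \<exists>g r. picard_deriv_system \<Omega> X\<^sub>h Q\<^sub>h \<nu> \<epsilon> f (u, p) (h, s) (g, r) \<and>
          (\<forall>g' r'. picard_deriv_system \<Omega> X\<^sub>h Q\<^sub>h \<nu> \<epsilon> f (u, p) (h, s) (g', r') \<longrightarrow>
             ae_eq \<Omega> g' g \<and> ae_eq \<Omega> r' r)) \<and>
     (\<forall>u\<in>X\<^sub>h. \<forall>p\<in>Q\<^sub>h.
        frechet_derivative_on (norm_X \<Omega> \<nu> \<epsilon>) (X\<^sub>h \<times> Q\<^sub>h) G (G' (u, p)) (u, p)) \<and>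
     (\<forall>u\<in>X\<^sub>h. \<forall>p\<in>Q\<^sub>h. \<forall>h\<in>X\<^sub>h. \<forall>s\<in>Q\<^sub>h.
        norm_X \<Omega> \<nu> \<epsilon> (G' (u, p) (h, s)) \<le> C\<^sub>L p * norm_X \<Omega> \<nu> \<epsilon> (h, s)) \<and>
     (\<forall>u\<in>X\<^sub>h. \<forall>p\<in>Q\<^sub>h. \<forall>h\<in>X\<^sub>h. \<forall>s\<in>Q\<^sub>h. \<forall>w\<in>X\<^sub>h. \<forall>z\<in>Q\<^sub>h.
        norm_X \<Omega> \<nu> \<epsilon> (G' (u + h, p + s) (w, z) - G' (u, p) (w, z))
          \<le> C\<^sub>L' p * norm_X \<Omega> \<nu> \<epsilon> (w, z) * norm_X \<Omega> \<nu> \<epsilon> (h, s))"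
proof -
  note compact = simplicial_mesh_compact(2)[OF mesh]
  interpret S: bounded_H10_subspace \<Omega> X\<^sub>h
  proof
    show "subspace X\<^sub>h" unfolding Xh by (rule subspace_fe_velocity[OF domain(1)])
    show "X\<^sub>h \<subseteq> H10 \<Omega>" unfolding Xh by (auto simp: fe_velocity_def)
    show "\<exists>B. \<forall>x\<in>\<Omega>. norm (u x) \<le> B" if "u \<in> X\<^sub>h" for u
      using fe_velocity_bounded[OF compact that[unfolded Xh]] .
  qed (rule domain)
  obtain B where B: "finite B" "B \<subseteq> X\<^sub>h" "\<forall>v\<in>X\<^sub>h. \<exists>w\<in>span B. \<forall>x\<in>\<Omega>. w x = v x"
    using fe_velocity_finite_span[OF domain(1) mesh, of k] unfolding Xh by blast
  define a where "a = (\<lambda>u v. L2_inner \<Omega> (grad \<Omega> u) (grad \<Omega> v))"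
  have a_apply: "a u v = L2_inner \<Omega> (grad \<Omega> u) (grad \<Omega> v)" for u v by (simp add: a_def)
  have aX: "semi_inner_product X\<^sub>h a" unfolding a_def by (rule S.grad_form_semi_inner_product)
  have cQ: "semi_inner_product Q\<^sub>h (L2_inner \<Omega>)" unfolding Qh by (rule S.fe_pressure_semi_inner_product)
  have a_norm: "semi_inner_product.seminorm a u = L2_norm \<Omega> (grad \<Omega> u)" for u
    by (simp add: semi_inner_product.seminorm_def[OF aX] a_apply L2_norm_def)
  have c_norm: "semi_inner_product.seminorm (L2_inner \<Omega>) q = L2_norm \<Omega> q" for q :: "real^'n \<Rightarrow> real"
    by (simp add: semi_inner_product.seminorm_def[OF cQ] L2_norm_def)
  have H10: "v \<in> H10 \<Omega>" if "v \<in> X\<^sub>h" for v using that S.X(2) by blast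
  interpret P: penalty_picard X\<^sub>h a Q\<^sub>h "L2_inner \<Omega>" "divergence \<Omega>" "bstar \<Omega>" M \<nu> \<epsilon> B f "dual_norm \<Omega> f"
  proof (intro penalty_picard.intro penalty_problem.intro penalty_problem_axioms.intro penalty_picard_axioms.intro
      aX cQ, unfold a_norm c_norm)
    show "divergence \<Omega> u \<in> Q\<^sub>h" if "u \<in> X\<^sub>h" for u
      unfolding Qh by (rule S.divergence_fe_pressure[OF that])
    show "linear_form_on X\<^sub>h (\<lambda>u. L2_inner \<Omega> (divergence \<Omega> u) q)" if "q \<in> Q\<^sub>h" for q
      by (rule S.linear_divergence_form[OF that[unfolded Qh]])
    show "linear_form_on X\<^sub>h (\<lambda>u. bstar \<Omega> u v w)" "linear_form_on X\<^sub>h (\<lambda>u. bstar \<Omega> v u w)"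
      "linear_form_on X\<^sub>h (\<lambda>u. bstar \<Omega> v w u)" if "v \<in> X\<^sub>h" "w \<in> X\<^sub>h" for v w
      using S.linear_bstar[OF that] .
    show "bstar \<Omega> u v v = 0" for u v by (simp add: bstar_def)
    show "bstar \<Omega> u v w \<le> M * L2_norm \<Omega> (grad \<Omega> u) * L2_norm \<Omega> (grad \<Omega> v) * L2_norm \<Omega> (grad \<Omega> w)"
      if "u \<in> X\<^sub>h" "v \<in> X\<^sub>h" "w \<in> X\<^sub>h" for u v w
      using M(2) H10 that by simp
    \<comment> \<open>\<open>B\<close> reproduces \<open>v\<close> only on the domain;
      \<open>v - w\<close> need not be 0, but its gradient and divergence vanish almost
      everywhere.\<close>
    show "\<exists>w\<in>span B. L2_norm \<Omega> (grad \<Omega> (v - w)) = 0 \<and> L2_norm \<Omega> (divergence \<Omega> (v - w)) = 0"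
      if v: "v \<in> X\<^sub>h" for v
    proof -
      obtain w where w: "w \<in> span B" "\<And>x. x \<in> \<Omega> \<Longrightarrow> w x = v x" using B(3) v by blast
      have wX: "w \<in> X\<^sub>h" using w(1) span_minimal[OF B(2) S.X(1)] by blast
      have vw: "v - w \<in> X\<^sub>h" using subspace_diff[OF S.X(1) v wX] .
      have g: "ae_eq \<Omega> (grad \<Omega> (v - w)) (\<lambda>x. 0)" by (rule S.grad_diff_eq_on[OF v wX]) (simp add: w(2))
      have "ae_eq \<Omega> (divergence \<Omega> (v - w)) (\<lambda>x. 0)"
        using g unfolding ae_eq_def by (rule eventually_mono) (simp add: divergence_def trace_def)
      then show ?thesis
        using g L2_norm_eq_0[OF grad_works(1)[OF S.X_H1[OF vw]]] L2_norm_eq_0[OF divergence_L2[OF S.X_H1[OF vw]]] w(1)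
        by blast
    qed
    show "linear_form_on X\<^sub>h f"
      by (rule linear_form_on_if_combinations) (use params(3) H10 in \<open>simp add: H10_dual_def\<close>)
    show "\<bar>f v\<bar> \<le> dual_norm \<Omega> f * L2_norm \<Omega> (grad \<Omega> v)" if "v \<in> X\<^sub>h" for v
      by (rule dual_norm_bound(1)[OF params(3) H10[OF that]])
    show "0 \<le> dual_norm \<Omega> f"
      by (rule dual_norm_bound(2)[OF params(3) zero_H10[OF domain(1)]])
  qed (use B M params in auto)
  have energy_norm: "P.energy_norm = norm_X \<Omega> \<nu> \<epsilon>"
    by (simp add: fun_eq_iff P.energy_norm_def norm_X_def a_norm c_norm)
  have bound: "P.Lipschitz_bound p = C\<^sub>L p" for p
    by (simp add: P.Lipschitz_bound_def C\<^sub>L \<kappa> c_norm)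
  have picard_iff: "picard_system \<Omega> X\<^sub>h Q\<^sub>h \<nu> \<epsilon> f (u, p) gr \<longleftrightarrow> P.solves u f p gr" for u p gr
    by (cases gr) (simp add: picard_system_def P.solves_def a_apply)
  \<comment> \<open>The convective term with direction \<open>h\<close> does not contain the
    unknown, so it is a source for the same left-hand side.\<close>
  have deriv_iff: "picard_deriv_system \<Omega> X\<^sub>h Q\<^sub>h \<nu> \<epsilon> f (u, p) (h, s) gr \<longleftrightarrow>
      P.solves u (\<lambda>v. - bstar \<Omega> h (fst (G (u, p))) v) s gr" for u p h s gr
    by (cases gr) (auto simp: picard_deriv_system_def P.solves_def a_apply G L2_inner_commute algebra_simps eq_neg_iff_add_eq_0)
  have G_solves: "P.solves u f p (G (u, p))" if "u \<in> X\<^sub>h" "p \<in> Q\<^sub>h" for u p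
  proof -
    have "\<exists>gr. picard_system \<Omega> X\<^sub>h Q\<^sub>h \<nu> \<epsilon> f (u, p) gr"
      using P.solves_exists[OF that P.f_lin P.f_bound] by (auto simp: picard_iff)
    then have "picard_system \<Omega> X\<^sub>h Q\<^sub>h \<nu> \<epsilon> f (u, p) (G (u, p))"
      unfolding G picard_def by (rule someI_ex)
    then show ?thesis by (simp add: picard_iff)
  qed
  have G_in: "fst (G (u, p)) \<in> X\<^sub>h" if "u \<in> X\<^sub>h" "p \<in> Q\<^sub>h" for u p
    using G_solves[OF that] by (auto simp: P.solves_def split: prod.splits)
  have deriv_exists: "\<exists>g r. P.solves u (\<lambda>v. - bstar \<Omega> h (fst (G (u, p))) v) s (g, r)"
    if "u \<in> X\<^sub>h" "p \<in> Q\<^sub>h" "h \<in> X\<^sub>h" "s \<in> Q\<^sub>h" for u p h s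
    using P.solves_convection_exists[OF that(1,4,3) G_in[OF that(1,2)]] .
  have G'_solves: "P.solves u (\<lambda>v. - bstar \<Omega> h (fst (G (u, p))) v) s (G' (u, p) (h, s))"
    if "u \<in> X\<^sub>h" "p \<in> Q\<^sub>h" "h \<in> X\<^sub>h" "s \<in> Q\<^sub>h" for u p h s
  proof -
    have "\<exists>gr. picard_deriv_system \<Omega> X\<^sub>h Q\<^sub>h \<nu> \<epsilon> f (u, p) (h, s) gr"
      using deriv_exists[OF that] by (auto simp: deriv_iff)
    then have "picard_deriv_system \<Omega> X\<^sub>h Q\<^sub>h \<nu> \<epsilon> f (u, p) (h, s) (G' (u, p) (h, s))"
      unfolding G' picard_deriv_def by (rule someI_ex)
    then show ?thesis by (simp add: deriv_iff)
  qed
  have solves_in: "gr \<in> X\<^sub>h \<times> Q\<^sub>h" if "P.solves u l p gr" for u l p gr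
    using that by (cases gr) (simp add: P.solves_def)
  have add_in: "u + h \<in> X\<^sub>h" "p + s \<in> Q\<^sub>h" if "u \<in> X\<^sub>h" "p \<in> Q\<^sub>h" "h \<in> X\<^sub>h" "s \<in> Q\<^sub>h" for u h p s
    using that P.X.subsp P.Q.subsp by (auto simp: subspace_add)
  have unique: "ae_eq \<Omega> g' g \<and> ae_eq \<Omega> r' r"
    if 1: "P.solves u l p (g, r)" and 2: "P.solves u l p (g', r')" and up: "u \<in> X\<^sub>h" "p \<in> Q\<^sub>h" for u l p g r g' r'
  proof -
    have in_spaces: "g \<in> X\<^sub>h" "r \<in> Q\<^sub>h" "g' \<in> X\<^sub>h" "r' \<in> Q\<^sub>h" using solves_in[OF 1] solves_in[OF 2] by auto
    have zero: "L2_norm \<Omega> (grad \<Omega> (g' - g)) = 0" "L2_norm \<Omega> (r' - r) = 0"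
      using P.solves_unique[OF 2 1 up] by (simp_all add: P.energy_norm_eq_0 a_norm c_norm)
    \<comment> \<open>The energy norm sees velocities through their gradients alone; the Poincare
      inequality turns a vanishing gradient into equality almost everywhere.\<close>
    have "L2_norm \<Omega> (g' - g) \<le> C\<^sub>P * L2_norm \<Omega> (grad \<Omega> (g' - g))"
      using poincare H10[OF subspace_diff[OF P.X.subsp in_spaces(3,1)]] by blast
    then have "L2_norm \<Omega> (g' - g) = 0" using zero L2_norm_nonneg[of \<Omega> "g' - g"] by simp
    moreover have "r \<in> L2 \<Omega>" "r' \<in> L2 \<Omega>" using in_spaces S.fe_pressure_L2 unfolding Qh by auto
    ultimately show ?thesis
      using zero in_spaces by (simp add: ae_eq_iff_norm_diff S.X_L2)
  qed
  have well_defined: "\<exists>g r. picard_deriv_system \<Omega> X\<^sub>h Q\<^sub>h \<nu> \<epsilon> f (u, p) (h, s) (g, r) \<and>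
      (\<forall>g' r'. picard_deriv_system \<Omega> X\<^sub>h Q\<^sub>h \<nu> \<epsilon> f (u, p) (h, s) (g', r') \<longrightarrow> ae_eq \<Omega> g' g \<and> ae_eq \<Omega> r' r)"
    if in_spaces: "u \<in> X\<^sub>h" "p \<in> Q\<^sub>h" "h \<in> X\<^sub>h" "s \<in> Q\<^sub>h" for u p h s
  proof -
    obtain g r where gr: "P.solves u (\<lambda>v. - bstar \<Omega> h (fst (G (u, p))) v) s (g, r)"
      using deriv_exists[OF in_spaces] by blast
    show ?thesis
      unfolding deriv_iff using gr unique[OF gr _ in_spaces(1,4)] by blast
  qed
  have G'_bound: "norm_X \<Omega> \<nu> \<epsilon> (G' (u, p) (h, s)) \<le> C\<^sub>L p * norm_X \<Omega> \<nu> \<epsilon> (h, s)"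
    if in_spaces: "u \<in> X\<^sub>h" "p \<in> Q\<^sub>h" "h \<in> X\<^sub>h" "s \<in> Q\<^sub>h" for u p h s
    using P.convection_estimate[of u p "fst (G (u, p))" "snd (G (u, p))" u h s "fst (G' (u, p) (h, s))" "snd (G' (u, p) (h, s))"]
      G_solves[OF in_spaces(1,2)] G'_solves[OF in_spaces] in_spaces
    by (simp add: bound energy_norm)
  have remainder: "norm_X \<Omega> \<nu> \<epsilon> (G ((u, p) + (h, s)) - G (u, p) - G' (u, p) (h, s))
      \<le> M / (\<nu> * sqrt \<nu>) * C\<^sub>L p * norm_X \<Omega> \<nu> \<epsilon> (h, s) * norm_X \<Omega> \<nu> \<epsilon> (h, s)"
    if in_spaces: "u \<in> X\<^sub>h" "p \<in> Q\<^sub>h" "h \<in> X\<^sub>h" "s \<in> Q\<^sub>h" for u p h s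
    using P.remainder_estimate[of u p "fst (G (u, p))" "snd (G (u, p))" h s
        "fst (G (u + h, p + s))" "snd (G (u + h, p + s))" "fst (G' (u, p) (h, s))" "snd (G' (u, p) (h, s))"]
      G_solves[OF in_spaces(1,2)] G_solves[OF add_in[OF in_spaces]] G'_solves[OF in_spaces] in_spaces
    by (simp add: bound energy_norm flip: fst_diff snd_diff)
  have nn: "0 \<le> norm_X \<Omega> \<nu> \<epsilon> (h, s)" if "h \<in> X\<^sub>h" "s \<in> Q\<^sub>h" for h s
    using P.energy_norm_nonneg[OF that] by (simp add: energy_norm)
  have C\<^sub>L_pos: "0 < C\<^sub>L p" for p unfolding C\<^sub>L by simp
  have frechet: "frechet_derivative_on (norm_X \<Omega> \<nu> \<epsilon>) (X\<^sub>h \<times> Q\<^sub>h) G (G' (u, p)) (u, p)"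
    if up: "u \<in> X\<^sub>h" "p \<in> Q\<^sub>h" for u p
    unfolding frechet_derivative_on_def
  proof (intro conjI ballI allI impI)
    show "G' (u, p) h \<in> X\<^sub>h \<times> Q\<^sub>h" if "h \<in> X\<^sub>h \<times> Q\<^sub>h" for h
      using that solves_in[OF G'_solves[OF up]] by (cases h) auto
    \<comment> \<open>The derivative at a combination and the combination of derivatives are
      independently chosen solutions of one system, so uniqueness yields linearity modulo the kernel
      of the norm.\<close>
    show "norm_X \<Omega> \<nu> \<epsilon> (G' (u, p) (x *\<^sub>R h + y *\<^sub>R k) - (x *\<^sub>R G' (u, p) h + y *\<^sub>R G' (u, p) k)) = 0"
      if hk: "h \<in> X\<^sub>h \<times> Q\<^sub>h" "k \<in> X\<^sub>h \<times> Q\<^sub>h" for h k x y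
    proof -
      obtain h1 s k1 t where eq: "h = (h1, s)" "k = (k1, t)" by (cases h, cases k)
      have in_spaces: "h1 \<in> X\<^sub>h" "s \<in> Q\<^sub>h" "k1 \<in> X\<^sub>h" "t \<in> Q\<^sub>h" using hk eq by auto
      have comb: "x *\<^sub>R h1 + y *\<^sub>R k1 \<in> X\<^sub>h" "x *\<^sub>R s + y *\<^sub>R t \<in> Q\<^sub>h"
        using in_spaces P.X.subsp P.Q.subsp by (auto simp: subspace_add subspace_scale)
      let ?G = "fst (G (u, p))"
      have "P.solves u (\<lambda>v. x * (- bstar \<Omega> h1 ?G v) + y * (- bstar \<Omega> k1 ?G v)) (x *\<^sub>R s + y *\<^sub>R t)
          (x *\<^sub>R fst (G' (u, p) h) + y *\<^sub>R fst (G' (u, p) k), x *\<^sub>R snd (G' (u, p) h) + y *\<^sub>R snd (G' (u, p) k))"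
        by (rule P.solves_combination) (use G'_solves[OF up] in_spaces up in \<open>simp_all add: eq\<close>)
      then have 1: "P.solves u (\<lambda>v. - bstar \<Omega> (x *\<^sub>R h1 + y *\<^sub>R k1) ?G v) (x *\<^sub>R s + y *\<^sub>R t)
          (x *\<^sub>R fst (G' (u, p) h) + y *\<^sub>R fst (G' (u, p) k), x *\<^sub>R snd (G' (u, p) h) + y *\<^sub>R snd (G' (u, p) k))"
      proof (rule P.solves_cong)
        fix v assume v: "v \<in> X\<^sub>h"
        note lin = P.b_lin1[OF G_in[OF up] v]
        show "x * (- bstar \<Omega> h1 ?G v) + y * (- bstar \<Omega> k1 ?G v) = - bstar \<Omega> (x *\<^sub>R h1 + y *\<^sub>R k1) ?G v"
          using linear_form_on_add[OF lin subspace_scale[OF P.X.subsp in_spaces(1)] subspace_scale[OF P.X.subsp in_spaces(3)]]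
            linear_form_on_scaleR[OF lin in_spaces(1)] linear_form_on_scaleR[OF lin in_spaces(3)] by simp
      qed
      have 2: "P.solves u (\<lambda>v. - bstar \<Omega> (x *\<^sub>R h1 + y *\<^sub>R k1) ?G v) (x *\<^sub>R s + y *\<^sub>R t)
          (fst (G' (u, p) (x *\<^sub>R h + y *\<^sub>R k)), snd (G' (u, p) (x *\<^sub>R h + y *\<^sub>R k)))"
        using G'_solves[OF up comb] by (simp add: eq)
      have "(fst (G' (u, p) (x *\<^sub>R h + y *\<^sub>R k)) - (x *\<^sub>R fst (G' (u, p) h) + y *\<^sub>R fst (G' (u, p) k)),
          snd (G' (u, p) (x *\<^sub>R h + y *\<^sub>R k)) - (x *\<^sub>R snd (G' (u, p) h) + y *\<^sub>R snd (G' (u, p) k)))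
        = G' (u, p) (x *\<^sub>R h + y *\<^sub>R k) - (x *\<^sub>R G' (u, p) h + y *\<^sub>R G' (u, p) k)"
        by (rule prod_eqI) simp_all
      then show ?thesis using P.solves_unique[OF 2 1 up(1) comb(2)] by (simp add: energy_norm)
    qed
    show "\<exists>C. \<forall>h\<in>X\<^sub>h \<times> Q\<^sub>h. norm_X \<Omega> \<nu> \<epsilon> (G' (u, p) h) \<le> C * norm_X \<Omega> \<nu> \<epsilon> h"
      using G'_bound[OF up] by (intro exI[of _ "C\<^sub>L p"]) auto
    fix e :: real assume e: "e > 0"
    define K where "K = M / (\<nu> * sqrt \<nu>) * C\<^sub>L p"
    have K: "K > 0" unfolding K_def using M(1) params(1) C\<^sub>L_pos by simp
    show "\<exists>\<delta>>0. \<forall>h\<in>X\<^sub>h \<times> Q\<^sub>h. norm_X \<Omega> \<nu> \<epsilon> h < \<delta> \<longrightarrow>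
        norm_X \<Omega> \<nu> \<epsilon> (G ((u, p) + h) - G (u, p) - G' (u, p) h) \<le> e * norm_X \<Omega> \<nu> \<epsilon> h"
    \<comment> \<open>The remainder is at most \<open>K\<close> times the square of the norm of
      \<open>h\<close>, which is below \<open>e\<close> times that norm as soon as the norm is below
      \<open>e / K\<close>.\<close>
    proof (intro exI[of _ "e / K"] conjI ballI impI)
      fix h assume h: "h \<in> X\<^sub>h \<times> Q\<^sub>h" "norm_X \<Omega> \<nu> \<epsilon> h < e / K"
      obtain h1 s where eq: "h = (h1, s)" by (cases h)
      have in_spaces: "h1 \<in> X\<^sub>h" "s \<in> Q\<^sub>h" using h eq by auto
      have "norm_X \<Omega> \<nu> \<epsilon> (G ((u, p) + h) - G (u, p) - G' (u, p) h) \<le> K * norm_X \<Omega> \<nu> \<epsilon> h * norm_X \<Omega> \<nu> \<epsilon> h"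
        unfolding K_def eq by (rule remainder[OF up in_spaces])
      also have "\<dots> \<le> e * norm_X \<Omega> \<nu> \<epsilon> h"
        using h(2) K nn[OF in_spaces] by (intro mult_right_mono) (auto simp: eq field_simps)
      finally show "norm_X \<Omega> \<nu> \<epsilon> (G ((u, p) + h) - G (u, p) - G' (u, p) h) \<le> e * norm_X \<Omega> \<nu> \<epsilon> h" .
    qed (use e K in simp)
  qed
  have Lipschitz: "norm_X \<Omega> \<nu> \<epsilon> (G' (u + h, p + s) (w, z) - G' (u, p) (w, z))
      \<le> C\<^sub>L' p * norm_X \<Omega> \<nu> \<epsilon> (w, z) * norm_X \<Omega> \<nu> \<epsilon> (h, s)"
    if in_spaces: "u \<in> X\<^sub>h" "p \<in> Q\<^sub>h" "h \<in> X\<^sub>h" "s \<in> Q\<^sub>h" and wz: "w \<in> X\<^sub>h" "z \<in> Q\<^sub>h" for u p h s w z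
  proof -
    have "norm_X \<Omega> \<nu> \<epsilon> (G' (u + h, p + s) (w, z) - G' (u, p) (w, z))
      \<le> 2 * (M / (\<nu> * sqrt \<nu>)) * C\<^sub>L p * norm_X \<Omega> \<nu> \<epsilon> (w, z) * norm_X \<Omega> \<nu> \<epsilon> (h, s)"
      using P.derivative_Lipschitz[of u p "fst (G (u, p))" "snd (G (u, p))" h s
          "fst (G (u + h, p + s))" "snd (G (u + h, p + s))" w z "fst (G' (u, p) (w, z))" "snd (G' (u, p) (w, z))"
          "fst (G' (u + h, p + s) (w, z))" "snd (G' (u + h, p + s) (w, z))"]
        G_solves[OF in_spaces(1,2)] G_solves[OF add_in[OF in_spaces]] G'_solves[OF in_spaces(1,2) wz]
        G'_solves[OF add_in[OF in_spaces] wz] in_spaces wz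
      by (simp add: bound energy_norm flip: fst_diff snd_diff)
    also have "\<dots> \<le> C\<^sub>L' p * norm_X \<Omega> \<nu> \<epsilon> (w, z) * norm_X \<Omega> \<nu> \<epsilon> (h, s)"
    proof -
      have "\<nu> powr (- 3 / 2) = 1 / (\<nu> * sqrt \<nu>)"
      proof -
        have "\<nu> powr (3 / 2) = \<nu> powr 1 * \<nu> powr (1 / 2)" by (subst powr_add[symmetric]) simp
        then have "\<nu> powr (3 / 2) = \<nu> * sqrt \<nu>" using params(1) by (simp add: powr_half_sqrt)
        then show ?thesis by (simp add: powr_minus_divide[of \<nu> "3 / 2", simplified])
      qed
      then have C: "C\<^sub>L' p = sqrt 10 * (M / (\<nu> * sqrt \<nu>)) * C\<^sub>L p" by (simp add: C\<^sub>L')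
      \<comment> \<open>The abstract estimate has the constant 2, which the constant of the theorem
        dominates.\<close>
      have "2 \<le> sqrt (10 :: real)" by (rule real_le_rsqrt) simp
      then have "2 * (M / (\<nu> * sqrt \<nu>)) * C\<^sub>L p \<le> C\<^sub>L' p"
        unfolding C using M(1) params(1) less_imp_le[OF C\<^sub>L_pos] by (intro mult_right_mono) auto
      then show ?thesis using nn[OF wz] nn[OF in_spaces(3,4)] by (intro mult_right_mono)
    qed
    finally show ?thesis .
  qed
  show ?thesis
    by (intro conjI ballI well_defined frechet G'_bound Lipschitz)
qed

end
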